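(* Let $\mathfrak R$ be a split $C^\infty$-superring. There exists a bijective correspondence between Euler vector fields on $\mathfrak R$ and splittings of $\mathfrak R$.
   Context: A $C^\infty$-ring is a set $\mathfrak C$ with operations $\phi_f:\mathfrak C^n\to\mathfrak C$ for all $f\in C^\infty(\mathbb R^n)$, $n\in\mathbb N$, preserving coordinate projections and compositions of smooth functions; it is in particular a commutative $\mathbb R$-algebra. A superring is a $\mathbb Z_2$-graded unital supercommutative ring. A $C^\infty$-superring is a superring $\mathfrak R=\mathfrak R_{\bar 0}\oplus\mathfrak R_{\bar 1}$ whose even part carries a $C^\infty$-ring structure compatible with its ring structure. A morphism of $C^\infty$-superrings is a grading-preserving superring morphism whose restriction to even parts commutes with all the operations of the $C^\infty$-rings. For a $C^\infty$-ring $\mathfrak C$ and a free $\mathfrak C$-module $\xi$ with finite basis $\theta^1,\dots,\theta^q$, $\mathfrak C[\theta^1,\dots,\theta^q]^\pm:=\bigwedge_{\mathfrak C}\xi$ is a $C^\infty$-superring with the $\theta^i$ odd. An even element is $F=f+N$ with $f\in\mathfrak C$ and $N$ a $\mathfrak C$-combination of products of a positive even number of $\theta$'s, and the operations are $\Phi_h(F_1,\dots,F_k)=\sum_{n\ge0}\frac1{n!}\sum_{j_1,\dots,j_n}\phi_{\partial_{j_1}\cdots\partial_{j_n}h}(f_1,\dots,f_k)N_{j_1}\cdots N_{j_n}$. A $C^\infty$-superring is split if it is isomorphic to one of this form. The canonical superideal $\mathfrak J$ of $\mathfrak R$ is the ideal generated by $\mathfrak R_{\bar 1}$. $\operatorname{Gr}\mathfrak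 R=\bigoplus_{k\ge0}\mathfrak J^k/\mathfrak J^{k+1}$ is the associated graded $C^\infty$-superring, with parity equal to the degree mod 2 and with $C^\infty$-operations given by the same Taylor formula over $\mathfrak R/\mathfrak J$. An even superderivation is an $\mathbb R$-linear parity-preserving map $D:\mathfrak R\to\mathfrak R$ with $D(rs)=D(r)s+rD(s)$. An Euler vector field on $\mathfrak R$ is an even superderivation $E$ adapted to the $\mathfrak J$-adic filtration, i.e. $(E-k\,\mathrm{id}_{\mathfrak R})\mathfrak J^k\subset\mathfrak J^{k+1}$ for all $k\ge0$. For example, a presentation $\mathfrak R\cong\mathfrak C[\theta^1,\dots,\theta^q]^\pm$ gives the Euler vector field $E_\theta=\sum_{i=1}^q\theta^i\frac{\partial}{\partial\theta^i}$ associated with the basis $\{\theta^i\}$, where $\frac{\partial}{\partial\theta^i}$ is the odd superderivation that vanishes on $\mathfrak C$ and satisfies $\frac{\partial}{\partial\theta^i}(\theta^j)=\delta_i^j$. A splitting of $\mathfrak R$ is an isomorphism of $C^\infty$-superrings $\lambda:\mathfrak R\to\operatorname{Gr}\mathfrak R$ inducing the identity on $\operatorname{Gr}\mathfrak R$: for all $k\ge0$, $\mathrm{pr}_k\circ\lambda|_{\mathfrak J^k}=\pi_k$, where $\pi_k:\mathfrak J^k\to\mathfrak J^k/\mathfrak J^{k+1}$ is the canonical projection and $\mathrm{pr}_k$ is the projection of $\operatorname{Gr}\mathfrak R$ onto its degree-$k$ component.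
   Formalization: Euler vector fields are additionally required to satisfy the chain rule for all C^∞-operations on even elements; with only ℝ-linearity and the Leibniz rule the claim fails, e.g. for C[θ¹,θ²] with C the hyperreals as a quotient of C^∞(ℝ). *)

theory Defs
  imports "HOL-Analysis.Analysis" "HOL-Algebra.QuotRing" "HOL-Algebra.Ideal_Product"
begin

section \<open>Smooth functions on real n-space, with n varying\<close>

text \<open>
  A function on \<open>\<real>\<^sup>n\<close> is encoded as a function on real sequences that depends on the first n
  coordinates only. Continuity of such a function for the product topology of
  \<^typ>\<open>nat \<Rightarrow> real\<close> is the same as continuity on \<open>\<real>\<^sup>n\<close>.
\<close>

type_synonym rfun = "(nat \<Rightarrow> real) \<Rightarrow> real"

definition depends_on_first :: "nat \<Rightarrow> rfun \<Rightarrow> bool" where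
  "depends_on_first n f \<longleftrightarrow> (\<forall>x y. (\<forall>i<n. x i = y i) \<longrightarrow> f x = f y)"

definition partial :: "nat \<Rightarrow> rfun \<Rightarrow> rfun" where
  "partial i f = (\<lambda>x. deriv (\<lambda>t. f (x(i := t))) (x i))"

definition partials :: "nat list \<Rightarrow> rfun \<Rightarrow> rfun" where
  "partials js f = foldr partial js f"

definition smooth :: "nat \<Rightarrow> rfun \<Rightarrow> bool" where
  "smooth n f \<longleftrightarrow> depends_on_first n f \<and>
     (\<forall>js. set js \<subseteq> {..<n} \<longrightarrow>
        continuous_on UNIV (partials js f) \<and>
        (\<forall>i<n. \<forall>x. (\<lambda>t. partials js f (x(i := t))) field_differentiable (at (x i))))"


section \<open>Smooth rings\<close>

text \<open>
  The operations are one function of type \<open>'a cinf_ops\<close>. The arity is the length of the argument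
  list: for f smooth on \<open>\<real>\<^sup>n\<close>, the n-ary operation of f is \<open>\<phi> f\<close> on lists of length n.
\<close>

type_synonym 'a cinf_ops = "rfun \<Rightarrow> 'a list \<Rightarrow> 'a"

definition comp_smooth :: "rfun \<Rightarrow> rfun list \<Rightarrow> rfun" where
  "comp_smooth f gs = (\<lambda>x. f (\<lambda>i. if i < length gs then (gs ! i) x else 0))"

definition cinf_ring :: "'a set \<Rightarrow> 'a cinf_ops \<Rightarrow> bool" where
  "cinf_ring C \<phi> \<longleftrightarrow>
     (\<forall>f cs. smooth (length cs) f \<longrightarrow> set cs \<subseteq> C \<longrightarrow> \<phi> f cs \<in> C) \<and>
     (\<forall>cs i. set cs \<subseteq> C \<longrightarrow> i < length cs \<longrightarrow> \<phi> (\<lambda>x. x i) cs = cs ! i) \<and>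
     (\<forall>f gs cs. smooth (length gs) f \<longrightarrow> (\<forall>g\<in>set gs. smooth (length cs) g) \<longrightarrow> set cs \<subseteq> C \<longrightarrow>
        \<phi> (comp_smooth f gs) cs = \<phi> f (map (\<lambda>g. \<phi> g cs) gs))"

definition ring_of_cinf :: "'a set \<Rightarrow> 'a cinf_ops \<Rightarrow> 'a ring" where
  "ring_of_cinf C \<phi> =
     \<lparr>carrier = C,
      mult = (\<lambda>a b. \<phi> (\<lambda>x. x 0 * x 1) [a, b]),
      one = \<phi> (\<lambda>_. 1) [],
      zero = \<phi> (\<lambda>_. 0) [],
      add = (\<lambda>a b. \<phi> (\<lambda>x. x 0 + x 1) [a, b])\<rparr>"


section \<open>Smooth superrings\<close>

record 'a cinf_superstructure = "'a ring" +
  even_part :: "'a set"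
  odd_part :: "'a set"
  smooth_op :: "'a cinf_ops"

definition superring :: "('a, 'm) cinf_superstructure_scheme \<Rightarrow> bool" where
  "superring R \<longleftrightarrow> ring R \<and>
     additive_subgroup (even_part R) R \<and> additive_subgroup (odd_part R) R \<and>
     even_part R \<inter> odd_part R = {\<zero>\<^bsub>R\<^esub>} \<and>
     even_part R <+>\<^bsub>R\<^esub> odd_part R = carrier R \<and>
     \<one>\<^bsub>R\<^esub> \<in> even_part R \<and>
     (\<forall>a\<in>even_part R. \<forall>b\<in>even_part R. a \<otimes>\<^bsub>R\<^esub> b \<in> even_part R) \<and>
     (\<forall>a\<in>even_part R. \<forall>b\<in>odd_part R. a \<otimes>\<^bsub>R\<^esub> b \<in> odd_part R) \<and>
     (\<forall>a\<in>odd_part R. \<forall>b\<in>odd_part R. a \<otimes>\<^bsub>R\<^esub> b \<in> even_part R) \<and>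
     (\<forall>a\<in>even_part R. \<forall>b\<in>carrier R. a \<otimes>\<^bsub>R\<^esub> b = b \<otimes>\<^bsub>R\<^esub> a) \<and>
     (\<forall>a\<in>odd_part R. \<forall>b\<in>odd_part R. a \<otimes>\<^bsub>R\<^esub> b = \<ominus>\<^bsub>R\<^esub> (b \<otimes>\<^bsub>R\<^esub> a))"

definition cinf_superring :: "('a, 'm) cinf_superstructure_scheme \<Rightarrow> bool" where
  "cinf_superring R \<longleftrightarrow> superring R \<and>
     cinf_ring (even_part R) (smooth_op R) \<and>
     smooth_op R (\<lambda>_. 0) [] = \<zero>\<^bsub>R\<^esub> \<and> smooth_op R (\<lambda>_. 1) [] = \<one>\<^bsub>R\<^esub> \<and>
     (\<forall>a\<in>even_part R. \<forall>b\<in>even_part R.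
        smooth_op R (\<lambda>x. x 0 + x 1) [a, b] = a \<oplus>\<^bsub>R\<^esub> b \<and>
        smooth_op R (\<lambda>x. x 0 * x 1) [a, b] = a \<otimes>\<^bsub>R\<^esub> b)"

definition cinf_superring_hom ::
  "('a, 'm) cinf_superstructure_scheme \<Rightarrow> ('b, 'n) cinf_superstructure_scheme \<Rightarrow> ('a \<Rightarrow> 'b) \<Rightarrow> bool"
where
  "cinf_superring_hom R S h \<longleftrightarrow> h \<in> ring_hom R S \<and>
     h ` even_part R \<subseteq> even_part S \<and> h ` odd_part R \<subseteq> odd_part S \<and>
     (\<forall>f as. smooth (length as) f \<longrightarrow> set as \<subseteq> even_part R \<longrightarrow>
        h (smooth_op R f as) = smooth_op S f (map h as))"

definition cinf_superring_iso ::
  "('a, 'm) cinf_superstructure_scheme \<Rightarrow> ('b, 'n) cinf_superstructure_scheme \<Rightarrow> ('a \<Rightarrow> 'b) \<Rightarrow> bool"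
where
  "cinf_superring_iso R S h \<longleftrightarrow>
     cinf_superring_hom R S h \<and> bij_betw h (carrier R) (carrier S)"


section \<open>Smooth operations by Taylor expansion\<close>

text \<open>
  The value at \<open>(f\<^sub>0 + N\<^sub>0, \<dots>, f\<^sub>k\<^sub>-\<^sub>1 + N\<^sub>k\<^sub>-\<^sub>1)\<close> of the operation of h. The bodies \<open>fs\<close> lie in a smooth
  ring with operations \<open>\<phi>\<close>, which \<open>\<iota>\<close> maps into the ring A; the nilpotent parts \<open>Ns\<close> lie in A.
  The outer sum has finitely many nonzero terms, and \<^const>\<open>finsum\<close> needs a finite index set.
\<close>

definition taylor_term ::
  "('a, 'm) ring_scheme \<Rightarrow> ('c \<Rightarrow> 'a) \<Rightarrow> 'c cinf_ops \<Rightarrow> rfun \<Rightarrow> 'c list \<Rightarrow> 'a list \<Rightarrow> nat \<Rightarrow> 'a"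
where
  "taylor_term A \<iota> \<phi> h fs Ns n =
     \<iota> (\<phi> (\<lambda>_. 1 / fact n) []) \<otimes>\<^bsub>A\<^esub>
     (\<Oplus>\<^bsub>A\<^esub>js \<in> {js. length js = n \<and> set js \<subseteq> {..<length fs}}.
        \<iota> (\<phi> (partials js h) fs) \<otimes>\<^bsub>A\<^esub> foldr (\<lambda>j p. (Ns ! j) \<otimes>\<^bsub>A\<^esub> p) js \<one>\<^bsub>A\<^esub>)"

definition taylor ::
  "('a, 'm) ring_scheme \<Rightarrow> ('c \<Rightarrow> 'a) \<Rightarrow> 'c cinf_ops \<Rightarrow> rfun \<Rightarrow> 'c list \<Rightarrow> 'a list \<Rightarrow> 'a"
where
  "taylor A \<iota> \<phi> h fs Ns =
     (\<Oplus>\<^bsub>A\<^esub>n \<in> {n. taylor_term A \<iota> \<phi> h fs Ns n \<noteq> \<zero>\<^bsub>A\<^esub>}. taylor_term A \<iota> \<phi> h fs Ns n)"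


section \<open>Exterior algebras of finite free modules, and split superrings\<close>

text \<open>
  The exterior algebra on \<open>\<theta>\<^sub>0, \<dots>, \<theta>\<^sub>q\<^sub>-\<^sub>1\<close> over C is given by coefficients: F stands for the sum over
  S of \<open>F S \<cdot> \<theta>\<^sub>S\<close>, where \<open>\<theta>\<^sub>S\<close> is the product of the \<open>\<theta>\<^sub>i\<close> with \<open>i \<in> S\<close> in increasing order. For
  disjoint A and B, \<open>\<theta>\<^sub>A \<theta>\<^sub>B\<close> is \<open>\<theta>\<^bsub>A \<union> B\<^esub>\<close> up to the sign of the shuffle that sorts A followed by B.
\<close>

definition inversions :: "nat set \<Rightarrow> nat set \<Rightarrow> nat" where
  "inversions A B = card {(a, b). a \<in> A \<and> b \<in> B \<and> b < a}"

definition grassmann_ring :: "'c set \<Rightarrow> 'c cinf_ops \<Rightarrow> nat \<Rightarrow> (nat set \<Rightarrow> 'c) ring" where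
  "grassmann_ring C \<phi> q = (let K = ring_of_cinf C \<phi> in
     \<lparr>carrier = Pow {..<q} \<rightarrow>\<^sub>E C,
      mult = (\<lambda>F G. \<lambda>S\<in>Pow {..<q}. \<Oplus>\<^bsub>K\<^esub>A \<in> Pow S.
                (if even (inversions A (S - A)) then F A \<otimes>\<^bsub>K\<^esub> G (S - A)
                 else \<ominus>\<^bsub>K\<^esub> (F A \<otimes>\<^bsub>K\<^esub> G (S - A)))),
      one = (\<lambda>S\<in>Pow {..<q}. if S = {} then \<one>\<^bsub>K\<^esub> else \<zero>\<^bsub>K\<^esub>),
      zero = (\<lambda>S\<in>Pow {..<q}. \<zero>\<^bsub>K\<^esub>),
      add = (\<lambda>F G. \<lambda>S\<in>Pow {..<q}. F S \<oplus>\<^bsub>K\<^esub> G S)\<rparr>)"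

definition grassmann_const :: "'c set \<Rightarrow> 'c cinf_ops \<Rightarrow> nat \<Rightarrow> 'c \<Rightarrow> nat set \<Rightarrow> 'c" where
  "grassmann_const C \<phi> q c =
     (\<lambda>S\<in>Pow {..<q}. if S = {} then c else \<zero>\<^bsub>ring_of_cinf C \<phi>\<^esub>)"

definition grassmann :: "'c set \<Rightarrow> 'c cinf_ops \<Rightarrow> nat \<Rightarrow> (nat set \<Rightarrow> 'c) cinf_superstructure" where
  "grassmann C \<phi> q = (let K = ring_of_cinf C \<phi>; A = grassmann_ring C \<phi> q in
     \<lparr>carrier = carrier A, mult = mult A, one = one A, zero = zero A, add = add A,
      even_part = {F \<in> carrier A. \<forall>S\<subseteq>{..<q}. odd (card S) \<longrightarrow> F S = \<zero>\<^bsub>K\<^esub>},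
      odd_part = {F \<in> carrier A. \<forall>S\<subseteq>{..<q}. even (card S) \<longrightarrow> F S = \<zero>\<^bsub>K\<^esub>},
      smooth_op = (\<lambda>h Fs. taylor A (grassmann_const C \<phi> q) \<phi> h
                     (map (\<lambda>F. F {}) Fs) (map (\<lambda>F. F({} := \<zero>\<^bsub>K\<^esub>)) Fs))\<rparr>)"

text \<open>
  The type argument is the type in which the smooth ring of coefficients is sought. A theorem that
  assumes \<open>is_split TYPE('c) R\<close> for a type variable \<open>'c\<close> covers coefficient rings of every type.
\<close>

definition is_split :: "'c itself \<Rightarrow> ('a, 'm) cinf_superstructure_scheme \<Rightarrow> bool" where
  "is_split T R \<longleftrightarrow>
     (\<exists>(C :: 'c set) \<phi> q h. cinf_ring C \<phi> \<and> cinf_superring_iso R (grassmann C \<phi> q) h)"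


section \<open>The canonical filtration and the associated graded superring\<close>

definition canonical_ideal :: "('a, 'm) cinf_superstructure_scheme \<Rightarrow> 'a set" where
  "canonical_ideal R = genideal R (odd_part R)"

primrec canonical_power :: "('a, 'm) cinf_superstructure_scheme \<Rightarrow> nat \<Rightarrow> 'a set" where
  "canonical_power R 0 = carrier R"
| "canonical_power R (Suc k) = ideal_prod R (canonical_ideal R) (canonical_power R k)"

definition gr_proj :: "('a, 'm) cinf_superstructure_scheme \<Rightarrow> nat \<Rightarrow> 'a \<Rightarrow> 'a set" where
  "gr_proj R k x = canonical_power R (Suc k) +>\<^bsub>R\<^esub> x"

definition gr_piece :: "('a, 'm) cinf_superstructure_scheme \<Rightarrow> nat \<Rightarrow> 'a set set" where
  "gr_piece R k = gr_proj R k ` canonical_power R k"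

text \<open>
  An element of the direct sum is a finitely supported sequence of cosets; the zero of the k-th
  summand is the coset \<open>canonical_power R (Suc k)\<close>. The summands \<open>a b\<close> of the m-th component of a
  product are added in the quotient of R by the power m + 1, of which the m-th summand is a subgroup.
\<close>

definition gr_ring :: "('a, 'm) cinf_superstructure_scheme \<Rightarrow> (nat \<Rightarrow> 'a set) ring" where
  "gr_ring R =
     \<lparr>carrier = {F. (\<forall>k. F k \<in> gr_piece R k) \<and> finite {k. F k \<noteq> canonical_power R (Suc k)}},
      mult = (\<lambda>F G m. \<Oplus>\<^bsub>R Quot (canonical_power R (Suc m))\<^esub>i \<in> {..m}.
                rcoset_mult R (canonical_power R (Suc m)) (F i) (G (m - i))),
      one = (\<lambda>k. if k = 0 then gr_proj R 0 \<one>\<^bsub>R\<^esub> else canonical_power R (Suc k)),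
      zero = (\<lambda>k. canonical_power R (Suc k)),
      add = (\<lambda>F G k. F k <+>\<^bsub>R\<^esub> G k)\<rparr>"

text \<open>
  Every class modulo the canonical ideal has an even representative, and the class of the result
  does not depend on the choice of representatives.
\<close>

definition body_op :: "('a, 'm) cinf_superstructure_scheme \<Rightarrow> 'a set cinf_ops" where
  "body_op R h As =
     \<Union> {gr_proj R 0 (smooth_op R h as) | as. list_all2 (\<lambda>a A. a \<in> A \<inter> even_part R) as As}"

definition gr_const :: "('a, 'm) cinf_superstructure_scheme \<Rightarrow> 'a set \<Rightarrow> nat \<Rightarrow> 'a set" where
  "gr_const R A = (\<lambda>k. if k = 0 then A else canonical_power R (Suc k))"

definition Gr :: "('a, 'm) cinf_superstructure_scheme \<Rightarrow> (nat \<Rightarrow> 'a set) cinf_superstructure" where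
  "Gr R = (let A = gr_ring R in
     \<lparr>carrier = carrier A, mult = mult A, one = one A, zero = zero A, add = add A,
      even_part = {F \<in> carrier A. \<forall>k. odd k \<longrightarrow> F k = canonical_power R (Suc k)},
      odd_part = {F \<in> carrier A. \<forall>k. even k \<longrightarrow> F k = canonical_power R (Suc k)},
      smooth_op = (\<lambda>h Fs. taylor A (gr_const R) (body_op R) h
                     (map (\<lambda>F. F 0) Fs) (map (\<lambda>F. F(0 := canonical_power R (Suc 0))) Fs))\<rparr>)"


section \<open>Euler vector fields and splittings\<close>

text \<open>
  Maps on R are taken to be undefined outside the carrier, so that equality of functions is equality
  of maps on the carrier.
\<close>

definition even_superderivation ::
  "('a, 'm) cinf_superstructure_scheme \<Rightarrow> ('a \<Rightarrow> 'a) \<Rightarrow> bool"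
where
  "even_superderivation R D \<longleftrightarrow>
     D \<in> carrier R \<rightarrow>\<^sub>E carrier R \<and>
     (\<forall>r\<in>carrier R. \<forall>s\<in>carrier R. D (r \<oplus>\<^bsub>R\<^esub> s) = D r \<oplus>\<^bsub>R\<^esub> D s) \<and>
     (\<forall>c. \<forall>r\<in>carrier R.
        D (smooth_op R (\<lambda>_. c) [] \<otimes>\<^bsub>R\<^esub> r) = smooth_op R (\<lambda>_. c) [] \<otimes>\<^bsub>R\<^esub> D r) \<and>
     D ` even_part R \<subseteq> even_part R \<and> D ` odd_part R \<subseteq> odd_part R \<and>
     (\<forall>r\<in>carrier R. \<forall>s\<in>carrier R. D (r \<otimes>\<^bsub>R\<^esub> s) = D r \<otimes>\<^bsub>R\<^esub> s \<oplus>\<^bsub>R\<^esub> r \<otimes>\<^bsub>R\<^esub> D s)"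

text \<open>
  A superderivation of the smooth structure satisfies the chain rule for all smooth operations on
  even elements. The Leibniz rule alone does not imply this. Let C be the field of hyperreals, which
  is a smooth ring as a quotient of the ring of smooth functions on the line, and let R be its
  exterior algebra on two generators. The only chain-rule derivation of C is 0, so that R has exactly
  one splitting, whereas C has nonzero real-linear derivations d, and \<open>c \<mapsto> d c \<cdot> \<theta>\<^sub>0 \<theta>\<^sub>1\<close> can be
  added to the Euler vector field of the basis. Correspondingly, the kernel of an Euler vector
  field without the chain rule need not be closed under the smooth operations.
\<close>

definition cinf_even_superderivation ::
  "('a, 'm) cinf_superstructure_scheme \<Rightarrow> ('a \<Rightarrow> 'a) \<Rightarrow> bool"
where
  "cinf_even_superderivation R D \<longleftrightarrow> even_superderivation R D \<and>
     (\<forall>f as. smooth (length as) f \<longrightarrow> set as \<subseteq> even_part R \<longrightarrow>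
        D (smooth_op R f as) =
          (\<Oplus>\<^bsub>R\<^esub>i \<in> {..<length as}. smooth_op R (partial i f) as \<otimes>\<^bsub>R\<^esub> D (as ! i)))"

definition euler_vector_field ::
  "('a, 'm) cinf_superstructure_scheme \<Rightarrow> ('a \<Rightarrow> 'a) \<Rightarrow> bool"
where
  "euler_vector_field R E \<longleftrightarrow> cinf_even_superderivation R E \<and>
     (\<forall>k::nat. \<forall>x\<in>canonical_power R k. E x \<ominus>\<^bsub>R\<^esub> [k] \<cdot>\<^bsub>R\<^esub> x \<in> canonical_power R (Suc k))"

definition splitting ::
  "('a, 'm) cinf_superstructure_scheme \<Rightarrow> ('a \<Rightarrow> nat \<Rightarrow> 'a set) \<Rightarrow> bool"
where
  "splitting R l \<longleftrightarrow> l \<in> extensional (carrier R) \<and> cinf_superring_iso R (Gr R) l \<and>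
     (\<forall>k. \<forall>x\<in>canonical_power R k. l x k = gr_proj R k x)"

end

theory Submission
  imports Defs
begin

text \<open>
  Euler vector fields and splittings are two descriptions of one structure. Let \<open>J\<close> be the canonical
  ideal. A grading adapted to the filtration by the powers of \<open>J\<close> is a family of subgroups \<open>G k\<close> of
  \<open>J\<^sup>k\<close> such that every class in \<open>J\<^sup>k / J\<^sup>k\<^sup>+\<^sup>1\<close> has exactly one representative in \<open>G k\<close>, products add
  degrees, elements of \<open>G k\<close> have the parity of k, and \<open>G 0\<close> is closed under the smooth operations.
  
  An Euler vector field E acts on \<open>J\<^sup>k / J\<^sup>k\<^sup>+\<^sup>1\<close> as multiplication by k. As \<open>J\<close> is nilpotent and differences
  of distinct degrees are invertible scalars, E is diagonalisable, and its eigenspaces form a grading. A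
  splitting gives a grading by pulling back the homogeneous components of the associated graded ring. In
  the other direction, a grading defines the Euler vector field that multiplies \<open>G k\<close> by k and the
  splitting that sends an element of \<open>G k\<close> to its class. Hence both sets are in bijection with the set
  of gradings (\<open>bij_betw_eigenspace\<close>, \<open>bij_betw_degree_part\<close>), and the theorem composes the two bijections.
  
  All of this is filtered linear algebra except for the smooth operations, and there the tool is Taylor's
  formula: if c is even and N is even and lies in \<open>J\<close>, then the value of an operation at \<open>c + N\<close> is its
  Taylor expansion about c (\<open>taylor_formula\<close>). In an exterior algebra the operations are defined by the
  expansion about the body; expanding about an arbitrary c instead amounts to re-expanding a Taylor
  series, that is, to the binomial theorem for the symmetric family of iterated partial derivatives
  (\<open>contract_exp_add\<close>, \<open>partial_commute\<close>). Expanding about degree-zero parts then shows that the derivation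
  of a grading satisfies the chain rule (\<open>degree_field_op\<close>) and that the map to the associated graded ring
  commutes with the operations (\<open>leading_forms_op\<close>). Conversely the chain rule makes the kernel of an
  Euler vector field closed under the operations. Splitness supplies the nilpotency of \<open>J\<close> and Taylor's
  formula; the locale \<open>nilpotent_taylor\<close> records exactly these two facts.
\<close>

section \<open>Polynomial functions and the symmetry of partial derivatives\<close>

lemma partials_Nil [simp]: "partials [] f = f"
  and partials_Cons [simp]: "partials (j # js) f = partial j (partials js f)"
  and partials_append: "partials (js @ ks) f = partials js (partials ks f)"
  by (simp_all add: partials_def)

lemma smooth_continuous: "smooth n f \<Longrightarrow> continuous_on UNIV f"
  by (auto simp: smooth_def dest: spec[where x = "[]"])

lemma smooth_field_differentiable:
  "smooth n f \<Longrightarrow> i < n \<Longrightarrow> (\<lambda>t. f (x(i := t))) field_differentiable at (x i)"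
  by (auto simp: smooth_def dest: spec[where x = "[]"])

lemma depends_on_first_partial:
  assumes "depends_on_first n f" "i < n"
  shows "depends_on_first n (partial i f)"
  unfolding depends_on_first_def
proof (intro allI impI)
  fix x y :: "nat \<Rightarrow> real" assume xy: "\<forall>i<n. x i = y i"
  have "f (x(i := t)) = f (y(i := t))" for t
    using assms(1)[unfolded depends_on_first_def, rule_format, of "x(i := t)" "y(i := t)"] xy by simp
  then show "partial i f x = partial i f y"
    using xy assms(2) by (simp add: partial_def)
qed

lemma smooth_partial:
  assumes "smooth n f" "i < n"
  shows "smooth n (partial i f)"
proof -
  have *: "partials js (partial i f) = partials (js @ [i]) f" for js
    by (simp add: partials_append)
  show ?thesis
    using assms depends_on_first_partial[of n f i] unfolding smooth_def * by simp
qed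

lemma smooth_partials: "smooth n f \<Longrightarrow> set js \<subseteq> {..<n} \<Longrightarrow> smooth n (partials js f)"
  by (induction js) (auto intro: smooth_partial)

text \<open>
  Iterated partial derivatives never leave a class that is closed under partial derivatives, so
  smoothness of explicit functions can be read off from first derivatives.
\<close>

lemma smooth_coinduct:
  assumes "f \<in> X"
    and "\<And>g. g \<in> X \<Longrightarrow> depends_on_first n g"
    and "\<And>g. g \<in> X \<Longrightarrow> continuous_on UNIV g"
    and "\<And>g i x. g \<in> X \<Longrightarrow> i < n \<Longrightarrow> (\<lambda>t. g (x(i := t))) field_differentiable at (x i)"
    and "\<And>g i. g \<in> X \<Longrightarrow> i < n \<Longrightarrow> partial i g \<in> X"
  shows "smooth n f"
proof -
  have "partials js f \<in> X" if "set js \<subseteq> {..<n}" for js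
    using that by (induction js) (auto simp: assms)
  then show ?thesis
    using assms unfolding smooth_def by blast
qed

inductive_set polyfuns :: "nat \<Rightarrow> rfun set" for n where
  const: "(\<lambda>_. c) \<in> polyfuns n"
| coord: "i < n \<Longrightarrow> (\<lambda>x. x i) \<in> polyfuns n"
| add: "f \<in> polyfuns n \<Longrightarrow> g \<in> polyfuns n \<Longrightarrow> (\<lambda>x. f x + g x) \<in> polyfuns n"
| mult: "f \<in> polyfuns n \<Longrightarrow> g \<in> polyfuns n \<Longrightarrow> (\<lambda>x. f x * g x) \<in> polyfuns n"

lemma polyfuns_derivative:
  assumes "f \<in> polyfuns n"
  shows "\<exists>f'\<in>polyfuns n. \<forall>x. ((\<lambda>t. f (x(i := t))) has_field_derivative f' x) (at (x i))"
  using assms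
proof induction
  case (const c)
  then show ?case by (intro bexI[of _ "\<lambda>_. 0"] allI polyfuns.const) auto
next
  case (coord j)
  show ?case
  proof (cases "j = i")
    case True
    then show ?thesis by (intro bexI[of _ "\<lambda>_. 1"] allI polyfuns.const) auto
  next
    case False
    then show ?thesis by (intro bexI[of _ "\<lambda>_. 0"] allI polyfuns.const) auto
  qed
next
  case (add f g)
  then obtain f' g' where f'g': "f' \<in> polyfuns n" "g' \<in> polyfuns n"
    "\<And>x. ((\<lambda>t. f (x(i := t))) has_field_derivative f' x) (at (x i))"
    "\<And>x. ((\<lambda>t. g (x(i := t))) has_field_derivative g' x) (at (x i))" by blast
  then have "(\<lambda>x. f' x + g' x) \<in> polyfuns n" by (intro polyfuns.intros)
  moreover have "((\<lambda>t. f (x(i := t)) + g (x(i := t))) has_field_derivative f' x + g' x) (at (x i))" for x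
    using DERIV_add[OF f'g'(3)[of x] f'g'(4)[of x]] .
  ultimately show ?case by (intro bexI[of _ "\<lambda>x. f' x + g' x"] allI)
next
  case (mult f g)
  then obtain f' g' where f'g': "f' \<in> polyfuns n" "g' \<in> polyfuns n"
    "\<And>x. ((\<lambda>t. f (x(i := t))) has_field_derivative f' x) (at (x i))"
    "\<And>x. ((\<lambda>t. g (x(i := t))) has_field_derivative g' x) (at (x i))" by blast
  have "(\<lambda>x. f' x * g x + g' x * f x) \<in> polyfuns n"
    using f'g'(1,2) mult(1,2) by (intro polyfuns.intros)
  moreover have "((\<lambda>t. f (x(i := t)) * g (x(i := t))) has_field_derivative f' x * g x + g' x * f x)
      (at (x i))" for x
    using DERIV_mult[OF f'g'(3)[of x] f'g'(4)[of x]] by simp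
  ultimately show ?case by (intro bexI[of _ "\<lambda>x. f' x * g x + g' x * f x"] allI)
qed

lemma smooth_polyfuns:
  assumes "f \<in> polyfuns n"
  shows "smooth n f"
proof (rule smooth_coinduct[OF assms])
  fix g assume g: "g \<in> polyfuns n"
  show "depends_on_first n g"
    using g unfolding depends_on_first_def
  proof induction
    case (add f g)
    then show ?case by metis
  next
    case (mult f g)
    then show ?case by metis
  qed auto
  show "continuous_on UNIV g"
    using g by induction (auto intro!: continuous_intros)
  fix i assume "i < n"
  obtain g' where g': "g' \<in> polyfuns n"
    "\<And>x. ((\<lambda>t. g (x(i := t))) has_field_derivative g' x) (at (x i))"
    using polyfuns_derivative[OF g] by blast
  show "(\<lambda>t. g (x(i := t))) field_differentiable at (x i)" for x
    using g'(2) unfolding field_differentiable_def by blast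
  have "partial i g = g'"
    unfolding partial_def by (intro ext DERIV_imp_deriv g'(2))
  then show "partial i g \<in> polyfuns n" using g'(1) by simp
qed

lemma smooth_DERIV:
  assumes "smooth n f" "i < n"
  shows "((\<lambda>t. f (x(i := t))) has_field_derivative partial i f (x(i := s))) (at s)"
  using smooth_field_differentiable[OF assms, of "x(i := s)"]
  by (simp add: partial_def DERIV_deriv_iff_field_differentiable)

text \<open>
  The mean value theorem, applied first in direction i and then in direction j, expresses the second
  difference by a mixed partial derivative. The left-hand side is symmetric in i and j.
\<close>

lemma second_difference_mean_value:
  assumes f: "smooth n f" and ij: "i < n" "j < n" "i \<noteq> j" and h: "h > 0"
  shows "\<exists>s t. x i < s \<and> s < x i + h \<and> x j < t \<and> t < x j + h \<and>
    f (x(i := x i + h, j := x j + h)) - f (x(i := x i + h)) - f (x(j := x j + h)) + f x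
      = h * h * partial j (partial i f) (x(i := s, j := t))"
proof -
  define d where "d = (\<lambda>s. f (x(i := s, j := x j + h)) - f (x(i := s)))"
  define d' where "d' = (\<lambda>s. partial i f (x(i := s, j := x j + h)) - partial i f (x(i := s)))"
  have d: "(d has_field_derivative d' s) (at s)" for s
    unfolding d_def d'_def
    using smooth_DERIV[OF f ij(1), of "x(j := x j + h)" s] smooth_DERIV[OF f ij(1), of x s]
    by (intro DERIV_diff) (simp_all add: fun_upd_twist[OF ij(3)])
  obtain s where s: "x i < s" "s < x i + h" "d (x i + h) - d (x i) = h * d' s"
    using MVT2[of "x i" "x i + h" d d'] d h by auto
  have "((\<lambda>t. partial i f (x(i := s, j := t))) has_field_derivative
      partial j (partial i f) (x(i := s, j := t))) (at t)" for t
    using smooth_DERIV[OF smooth_partial[OF f ij(1)] ij(2), of "x(i := s)"] .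
  then obtain t where t: "x j < t" "t < x j + h"
    "partial i f (x(i := s, j := x j + h)) - partial i f (x(i := s, j := x j)) =
      h * partial j (partial i f) (x(i := s, j := t))"
    using MVT2[of "x j" "x j + h" "\<lambda>t. partial i f (x(i := s, j := t))"
        "\<lambda>t. partial j (partial i f) (x(i := s, j := t))"] h by auto
  have "x(i := s, j := x j) = x(i := s)" using ij(3) by auto
  then have "d' s = h * partial j (partial i f) (x(i := s, j := t))"
    using t(3) by (simp add: d'_def)
  moreover have "d (x i + h) - d (x i) =
      f (x(i := x i + h, j := x j + h)) - f (x(i := x i + h)) - f (x(j := x j + h)) + f x"
    by (simp add: d_def)
  ultimately show ?thesis using s t by (metis mult.assoc)
qed

text \<open>
  For each side length h the two orders of differentiation agree up to moving the argument inside a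
  square of side h at x; continuity of the second derivatives gives equality in the limit.
\<close>

lemma partial_commute:
  assumes f: "smooth n f" and ij: "i < n" "j < n"
  shows "partial i (partial j f) = partial j (partial i f)"
proof (cases "i = j")
  case ne: False
  show ?thesis
  proof
    fix x :: "nat \<Rightarrow> real"
    define h where "h = (\<lambda>m. inverse (real (Suc m)))"
    have h0: "h m > 0" for m by (simp add: h_def)
    have hlim: "(\<lambda>m. c + h m) \<longlonglongrightarrow> c" for c
      using tendsto_add[OF tendsto_const LIMSEQ_inverse_real_of_nat, of c] by (simp add: h_def)
    define near where "near = (\<lambda>m p. \<exists>s t. p = x(i := s, j := t) \<and>
      x i < s \<and> s < x i + h m \<and> x j < t \<and> t < x j + h m)"
    have lim: "(\<lambda>m. F (p m)) \<longlonglongrightarrow> F x" if F: "smooth n F" and p: "\<And>m. near m (p m)" for F p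
    proof -
      obtain s t where p_eq: "\<And>m. p m = x(i := s m, j := t m)"
        and st: "\<And>m. x i < s m" "\<And>m. s m < x i + h m" "\<And>m. x j < t m" "\<And>m. t m < x j + h m"
        using p unfolding near_def by metis
      have "s \<longlonglongrightarrow> x i" "t \<longlonglongrightarrow> x j"
        using st by (auto intro!: tendsto_sandwich[OF _ _ tendsto_const hlim] always_eventually
            intro: less_imp_le)
      then have "(\<lambda>m. (s m, t m)) \<longlonglongrightarrow> (x i, x j)" by (rule tendsto_Pair)
      moreover have "continuous_on UNIV (\<lambda>z. x(i := fst z, j := snd z))"
      proof (rule continuous_on_coordinatewise_then_product)
        show "continuous_on UNIV (\<lambda>z. (x(i := fst z, j := snd z)) k)" for k
          by (cases "k = j"; cases "k = i") (auto intro: continuous_intros)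
      qed
      then have "continuous_on UNIV (\<lambda>z. F (x(i := fst z, j := snd z)))"
        using continuous_on_compose2[OF smooth_continuous[OF F]] by blast
      ultimately have "(\<lambda>m. F (x(i := s m, j := t m))) \<longlonglongrightarrow> F (x(i := x i, j := x j))"
        using continuous_on_tendsto_compose[of UNIV "\<lambda>z. F (x(i := fst z, j := snd z))"
            "\<lambda>m. (s m, t m)" "(x i, x j)"] by simp
      then show ?thesis by (simp add: p_eq)
    qed
    have "\<exists>p q. near m p \<and> near m q \<and> partial j (partial i f) p = partial i (partial j f) q" for m
    proof -
      obtain s t where st: "x i < s" "s < x i + h m" "x j < t" "t < x j + h m"
        "f (x(i := x i + h m, j := x j + h m)) - f (x(i := x i + h m)) - f (x(j := x j + h m)) + f x
          = h m * h m * partial j (partial i f) (x(i := s, j := t))"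
        using second_difference_mean_value[OF f ij ne h0] by blast
      obtain t' s' where st': "x j < t'" "t' < x j + h m" "x i < s'" "s' < x i + h m"
        "f (x(j := x j + h m, i := x i + h m)) - f (x(j := x j + h m)) - f (x(i := x i + h m)) + f x
          = h m * h m * partial i (partial j f) (x(j := t', i := s'))"
        using second_difference_mean_value[OF f ij(2,1) ne[symmetric] h0] by blast
      have "h m * h m * partial j (partial i f) (x(i := s, j := t)) =
          h m * h m * partial i (partial j f) (x(i := s', j := t'))"
        using st(5) st'(5) by (simp add: fun_upd_twist[OF ne] algebra_simps)
      then have "partial j (partial i f) (x(i := s, j := t)) = partial i (partial j f) (x(i := s', j := t'))"
        using h0[of m] by simp
      then show ?thesis using st st' unfolding near_def by blast
    qed
    then obtain p q where pq: "\<And>m. near m (p m)" "\<And>m. near m (q m)"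
      "\<And>m. partial j (partial i f) (p m) = partial i (partial j f) (q m)"
      by metis
    have "(\<lambda>m. partial j (partial i f) (p m)) \<longlonglongrightarrow> partial j (partial i f) x"
      by (rule lim) (use pq f ij in \<open>auto intro: smooth_partial\<close>)
    moreover have "(\<lambda>m. partial i (partial j f) (q m)) \<longlonglongrightarrow> partial i (partial j f) x"
      by (rule lim) (use pq f ij in \<open>auto intro: smooth_partial\<close>)
    ultimately show "partial i (partial j f) x = partial j (partial i f) x"
      using LIMSEQ_unique unfolding pq(3) by blast
  qed
qed simp

lemma partials_snoc_Cons:
  assumes "smooth n f" "j < n" "set js \<subseteq> {..<n}"
  shows "partials (js @ [j]) f = partials (j # js) f"
  using assms(3)
proof (induction js)
  case (Cons i js)
  then show ?case
    using partial_commute[of n "partials js f" i j] assms by (auto intro: smooth_partials)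
qed simp

lemma partials_insert_Cons:
  assumes "smooth n f" "j < n" "set js \<subseteq> {..<n}" "set ks \<subseteq> {..<n}"
  shows "partials (ks @ j # js) f = partials (j # ks @ js) f"
  using partials_snoc_Cons[of n "partials js f" j ks] assms
  by (simp add: partials_append smooth_partials)

section \<open>Contractions of symmetric families of coefficients\<close>

abbreviation index_lists :: "nat \<Rightarrow> nat \<Rightarrow> nat list set" where
  "index_lists k n \<equiv> {js. length js = n \<and> set js \<subseteq> {..<k}}"

definition monomial :: "('a, 'm) ring_scheme \<Rightarrow> (nat \<Rightarrow> 'a) \<Rightarrow> nat list \<Rightarrow> 'a" where
  "monomial A N js = foldr (\<lambda>j p. N j \<otimes>\<^bsub>A\<^esub> p) js \<one>\<^bsub>A\<^esub>"

text \<open>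
  The n-linear form with coefficients D, evaluated at n copies of the vector N. With iterated partial
  derivatives as coefficients it is, up to the factor \<open>1 / n!\<close>, the degree-n part of a Taylor expansion.
\<close>

definition contraction ::
  "('a, 'm) ring_scheme \<Rightarrow> nat \<Rightarrow> (nat list \<Rightarrow> 'a) \<Rightarrow> (nat \<Rightarrow> 'a) \<Rightarrow> nat \<Rightarrow> 'a"
where
  "contraction A k D N n = (\<Oplus>\<^bsub>A\<^esub>js \<in> index_lists k n. D js \<otimes>\<^bsub>A\<^esub> monomial A N js)"

text \<open>
  Invariance under moving one index to the front; such moves generate all permutations.
\<close>

definition symmetric_family :: "nat \<Rightarrow> (nat list \<Rightarrow> 'a) \<Rightarrow> bool" where
  "symmetric_family k D \<longleftrightarrow>
     (\<forall>j ks js. j < k \<longrightarrow> set ks \<subseteq> {..<k} \<longrightarrow> set js \<subseteq> {..<k} \<longrightarrow> D (ks @ j # js) = D (j # ks @ js))"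

lemma symmetric_family_Cons:
  assumes D: "symmetric_family k D" and i: "i < k"
  shows "symmetric_family k (\<lambda>js. D (i # js))"
  unfolding symmetric_family_def
proof (intro allI impI)
  fix j ks js assume *: "j < k" "set ks \<subseteq> {..<k}" "set js \<subseteq> {..<k}"
  have "D ((i # ks) @ j # js) = D (j # (i # ks) @ js)"
    using D * i unfolding symmetric_family_def by (metis insert_subset lessThan_iff list.set(2))
  also have "\<dots> = D ([j] @ i # ks @ js)" by simp
  also have "\<dots> = D (i # [j] @ ks @ js)"
  proof -
    have "set [j] \<subseteq> {..<k}" "set (ks @ js) \<subseteq> {..<k}" using * by auto
    then show ?thesis using D i unfolding symmetric_family_def by blast
  qed
  finally show "D (i # ks @ j # js) = D (i # j # ks @ js)" by simp
qed

lemma finite_index_lists: "finite (index_lists k n)"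
  using finite_lists_length_eq[of "{..<k}" n] by (simp add: conj_commute)

lemma index_lists_0: "index_lists k 0 = {[]}" by auto

lemma index_lists_Suc: "index_lists k (Suc n) = (\<Union>j<k. (#) j ` index_lists k n)"
proof
  show "index_lists k (Suc n) \<subseteq> (\<Union>j<k. (#) j ` index_lists k n)"
  proof
    fix js assume "js \<in> index_lists k (Suc n)"
    then obtain j js' where "js = j # js'" "j < k" "js' \<in> index_lists k n"
      by (cases js) auto
    then show "js \<in> (\<Union>j<k. (#) j ` index_lists k n)" by blast
  qed
qed auto

context abelian_monoid
begin

lemma finsum_index_lists_Suc:
  assumes "\<And>js. js \<in> index_lists k (Suc n) \<Longrightarrow> D js \<in> carrier G"
  shows "finsum G D (index_lists k (Suc n)) = (\<Oplus>j\<in>{..<k}. finsum G (\<lambda>js. D (j # js)) (index_lists k n))"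
proof -
  have "finsum G D (index_lists k (Suc n)) = (\<Oplus>j\<in>{..<k}. finsum G D ((#) j ` index_lists k n))"
    unfolding index_lists_Suc
    by (rule add.finprod_UN_disjoint)
      (use assms finite_index_lists in \<open>auto simp: pairwise_def disjnt_def\<close>)
  also have "\<dots> = (\<Oplus>j\<in>{..<k}. finsum G (\<lambda>js. D (j # js)) (index_lists k n))"
  proof (rule finsum_cong')
    fix j assume j: "j \<in> {..<k}"
    show "finsum G D ((#) j ` index_lists k n) = finsum G (\<lambda>js. D (j # js)) (index_lists k n)"
      by (rule finsum_reindex) (use j assms in auto)
  qed (use assms in \<open>auto intro!: finsum_closed\<close>)
  finally show ?thesis .
qed

lemma finsum_swap:
  assumes "finite A" "finite B" "\<And>a b. a \<in> A \<Longrightarrow> b \<in> B \<Longrightarrow> f a b \<in> carrier G"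
  shows "(\<Oplus>a\<in>A. \<Oplus>b\<in>B. f a b) = (\<Oplus>b\<in>B. \<Oplus>a\<in>A. f a b)"
  using assms(1,3)
proof (induction A rule: finite_induct)
  case (insert x A)
  have "(\<Oplus>a\<in>insert x A. \<Oplus>b\<in>B. f a b) = (\<Oplus>b\<in>B. f x b) \<oplus> (\<Oplus>b\<in>B. \<Oplus>a\<in>A. f a b)"
    using insert by (subst finsum_insert) (auto intro!: finsum_closed)
  also have "\<dots> = (\<Oplus>b\<in>B. f x b \<oplus> (\<Oplus>a\<in>A. f a b))"
    using insert by (subst finsum_addf) (auto intro!: finsum_closed)
  also have "\<dots> = (\<Oplus>b\<in>B. \<Oplus>a\<in>insert x A. f a b)"
    using insert by (intro finsum_cong' refl) (auto intro!: finsum_closed)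
  finally show ?case .
qed simp

lemma add_pow_finsum:
  assumes "finite A" "f \<in> A \<rightarrow> carrier G"
  shows "[(n::nat)] \<cdot>\<^bsub>G\<^esub> finsum G f A = (\<Oplus>a\<in>A. [n] \<cdot>\<^bsub>G\<^esub> f a)"
  using assms(2) by (induction n) (simp_all add: Pi_def)

lemma finsum_lessThan_Suc:
  assumes "\<And>i. i \<le> n \<Longrightarrow> f i \<in> carrier G"
  shows "finsum G f {..<Suc n} = finsum G f {..<n} \<oplus> f n"
  using assms by (simp add: lessThan_Suc a_comm)

lemma finsum_lessThan_Suc_shift:
  assumes "\<And>i. f i \<in> carrier G"
  shows "finsum G f {..<Suc n} = (\<Oplus>i\<in>{..<n}. f (Suc i)) \<oplus> f 0"
proof (induction n)
  case (Suc n)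
  have "finsum G f {..<Suc (Suc n)} = (\<Oplus>i\<in>{..<n}. f (Suc i)) \<oplus> f 0 \<oplus> f (Suc n)"
    using assms Suc by (subst finsum_lessThan_Suc) auto
  also have "\<dots> = (\<Oplus>i\<in>{..<Suc n}. f (Suc i)) \<oplus> f 0"
    using assms by (subst finsum_lessThan_Suc) (auto simp: a_ac)
  finally show ?case .
qed (simp add: assms lessThan_Suc)

lemma finsum_triangle:
  fixes W :: "nat \<Rightarrow> nat \<Rightarrow> 'a"
  assumes "\<And>l m. W l m \<in> carrier G"
  shows "(\<Oplus>n\<in>{..<q}. \<Oplus>m\<in>{..n}. W (n - m) m) = (\<Oplus>m\<in>{..<q}. \<Oplus>l\<in>{..<q - m}. W l m)"
proof (induction q)
  case (Suc q)
  have "(\<Oplus>m\<in>{..<Suc q}. \<Oplus>l\<in>{..<Suc q - m}. W l m) =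
      (\<Oplus>m\<in>{..<Suc q}. (\<Oplus>l\<in>{..<q - m}. W l m) \<oplus> W (q - m) m)"
  proof (rule finsum_cong')
    fix m assume "m \<in> {..<Suc q}"
    then have "Suc q - m = Suc (q - m)" by auto
    then show "(\<Oplus>l\<in>{..<Suc q - m}. W l m) = (\<Oplus>l\<in>{..<q - m}. W l m) \<oplus> W (q - m) m"
      by (simp only: finsum_lessThan_Suc assms)
  qed (auto simp: assms)
  also have "\<dots> = (\<Oplus>m\<in>{..<Suc q}. \<Oplus>l\<in>{..<q - m}. W l m) \<oplus> (\<Oplus>m\<in>{..<Suc q}. W (q - m) m)"
    by (rule finsum_addf) (auto simp: assms)
  also have "(\<Oplus>m\<in>{..<Suc q}. \<Oplus>l\<in>{..<q - m}. W l m) = (\<Oplus>m\<in>{..<q}. \<Oplus>l\<in>{..<q - m}. W l m)"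
    by (subst finsum_lessThan_Suc) (auto simp: assms)
  also have "\<dots> \<oplus> (\<Oplus>m\<in>{..<Suc q}. W (q - m) m) =
      (\<Oplus>n\<in>{..<Suc q}. \<Oplus>m\<in>{..n}. W (n - m) m)"
    unfolding Suc[symmetric] lessThan_Suc_atMost[symmetric]
    by (rule finsum_lessThan_Suc[symmetric]) (auto simp: assms)
  finally show ?case by simp
qed simp

text \<open>
  The induction step of the binomial theorem, with \<open>U l m\<close> in place of the product of the l-th and the
  m-th power.
\<close>

lemma finsum_pascal:
  fixes U :: "nat \<Rightarrow> nat \<Rightarrow> 'a"
  assumes U: "\<And>l m. U l m \<in> carrier G"
  shows "(\<Oplus>m\<in>{..n}. [(n choose m)] \<cdot>\<^bsub>G\<^esub> (U (Suc (n - m)) m \<oplus> U (n - m) (Suc m))) =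
    (\<Oplus>m\<in>{..Suc n}. [(Suc n choose m)] \<cdot>\<^bsub>G\<^esub> U (Suc n - m) m)"
proof -
  have c: "[(a::nat)] \<cdot>\<^bsub>G\<^esub> U l m \<in> carrier G" for a l m using U by simp
  have 1: "(\<Oplus>m\<in>{..n}. [(n choose m)] \<cdot>\<^bsub>G\<^esub> U (Suc (n - m)) m) =
      (\<Oplus>m\<in>{..n}. [(n choose Suc m)] \<cdot>\<^bsub>G\<^esub> U (n - m) (Suc m)) \<oplus> U (Suc n) 0"
  proof -
    have "(\<Oplus>m\<in>{..n}. [(n choose m)] \<cdot>\<^bsub>G\<^esub> U (Suc (n - m)) m) =
        (\<Oplus>m\<in>{..n}. [(n choose m)] \<cdot>\<^bsub>G\<^esub> U (Suc n - m) m)"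
      by (intro finsum_cong' refl) (auto simp: c Suc_diff_le)
    also have "\<dots> = (\<Oplus>m\<in>{..Suc n}. [(n choose m)] \<cdot>\<^bsub>G\<^esub> U (Suc n - m) m)"
      using c by (subst finsum_Suc) (auto simp: binomial_eq_0)
    also have "\<dots> = (\<Oplus>m\<in>{..n}. [(n choose Suc m)] \<cdot>\<^bsub>G\<^esub> U (n - m) (Suc m)) \<oplus> U (Suc n) 0"
      using c U by (subst finsum_Suc2) auto
    finally show ?thesis .
  qed
  have "(\<Oplus>m\<in>{..n}. [(n choose m)] \<cdot>\<^bsub>G\<^esub> (U (Suc (n - m)) m \<oplus> U (n - m) (Suc m))) =
      (\<Oplus>m\<in>{..n}. [(n choose m)] \<cdot>\<^bsub>G\<^esub> U (Suc (n - m)) m \<oplus> [(n choose m)] \<cdot>\<^bsub>G\<^esub> U (n - m) (Suc m))"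
    using U by (intro finsum_cong' refl) (auto simp: add.nat_pow_distrib)
  also have "\<dots> = (\<Oplus>m\<in>{..n}. [(n choose m)] \<cdot>\<^bsub>G\<^esub> U (Suc (n - m)) m) \<oplus>
      (\<Oplus>m\<in>{..n}. [(n choose m)] \<cdot>\<^bsub>G\<^esub> U (n - m) (Suc m))"
    by (rule finsum_addf) (auto simp: c)
  also have "\<dots> = ((\<Oplus>m\<in>{..n}. [(n choose m)] \<cdot>\<^bsub>G\<^esub> U (n - m) (Suc m)) \<oplus>
      (\<Oplus>m\<in>{..n}. [(n choose Suc m)] \<cdot>\<^bsub>G\<^esub> U (n - m) (Suc m))) \<oplus> U (Suc n) 0"
    unfolding 1 using U c by (simp add: a_ac)
  also have "(\<Oplus>m\<in>{..n}. [(n choose m)] \<cdot>\<^bsub>G\<^esub> U (n - m) (Suc m)) \<oplus>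
      (\<Oplus>m\<in>{..n}. [(n choose Suc m)] \<cdot>\<^bsub>G\<^esub> U (n - m) (Suc m)) =
      (\<Oplus>m\<in>{..n}. [(n choose m)] \<cdot>\<^bsub>G\<^esub> U (n - m) (Suc m) \<oplus> [(n choose Suc m)] \<cdot>\<^bsub>G\<^esub> U (n - m) (Suc m))"
    by (rule finsum_addf[symmetric]) (auto simp: c)
  also have "\<dots> = (\<Oplus>m\<in>{..n}. [(Suc n choose Suc m)] \<cdot>\<^bsub>G\<^esub> U (n - m) (Suc m))"
    using U by (intro finsum_cong' refl) (auto simp: add.nat_pow_mult)
  also have "\<dots> \<oplus> U (Suc n) 0 = (\<Oplus>m\<in>{..Suc n}. [(Suc n choose m)] \<cdot>\<^bsub>G\<^esub> U (Suc n - m) m)"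
    using c U by (subst finsum_Suc2) auto
  finally show ?thesis .
qed

end

context ring
begin

abbreviation "contract \<equiv> contraction R"

lemma monomial_Nil [simp]: "monomial R N [] = \<one>"
  and monomial_Cons [simp]: "monomial R N (j # js) = N j \<otimes> monomial R N js"
  by (simp_all add: monomial_def)

lemma monomial_closed [simp]:
  "(\<And>j. j \<in> set js \<Longrightarrow> N j \<in> carrier R) \<Longrightarrow> monomial R N js \<in> carrier R"
  by (induction js) auto

lemma contract_closed:
  assumes "\<And>js. set js \<subseteq> {..<k} \<Longrightarrow> D js \<in> carrier R" "\<And>j. j < k \<Longrightarrow> N j \<in> carrier R"
  shows "contract k D N n \<in> carrier R"
  unfolding contraction_def using assms by (intro finsum_closed Pi_I m_closed monomial_closed) auto

lemma monomial_cong: "(\<And>j. j \<in> set js \<Longrightarrow> N' j = N j) \<Longrightarrow> monomial R N' js = monomial R N js"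
  by (induction js) auto

lemma contract_cong:
  assumes "\<And>js. set js \<subseteq> {..<k} \<Longrightarrow> D js \<in> carrier R" "\<And>j. j < k \<Longrightarrow> N j \<in> carrier R"
    and "\<And>js. set js \<subseteq> {..<k} \<Longrightarrow> D' js = D js" "\<And>j. j < k \<Longrightarrow> N' j = N j"
  shows "contract k D' N' n = contract k D N n"
proof -
  have "monomial R N' js = monomial R N js" if "set js \<subseteq> {..<k}" for js
    using that assms(4) by (intro monomial_cong) auto
  then show ?thesis
    unfolding contraction_def using assms
    by (intro finsum_cong' refl Pi_I m_closed monomial_closed) auto
qed

lemma contract_0:
  assumes "D [] \<in> carrier R"
  shows "contract k D N 0 = D []"
  unfolding contraction_def index_lists_0 using assms by simp

definition center :: "'a set" where
  "center = {x \<in> carrier R. \<forall>y\<in>carrier R. x \<otimes> y = y \<otimes> x}"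

lemma center_closed: "x \<in> center \<Longrightarrow> x \<in> carrier R"
  and center_commute: "x \<in> center \<Longrightarrow> y \<in> carrier R \<Longrightarrow> x \<otimes> y = y \<otimes> x"
  by (simp_all add: center_def)

lemma center_lcomm:
  "x \<in> center \<Longrightarrow> y \<in> carrier R \<Longrightarrow> z \<in> carrier R \<Longrightarrow> y \<otimes> (x \<otimes> z) = x \<otimes> (y \<otimes> z)"
  using center_commute[of x y] center_closed[of x] m_assoc[of x y z] m_assoc[of y x z] by simp

lemma center_add: "x \<in> center \<Longrightarrow> y \<in> center \<Longrightarrow> x \<oplus> y \<in> center"
  by (simp add: center_def l_distr r_distr)

lemma contract_Suc:
  assumes D: "\<And>js. set js \<subseteq> {..<k} \<Longrightarrow> D js \<in> carrier R" and Nz: "\<And>j. j < k \<Longrightarrow> N j \<in> center"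
  shows "contract k D N (Suc n) = (\<Oplus>j\<in>{..<k}. N j \<otimes> contract k (\<lambda>js. D (j # js)) N n)"
proof -
  have N: "N j \<in> carrier R" if "j < k" for j using Nz[OF that] by (rule center_closed)
  have "contract k D N (Suc n) =
      (\<Oplus>j\<in>{..<k}. \<Oplus>js\<in>index_lists k n. D (j # js) \<otimes> (N j \<otimes> monomial R N js))"
    unfolding contraction_def
    by (subst finsum_index_lists_Suc) (use D N in \<open>auto intro!: m_closed monomial_closed\<close>)
  also have "\<dots> = (\<Oplus>j\<in>{..<k}. N j \<otimes> contract k (\<lambda>js. D (j # js)) N n)"
  proof (rule finsum_cong')
    fix j assume j: "j \<in> {..<k}"
    have mon: "monomial R N js \<in> carrier R" if "set js \<subseteq> {..<k}" for js
      using that N by (auto intro!: monomial_closed)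
    show "(\<Oplus>js\<in>index_lists k n. D (j # js) \<otimes> (N j \<otimes> monomial R N js)) =
        N j \<otimes> contract k (\<lambda>js. D (j # js)) N n"
      unfolding contraction_def
      using j D N mon
      by (subst finsum_rdistr) (auto intro!: finsum_cong' simp: finite_index_lists center_lcomm[OF Nz])
  qed (use D N in \<open>auto intro!: contract_closed\<close>)
  finally show ?thesis .
qed

lemma contract_finsum:
  assumes "finite A"
    and D: "\<And>a js. a \<in> A \<Longrightarrow> set js \<subseteq> {..<k} \<Longrightarrow> D a js \<in> carrier R"
    and N: "\<And>j. j < k \<Longrightarrow> N j \<in> carrier R" and c: "\<And>a. a \<in> A \<Longrightarrow> c a \<in> carrier R"
  shows "contract k (\<lambda>js. \<Oplus>a\<in>A. c a \<otimes> D a js) N n = (\<Oplus>a\<in>A. c a \<otimes> contract k (D a) N n)"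
proof -
  have mon: "monomial R N js \<in> carrier R" if "set js \<subseteq> {..<k}" for js
    using that N by (auto intro!: monomial_closed)
  have "contract k (\<lambda>js. \<Oplus>a\<in>A. c a \<otimes> D a js) N n =
      (\<Oplus>js\<in>index_lists k n. \<Oplus>a\<in>A. c a \<otimes> D a js \<otimes> monomial R N js)"
    unfolding contraction_def
    using assms mon by (intro finsum_cong' refl finsum_ldistr) (auto intro!: finsum_closed)
  also have "\<dots> = (\<Oplus>a\<in>A. \<Oplus>js\<in>index_lists k n. c a \<otimes> D a js \<otimes> monomial R N js)"
    using assms mon by (intro finsum_swap finite_index_lists) auto
  also have "\<dots> = (\<Oplus>a\<in>A. c a \<otimes> contract k (D a) N n)"
  proof (rule finsum_cong')
    fix a assume a: "a \<in> A"
    show "(\<Oplus>js\<in>index_lists k n. c a \<otimes> D a js \<otimes> monomial R N js) = c a \<otimes> contract k (D a) N n"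
      unfolding contraction_def using a c D mon
      by (subst finsum_rdistr) (auto intro!: finsum_cong' simp: finite_index_lists m_assoc)
  qed (use c D N in \<open>auto intro!: contract_closed\<close>)
  finally show ?thesis .
qed

text \<open>
  The binomial theorem for symmetric forms: expanding the n factors \<open>M + N\<close>, symmetry of D collects the
  terms with m factors N. In the induction step the first index is split off; if it contributes a factor
  N, symmetry moves it behind the indices that are contracted with M.
\<close>

lemma contract_add:
  assumes D: "symmetric_family k D" "\<And>js. set js \<subseteq> {..<k} \<Longrightarrow> D js \<in> carrier R"
    and Mz: "\<And>j. j < k \<Longrightarrow> M j \<in> center" and Nz: "\<And>j. j < k \<Longrightarrow> N j \<in> center"
  shows "contract k D (\<lambda>j. M j \<oplus> N j) n = (\<Oplus>m\<in>{..n}. [(n choose m)] \<cdot>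
    contract k (\<lambda>js. contract k (\<lambda>ks. D (ks @ js)) M (n - m)) N m)"
  using D
proof (induction n arbitrary: D)
  case 0
  have "M j \<in> carrier R" "N j \<in> carrier R" if "j < k" for j
    using Mz[OF that] Nz[OF that] center_closed by auto
  with 0 show ?case by (simp add: contract_0)
next
  case (Suc n)
  have M: "M j \<in> carrier R" and N: "N j \<in> carrier R" if "j < k" for j
    using Mz[OF that] Nz[OF that] center_closed by auto
  define Q where "Q = (\<lambda>D a b. contract k (\<lambda>js. contract k (\<lambda>ks. D (ks @ js)) M a) N b)"
  have Q_closed: "Q D a b \<in> carrier R" if "\<And>js. set js \<subseteq> {..<k} \<Longrightarrow> D js \<in> carrier R" for D a b
    unfolding Q_def using that M N by (intro contract_closed) auto
  have D': "D (j # js) \<in> carrier R" if "j < k" "set js \<subseteq> {..<k}" for j js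
    using Suc.prems(2)[of "j # js"] that by auto
  have Q_Cons [simp]: "Q (\<lambda>js. D (j # js)) a b \<in> carrier R" if "j < k" for j a b
    using that D' by (intro Q_closed) auto
  have step1: "(\<Oplus>j\<in>{..<k}. M j \<otimes> Q (\<lambda>js. D (j # js)) a b) = Q D (Suc a) b" for a b
  proof -
    have "Q D (Suc a) b = contract k (\<lambda>js. \<Oplus>j\<in>{..<k}. M j \<otimes> contract k (\<lambda>ks. D (j # ks @ js)) M a) N b"
      unfolding Q_def
    proof (rule contract_cong)
      fix js assume js: "set js \<subseteq> {..<k}"
      show "contract k (\<lambda>ks. D (ks @ js)) M (Suc a) =
          (\<Oplus>j\<in>{..<k}. M j \<otimes> contract k (\<lambda>ks. D (j # ks @ js)) M a)"
        using js Suc.prems(2) Mz by (subst contract_Suc) auto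
      show "(\<Oplus>j\<in>{..<k}. M j \<otimes> contract k (\<lambda>ks. D (j # ks @ js)) M a) \<in> carrier R"
        using js Suc.prems(2) M by (auto intro!: finsum_closed contract_closed)
    qed (simp_all add: N)
    also have "\<dots> = (\<Oplus>j\<in>{..<k}. M j \<otimes> Q (\<lambda>js. D (j # js)) a b)"
      unfolding Q_def using M N Suc.prems(2) by (subst contract_finsum) (auto intro!: contract_closed)
    finally show ?thesis ..
  qed
  have step2: "(\<Oplus>j\<in>{..<k}. N j \<otimes> Q (\<lambda>js. D (j # js)) a b) = Q D a (Suc b)" for a b
  proof -
    have "Q D a (Suc b) =
      (\<Oplus>j\<in>{..<k}. N j \<otimes> contract k (\<lambda>js. contract k (\<lambda>ks. D (ks @ j # js)) M a) N b)"
      unfolding Q_def using Suc.prems(2) M Nz by (subst contract_Suc) (auto intro!: contract_closed)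
    also have "\<dots> = (\<Oplus>j\<in>{..<k}. N j \<otimes> Q (\<lambda>js. D (j # js)) a b)"
    proof (rule finsum_cong')
      fix j assume j: "j \<in> {..<k}"
      have "D (ks @ j # js) = D (j # ks @ js)" if "set ks \<subseteq> {..<k}" "set js \<subseteq> {..<k}" for ks js
        using Suc.prems(1) j that unfolding symmetric_family_def by blast
      then show "N j \<otimes> contract k (\<lambda>js. contract k (\<lambda>ks. D (ks @ j # js)) M a) N b =
          N j \<otimes> Q (\<lambda>js. D (j # js)) a b"
        unfolding Q_def using j M N D'
        by (intro arg_cong[where f = "\<lambda>x. N j \<otimes> x"] contract_cong) (auto intro!: contract_closed)
    qed (use N in auto)
    finally show ?thesis ..
  qed
  have "contract k D (\<lambda>j. M j \<oplus> N j) (Suc n) =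
      (\<Oplus>j\<in>{..<k}. (M j \<oplus> N j) \<otimes> contract k (\<lambda>js. D (j # js)) (\<lambda>j. M j \<oplus> N j) n)"
    using Mz Nz Suc.prems by (intro contract_Suc) (auto intro: center_add)
  also have "\<dots> = (\<Oplus>j\<in>{..<k}. \<Oplus>m\<in>{..n}. [(n choose m)] \<cdot>
      (M j \<otimes> Q (\<lambda>js. D (j # js)) (n - m) m \<oplus> N j \<otimes> Q (\<lambda>js. D (j # js)) (n - m) m))"
  proof (rule finsum_cong')
    fix j assume "j \<in> {..<k}"
    then have j: "j < k" by simp
    have "contract k (\<lambda>js. D (j # js)) (\<lambda>j. M j \<oplus> N j) n =
        (\<Oplus>m\<in>{..n}. [(n choose m)] \<cdot> Q (\<lambda>js. D (j # js)) (n - m) m)"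
      using Suc.IH[of "\<lambda>js. D (j # js)"] symmetric_family_Cons[OF Suc.prems(1) j] D'[OF j]
      by (simp add: Q_def)
    then have "(M j \<oplus> N j) \<otimes> contract k (\<lambda>js. D (j # js)) (\<lambda>j. M j \<oplus> N j) n =
        (\<Oplus>m\<in>{..n}. (M j \<oplus> N j) \<otimes> [(n choose m)] \<cdot> Q (\<lambda>js. D (j # js)) (n - m) m)"
      using M N j by (simp add: finsum_rdistr)
    also have "\<dots> = (\<Oplus>m\<in>{..n}. [(n choose m)] \<cdot>
      (M j \<otimes> Q (\<lambda>js. D (j # js)) (n - m) m \<oplus> N j \<otimes> Q (\<lambda>js. D (j # js)) (n - m) m))"
      using M N j by (intro finsum_cong' refl) (auto simp: add_pow_rdistr l_distr)
    finally show "(M j \<oplus> N j) \<otimes> contract k (\<lambda>js. D (j # js)) (\<lambda>j. M j \<oplus> N j) n = \<dots>" .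
  qed (use M N in \<open>auto intro!: finsum_closed\<close>)
  also have "\<dots> = (\<Oplus>m\<in>{..n}. \<Oplus>j\<in>{..<k}. [(n choose m)] \<cdot>
      (M j \<otimes> Q (\<lambda>js. D (j # js)) (n - m) m \<oplus> N j \<otimes> Q (\<lambda>js. D (j # js)) (n - m) m))"
    using M N by (intro finsum_swap) auto
  also have "\<dots> = (\<Oplus>m\<in>{..n}. [(n choose m)] \<cdot> (Q D (Suc (n - m)) m \<oplus> Q D (n - m) (Suc m)))"
  proof (rule finsum_cong')
    fix m
    have "(\<Oplus>j\<in>{..<k}. [(n choose m)] \<cdot>
      (M j \<otimes> Q (\<lambda>js. D (j # js)) (n - m) m \<oplus> N j \<otimes> Q (\<lambda>js. D (j # js)) (n - m) m)) =
      [(n choose m)] \<cdot> (\<Oplus>j\<in>{..<k}.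
      M j \<otimes> Q (\<lambda>js. D (j # js)) (n - m) m \<oplus> N j \<otimes> Q (\<lambda>js. D (j # js)) (n - m) m)"
      using M N by (intro add_pow_finsum[symmetric]) auto
    also have "(\<Oplus>j\<in>{..<k}.
      M j \<otimes> Q (\<lambda>js. D (j # js)) (n - m) m \<oplus> N j \<otimes> Q (\<lambda>js. D (j # js)) (n - m) m) =
      Q D (Suc (n - m)) m \<oplus> Q D (n - m) (Suc m)"
      unfolding step1[symmetric] step2[symmetric] using M N by (intro finsum_addf) auto
    finally show "(\<Oplus>j\<in>{..<k}. [(n choose m)] \<cdot>
      (M j \<otimes> Q (\<lambda>js. D (j # js)) (n - m) m \<oplus> N j \<otimes> Q (\<lambda>js. D (j # js)) (n - m) m)) =
      [(n choose m)] \<cdot> (Q D (Suc (n - m)) m \<oplus> Q D (n - m) (Suc m))" .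
  qed (use Q_closed[of D] Suc.prems in auto)
  also have "\<dots> = (\<Oplus>m\<in>{..Suc n}. [(Suc n choose m)] \<cdot> Q D (Suc n - m) m)"
    using Q_closed[of D] Suc.prems by (intro finsum_pascal) auto
  finally show ?case unfolding Q_def .
qed

lemma additive_finsum:
  assumes d: "\<And>x. x \<in> carrier R \<Longrightarrow> d x \<in> carrier R"
    and d_add: "\<And>x y. x \<in> carrier R \<Longrightarrow> y \<in> carrier R \<Longrightarrow> d (x \<oplus> y) = d x \<oplus> d y"
    and "finite A" "\<And>a. a \<in> A \<Longrightarrow> f a \<in> carrier R"
  shows "d (finsum R f A) = (\<Oplus>a\<in>A. d (f a))"
  using assms(3,4)
proof (induction A rule: finite_induct)
  case empty
  have "d \<zero> = d \<zero> \<oplus> d \<zero>" using d_add[of \<zero> \<zero>] by simp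
  then show ?case using d[of \<zero>] by simp
next
  case (insert a A)
  then show ?case by (simp add: d_add d Pi_def)
qed

lemma derivation_center:
  assumes d: "\<And>x. x \<in> carrier R \<Longrightarrow> d x \<in> carrier R"
    and d_mult: "\<And>x y. x \<in> carrier R \<Longrightarrow> y \<in> carrier R \<Longrightarrow> d (x \<otimes> y) = d x \<otimes> y \<oplus> x \<otimes> d y"
    and x: "x \<in> center"
  shows "d x \<in> center"
proof -
  note xc = center_closed[OF x]
  have "d x \<otimes> y = y \<otimes> d x" if y: "y \<in> carrier R" for y
  proof -
    have "d x \<otimes> y \<oplus> x \<otimes> d y = d (y \<otimes> x)" using d_mult[OF xc y] center_commute[OF x y] by simp
    also have "\<dots> = y \<otimes> d x \<oplus> x \<otimes> d y"
      using d_mult[OF y xc] center_commute[OF x d[OF y]] xc y d by (simp add: a_comm)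
    finally show ?thesis using xc y d by simp
  qed
  then show ?thesis using d[OF xc] by (simp add: center_def)
qed

text \<open>
  By the Leibniz rule a derivation that vanishes on the coefficients hits each of the \<open>n + 1\<close> factors
  once. Symmetry of D makes all these contributions equal to the one in which the last factor is hit.
\<close>

lemma contract_derivation:
  assumes d: "\<And>x. x \<in> carrier R \<Longrightarrow> d x \<in> carrier R"
    and d_add: "\<And>x y. x \<in> carrier R \<Longrightarrow> y \<in> carrier R \<Longrightarrow> d (x \<oplus> y) = d x \<oplus> d y"
    and d_mult: "\<And>x y. x \<in> carrier R \<Longrightarrow> y \<in> carrier R \<Longrightarrow> d (x \<otimes> y) = d x \<otimes> y \<oplus> x \<otimes> d y"
    and D: "symmetric_family k D" "\<And>js. set js \<subseteq> {..<k} \<Longrightarrow> D js \<in> carrier R"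
      "\<And>js. set js \<subseteq> {..<k} \<Longrightarrow> d (D js) = \<zero>"
    and Nz: "\<And>j. j < k \<Longrightarrow> N j \<in> center"
  shows "d (contract k D N (Suc n)) =
    [(Suc n)] \<cdot> (\<Oplus>i\<in>{..<k}. contract k (\<lambda>js. D (js @ [i])) N n \<otimes> d (N i))"
  using D
proof (induction n arbitrary: D)
  have N: "N j \<in> carrier R" if "j < k" for j using Nz[OF that] by (rule center_closed)
  define S where "S = (\<lambda>D n. \<Oplus>i\<in>{..<k}. contract k (\<lambda>js. D (js @ [i])) N n \<otimes> d (N i))"
  have S_closed: "S D n \<in> carrier R" if "\<And>js. set js \<subseteq> {..<k} \<Longrightarrow> D js \<in> carrier R" for D n
    unfolding S_def using that N d by (auto intro!: finsum_closed contract_closed)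
  have S_eq: "(\<Oplus>i\<in>{..<k}. contract k (\<lambda>js. D (js @ [i])) N n \<otimes> d (N i)) = S D n" for D n
    by (simp only: S_def)
  have step: "d (contract k D N (Suc n)) =
      S D n \<oplus> (\<Oplus>j\<in>{..<k}. N j \<otimes> d (contract k (\<lambda>js. D (j # js)) N n))"
    if sym: "symmetric_family k D" and D: "\<And>js. set js \<subseteq> {..<k} \<Longrightarrow> D js \<in> carrier R" for D n
  proof -
    have c: "contract k (\<lambda>js. D (j # js)) N n \<in> carrier R" if "j < k" for j
      using that D N by (auto intro!: contract_closed)
    have "d (contract k D N (Suc n)) = (\<Oplus>j\<in>{..<k}. d (N j \<otimes> contract k (\<lambda>js. D (j # js)) N n))"
      using D Nz N c by (subst contract_Suc) (auto intro!: additive_finsum d d_add)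
    also have "\<dots> = (\<Oplus>j\<in>{..<k}. contract k (\<lambda>js. D (js @ [j])) N n \<otimes> d (N j) \<oplus>
        N j \<otimes> d (contract k (\<lambda>js. D (j # js)) N n))"
    proof (rule finsum_cong')
      fix j assume "j \<in> {..<k}"
      then have j: "j < k" by simp
      have "D (js @ [j]) = D (j # js)" if "set js \<subseteq> {..<k}" for js
        using sym j that unfolding symmetric_family_def by (metis append_Nil2 empty_subsetI list.set(1))
      then have "contract k (\<lambda>js. D (js @ [j])) N n = contract k (\<lambda>js. D (j # js)) N n"
        using D N j by (intro contract_cong) auto
      then show "d (N j \<otimes> contract k (\<lambda>js. D (j # js)) N n) =
          contract k (\<lambda>js. D (js @ [j])) N n \<otimes> d (N j) \<oplus> N j \<otimes> d (contract k (\<lambda>js. D (j # js)) N n)"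
        using j N c center_commute[OF derivation_center[of d, OF d d_mult Nz[OF j]] c[OF j]]
        by (simp add: d_mult)
    qed (use D N d c in \<open>auto intro!: a_closed m_closed contract_closed\<close>)
    also have "\<dots> = S D n \<oplus> (\<Oplus>j\<in>{..<k}. N j \<otimes> d (contract k (\<lambda>js. D (j # js)) N n))"
      unfolding S_def using D N d c by (intro finsum_addf) (auto intro!: m_closed contract_closed)
    finally show ?thesis .
  qed
  {
    case 0
    have "(\<Oplus>j\<in>{..<k}. N j \<otimes> d (contract k (\<lambda>js. D (j # js)) N 0)) = \<zero>"
      using 0 N by (intro add.finprod_one_eqI) (auto simp: contract_0)
    then show ?case
      unfolding S_eq using step[OF 0(1,2), of 0] S_closed[of D 0] 0(2) by simp
  next
    case (Suc n)
    have D': "D (j # js) \<in> carrier R" "d (D (j # js)) = \<zero>" if "j < k" "set js \<subseteq> {..<k}" for j js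
      using Suc.prems(2,3)[of "j # js"] that by auto
    have S_Cons: "S (\<lambda>js. D (j # js)) n \<in> carrier R" if "j < k" for j
      using S_closed D' that by simp
    have "(\<Oplus>j\<in>{..<k}. N j \<otimes> d (contract k (\<lambda>js. D (j # js)) N (Suc n))) =
        (\<Oplus>j\<in>{..<k}. [(Suc n)] \<cdot> (N j \<otimes> S (\<lambda>js. D (j # js)) n))"
    proof (rule finsum_cong')
      fix j assume "j \<in> {..<k}"
      then have j: "j < k" by simp
      have "d (contract k (\<lambda>js. D (j # js)) N (Suc n)) = [(Suc n)] \<cdot> S (\<lambda>js. D (j # js)) n"
        unfolding S_def using symmetric_family_Cons[OF Suc.prems(1) j] D'[OF j] by (intro Suc.IH) auto
      then show "N j \<otimes> d (contract k (\<lambda>js. D (j # js)) N (Suc n)) =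
          [(Suc n)] \<cdot> (N j \<otimes> S (\<lambda>js. D (j # js)) n)"
        using j N S_Cons by (simp only: add_pow_rdistr)
    qed (use N S_Cons in auto)
    also have "\<dots> = [(Suc n)] \<cdot> (\<Oplus>j\<in>{..<k}. N j \<otimes> S (\<lambda>js. D (j # js)) n)"
      using N S_Cons by (intro add_pow_finsum[symmetric]) auto
    also have "(\<Oplus>j\<in>{..<k}. N j \<otimes> S (\<lambda>js. D (j # js)) n) =
        (\<Oplus>j\<in>{..<k}. \<Oplus>i\<in>{..<k}. N j \<otimes> (contract k (\<lambda>js. D (j # js @ [i])) N n \<otimes> d (N i)))"
      unfolding S_def using N Suc.prems(2) d
      by (intro finsum_cong' refl finsum_rdistr) (auto intro!: finsum_closed m_closed contract_closed)
    also have "\<dots> = (\<Oplus>i\<in>{..<k}. \<Oplus>j\<in>{..<k}. N j \<otimes> (contract k (\<lambda>js. D (j # js @ [i])) N n \<otimes> d (N i)))"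
      using N Suc.prems(2) d by (intro finsum_swap) (auto intro!: m_closed contract_closed)
    also have "\<dots> = S D (Suc n)"
      unfolding S_def
    proof (rule finsum_cong')
      fix i assume i: "i \<in> {..<k}"
      have te: "contract k (\<lambda>js. D (j # js @ [i])) N n \<in> carrier R" if "j < k" for j
        using that i N Suc.prems(2) by (auto intro!: contract_closed)
      have "contract k (\<lambda>js. D (js @ [i])) N (Suc n) =
          (\<Oplus>j\<in>{..<k}. N j \<otimes> contract k (\<lambda>js. D (j # js @ [i])) N n)"
        using i Nz Suc.prems(2) by (subst contract_Suc) auto
      then show "(\<Oplus>j\<in>{..<k}. N j \<otimes> (contract k (\<lambda>js. D (j # js @ [i])) N n \<otimes> d (N i))) =
          contract k (\<lambda>js. D (js @ [i])) N (Suc n) \<otimes> d (N i)"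
        using i N d te by (auto simp: finsum_ldistr m_assoc Pi_def intro!: finsum_cong')
    qed (use Suc.prems N d in \<open>auto intro!: contract_closed\<close>)
    finally show ?case
      unfolding S_eq using step[OF Suc.prems(1,2), of "Suc n"] S_closed[of D "Suc n"] Suc.prems(2)
      by (simp add: a_ac)
  }
qed

text \<open>
  The law \<open>exp (M + N) = exp M \<cdot> exp N\<close> for truncated exponential series of symmetric forms, where \<open>s n\<close>
  plays the role of \<open>1 / n!\<close>. It says that a Taylor expansion at increment \<open>M + N\<close> is the expansion at
  increment N of the expansions at increment M.
\<close>

lemma contract_exp_add:
  assumes D: "symmetric_family k D" "\<And>js. set js \<subseteq> {..<k} \<Longrightarrow> D js \<in> carrier R"
    and Mz: "\<And>j. j < k \<Longrightarrow> M j \<in> center" and Nz: "\<And>j. j < k \<Longrightarrow> N j \<in> center"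
    and sz: "\<And>n. s n \<in> center"
    and s_mult: "\<And>l m. [(l + m choose m)] \<cdot> s (l + m) = s l \<otimes> s m"
    and vanish: "\<And>ks js. set ks \<subseteq> {..<k} \<Longrightarrow> set js \<subseteq> {..<k} \<Longrightarrow> length ks + length js \<ge> q \<Longrightarrow>
      monomial R M ks \<otimes> monomial R N js = \<zero>"
  shows "(\<Oplus>n\<in>{..<q}. s n \<otimes> contract k D (\<lambda>j. M j \<oplus> N j) n) =
    (\<Oplus>m\<in>{..<q}. s m \<otimes> contract k
      (\<lambda>js. \<Oplus>l\<in>{..<q}. s l \<otimes> contract k (\<lambda>ks. D (ks @ js)) M l) N m)"
proof -
  have M: "M j \<in> carrier R" and N: "N j \<in> carrier R" if "j < k" for j
    using Mz[OF that] Nz[OF that] center_closed by auto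
  have s: "s n \<in> carrier R" for n using sz by (rule center_closed)
  define Q where "Q = (\<lambda>l m. contract k (\<lambda>js. contract k (\<lambda>ks. D (ks @ js)) M l) N m)"
  define W where "W = (\<lambda>l m. s m \<otimes> (s l \<otimes> Q l m))"
  have Q: "Q l m \<in> carrier R" for l m
    unfolding Q_def using D M N by (auto intro!: contract_closed)
  have W: "W l m \<in> carrier R" for l m
    unfolding W_def using Q s by auto
  have mon: "monomial R M js \<in> carrier R" "monomial R N js \<in> carrier R" if "set js \<subseteq> {..<k}" for js
    using that M N by (auto intro!: monomial_closed)
  \<comment> \<open>Terms of total degree at least q vanish, so that the square of pairs of degrees below q
    carries the same sum as the triangle that the binomial theorem produces.\<close>
  have Q0: "Q l m = \<zero>" if "l + m \<ge> q" for l m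
    unfolding Q_def contraction_def
  proof (rule add.finprod_one_eqI)
    fix js assume js: "js \<in> index_lists k m"
    have "(\<Oplus>ks\<in>index_lists k l. D (ks @ js) \<otimes> monomial R M ks) \<otimes> monomial R N js =
        (\<Oplus>ks\<in>index_lists k l. D (ks @ js) \<otimes> monomial R M ks \<otimes> monomial R N js)"
      using js D mon by (intro finsum_ldistr finite_index_lists) auto
    also have "\<dots> = \<zero>"
    proof (rule add.finprod_one_eqI)
      fix ks assume ks: "ks \<in> index_lists k l"
      then show "D (ks @ js) \<otimes> monomial R M ks \<otimes> monomial R N js = \<zero>"
        using js that vanish[of ks js] D(2)[of "ks @ js"] mon by (simp add: m_assoc)
    qed
    finally show "(\<Oplus>ks\<in>index_lists k l. D (ks @ js) \<otimes> monomial R M ks) \<otimes> monomial R N js = \<zero>" .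
  qed
  have "(\<Oplus>n\<in>{..<q}. s n \<otimes> contract k D (\<lambda>j. M j \<oplus> N j) n) =
      (\<Oplus>n\<in>{..<q}. \<Oplus>m\<in>{..n}. W (n - m) m)"
  proof (rule finsum_cong')
    fix n
    have "s n \<otimes> contract k D (\<lambda>j. M j \<oplus> N j) n = s n \<otimes> (\<Oplus>m\<in>{..n}. [(n choose m)] \<cdot> Q (n - m) m)"
      unfolding Q_def using D Mz Nz by (subst contract_add) auto
    also have "\<dots> = (\<Oplus>m\<in>{..n}. s n \<otimes> [(n choose m)] \<cdot> Q (n - m) m)"
      using s Q by (intro finsum_rdistr) auto
    also have "\<dots> = (\<Oplus>m\<in>{..n}. W (n - m) m)"
    proof (rule finsum_cong')
      fix m assume "m \<in> {..n}"
      then have "[(n choose m)] \<cdot> s n = s (n - m) \<otimes> s m" using s_mult[of "n - m" m] by simp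
      then have "s n \<otimes> [(n choose m)] \<cdot> Q (n - m) m = s (n - m) \<otimes> s m \<otimes> Q (n - m) m"
        using s Q by (metis add_pow_ldistr add_pow_rdistr)
      then show "s n \<otimes> [(n choose m)] \<cdot> Q (n - m) m = W (n - m) m"
        unfolding W_def using s Q center_commute[OF sz s, of "n - m" m] by (simp add: m_assoc[symmetric])
    qed (use W in auto)
    finally show "s n \<otimes> contract k D (\<lambda>j. M j \<oplus> N j) n = (\<Oplus>m\<in>{..n}. W (n - m) m)" .
  qed (use W in \<open>auto intro!: finsum_closed\<close>)
  also have "\<dots> = (\<Oplus>m\<in>{..<q}. \<Oplus>l\<in>{..<q - m}. W l m)"
    by (rule finsum_triangle[OF W])
  also have "\<dots> = (\<Oplus>m\<in>{..<q}. \<Oplus>l\<in>{..<q}. W l m)"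
  proof (rule finsum_cong')
    fix m
    show "(\<Oplus>l\<in>{..<q - m}. W l m) = (\<Oplus>l\<in>{..<q}. W l m)"
      by (rule add.finprod_mono_neutral_cong_left) (use W Q0 s in \<open>auto simp: W_def\<close>)
  qed (use W in \<open>auto intro!: finsum_closed\<close>)
  also have "\<dots> = (\<Oplus>m\<in>{..<q}. s m \<otimes> contract k
      (\<lambda>js. \<Oplus>l\<in>{..<q}. s l \<otimes> contract k (\<lambda>ks. D (ks @ js)) M l) N m)"
  proof (rule finsum_cong')
    fix m
    have "contract k (\<lambda>js. \<Oplus>l\<in>{..<q}. s l \<otimes> contract k (\<lambda>ks. D (ks @ js)) M l) N m =
        (\<Oplus>l\<in>{..<q}. s l \<otimes> Q l m)"
      unfolding Q_def using s D M N by (intro contract_finsum) (auto intro!: contract_closed)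
    then show "(\<Oplus>l\<in>{..<q}. W l m) = s m \<otimes> contract k
        (\<lambda>js. \<Oplus>l\<in>{..<q}. s l \<otimes> contract k (\<lambda>ks. D (ks @ js)) M l) N m"
      unfolding W_def using s Q by (simp add: finsum_rdistr)
  qed (use s D M N in \<open>auto intro!: m_closed contract_closed finsum_closed\<close>)
  finally show ?thesis .
qed

end

section \<open>Taylor expansions and ring homomorphisms\<close>

lemma taylor_term_eq:
  "taylor_term A \<iota> \<phi> h fs Ns n =
    \<iota> (\<phi> (\<lambda>_. 1 / fact n) []) \<otimes>\<^bsub>A\<^esub>
      contraction A (length fs) (\<lambda>js. \<iota> (\<phi> (partials js h) fs)) ((!) Ns) n"
  by (simp add: taylor_term_def contraction_def monomial_def)

lemma ring_hom_finsum:
  assumes "ring A" "ring B" "l \<in> ring_hom A B" "f \<in> S \<rightarrow> carrier A"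
  shows "l (finsum A f S) = (\<Oplus>\<^bsub>B\<^esub>x\<in>S. l (f x))"
proof -
  interpret ring_hom_ring A B l
    using assms by (simp add: ring_hom_ring_def ring_hom_ring_axioms_def)
  show ?thesis
    using assms(4) by (induction S rule: infinite_finite_induct) (auto simp: Pi_def)
qed

lemma ring_hom_monomial:
  assumes "ring A" "ring B" "l \<in> ring_hom A B" "\<And>j. j \<in> set js \<Longrightarrow> N j \<in> carrier A"
  shows "l (monomial A N js) = monomial B (\<lambda>j. l (N j)) js"
  using assms(4)
proof (induction js)
  case (Cons j js)
  interpret A: ring A by fact
  show ?case
    using Cons assms(3) by (auto simp: monomial_def ring_hom_mult A.monomial_closed[unfolded monomial_def])
qed (use assms(3) in \<open>auto simp: monomial_def ring_hom_one\<close>)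

lemma ring_hom_contraction:
  assumes "ring A" "ring B" "l \<in> ring_hom A B"
    and "\<And>js. set js \<subseteq> {..<k} \<Longrightarrow> D js \<in> carrier A" "\<And>j. j < k \<Longrightarrow> N j \<in> carrier A"
  shows "l (contraction A k D N n) = contraction B k (\<lambda>js. l (D js)) (\<lambda>j. l (N j)) n"
proof -
  interpret A: ring A by fact
  interpret B: ring B by fact
  have mon: "monomial A N js \<in> carrier A" if "set js \<subseteq> {..<k}" for js
    using that assms(5) by (auto intro!: A.monomial_closed)
  have "l (contraction A k D N n) = (\<Oplus>\<^bsub>B\<^esub>js\<in>index_lists k n. l (D js \<otimes>\<^bsub>A\<^esub> monomial A N js))"
    unfolding contraction_def using assms mon by (intro ring_hom_finsum) auto
  also have "\<dots> = contraction B k (\<lambda>js. l (D js)) (\<lambda>j. l (N j)) n"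
    unfolding contraction_def
  proof (rule B.finsum_cong')
    fix js assume js: "js \<in> index_lists k n"
    then have "l (monomial A N js) = monomial B (\<lambda>j. l (N j)) js"
      using assms by (intro ring_hom_monomial) auto
    then show "l (D js \<otimes>\<^bsub>A\<^esub> monomial A N js) = l (D js) \<otimes>\<^bsub>B\<^esub> monomial B (\<lambda>j. l (N j)) js"
      using js assms(3,4) mon by (simp add: ring_hom_mult)
  next
    show "(\<lambda>js. l (D js) \<otimes>\<^bsub>B\<^esub> monomial B (\<lambda>j. l (N j)) js) \<in> index_lists k n \<rightarrow> carrier B"
      using assms(3-5) by (auto intro!: B.m_closed B.monomial_closed simp: ring_hom_closed)
  qed simp
  finally show ?thesis .
qed

text \<open>
  Taylor expansions are made of ring operations and are therefore natural. Injectivity of the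
  homomorphism matters because the outer sum ranges over the degrees with nonzero terms.
\<close>

lemma ring_hom_taylor:
  assumes A: "ring A" and B: "ring B" and l: "l \<in> ring_hom A B" "inj_on l (carrier A)"
    and D: "\<And>js. set js \<subseteq> {..<length fs} \<Longrightarrow> \<iota> (\<phi> (partials js h) fs) \<in> carrier A"
    and s: "\<And>n. \<iota> (\<phi> (\<lambda>_. 1 / fact n) []) \<in> carrier A"
    and N: "\<And>j. j < length fs \<Longrightarrow> Ns ! j \<in> carrier A"
    and len: "length gs = length fs"
    and D': "\<And>js. set js \<subseteq> {..<length fs} \<Longrightarrow> \<iota>' (\<phi>' (partials js h) gs) = l (\<iota> (\<phi> (partials js h) fs))"
    and s': "\<And>n. \<iota>' (\<phi>' (\<lambda>_. 1 / fact n) []) = l (\<iota> (\<phi> (\<lambda>_. 1 / fact n) []))"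
    and N': "\<And>j. j < length fs \<Longrightarrow> Ms ! j = l (Ns ! j)"
  shows "taylor B \<iota>' \<phi>' h gs Ms = l (taylor A \<iota> \<phi> h fs Ns)"
proof -
  interpret A: ring A by fact
  interpret B: ring B by fact
  have closed: "taylor_term A \<iota> \<phi> h fs Ns n \<in> carrier A" for n
    unfolding taylor_term_eq using D s N by (auto intro!: A.m_closed A.contract_closed)
  have "contraction B (length fs) (\<lambda>js. \<iota>' (\<phi>' (partials js h) gs)) ((!) Ms) n =
      l (contraction A (length fs) (\<lambda>js. \<iota> (\<phi> (partials js h) fs)) ((!) Ns) n)" for n
  proof -
    have "contraction B (length fs) (\<lambda>js. \<iota>' (\<phi>' (partials js h) gs)) ((!) Ms) n =
        contraction B (length fs) (\<lambda>js. l (\<iota> (\<phi> (partials js h) fs))) (\<lambda>j. l (Ns ! j)) n"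
      using D D' N N' by (intro B.contract_cong) (auto simp: ring_hom_closed[OF l(1)])
    also have "\<dots> = l (contraction A (length fs) (\<lambda>js. \<iota> (\<phi> (partials js h) fs)) ((!) Ns) n)"
      using D N by (intro ring_hom_contraction[OF A B l(1), symmetric]) auto
    finally show ?thesis .
  qed
  then have tt: "taylor_term B \<iota>' \<phi>' h gs Ms n = l (taylor_term A \<iota> \<phi> h fs Ns n)" for n
    unfolding taylor_term_eq using D N s by (simp add: len s' ring_hom_mult[OF l(1)] A.contract_closed)
  have "l x = \<zero>\<^bsub>B\<^esub> \<longleftrightarrow> x = \<zero>\<^bsub>A\<^esub>" if "x \<in> carrier A" for x
    using that l ring_hom_zero[OF l(1) A B] by (metis A.zero_closed inj_onD)
  then show ?thesis
    unfolding taylor_def tt using closed by (subst ring_hom_finsum[OF A B l(1)]) auto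
qed

lemma taylor_finite:
  assumes "ring A"
    and closed: "\<And>n. n < q \<Longrightarrow> taylor_term A \<iota> \<phi> h fs Ns n \<in> carrier A"
    and zero: "\<And>n. n \<ge> q \<Longrightarrow> taylor_term A \<iota> \<phi> h fs Ns n = \<zero>\<^bsub>A\<^esub>"
  shows "taylor A \<iota> \<phi> h fs Ns = (\<Oplus>\<^bsub>A\<^esub>n\<in>{..<q}. taylor_term A \<iota> \<phi> h fs Ns n)"
proof -
  interpret A: ring A by fact
  show ?thesis
    unfolding taylor_def using closed zero
    by (intro A.add.finprod_mono_neutral_cong_left) (auto simp: not_less[symmetric])
qed

lemma taylor_zero_nilpotents:
  assumes A: "ring A"
    and D: "\<And>js. set js \<subseteq> {..<length fs} \<Longrightarrow> \<iota> (\<phi> (partials js h) fs) \<in> carrier A"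
    and s: "\<And>n. \<iota> (\<phi> (\<lambda>_. 1 / fact n) []) \<in> carrier A" "\<iota> (\<phi> (\<lambda>_. 1) []) = \<one>\<^bsub>A\<^esub>"
    and N: "\<And>j. j < length fs \<Longrightarrow> Ns ! j = \<zero>\<^bsub>A\<^esub>"
  shows "taylor A \<iota> \<phi> h fs Ns = \<iota> (\<phi> h fs)"
proof -
  interpret A: ring A by fact
  have mon: "monomial A ((!) Ns) js \<in> carrier A" if "set js \<subseteq> {..<length fs}" for js
    using that N by (auto intro!: A.monomial_closed)
  have "taylor_term A \<iota> \<phi> h fs Ns n = \<zero>\<^bsub>A\<^esub>" if "n \<ge> 1" for n
  proof -
    have "contraction A (length fs) (\<lambda>js. \<iota> (\<phi> (partials js h) fs)) ((!) Ns) n = \<zero>\<^bsub>A\<^esub>"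
      unfolding contraction_def
    proof (rule A.add.finprod_one_eqI)
      fix js assume "js \<in> index_lists (length fs) n"
      with that obtain j js' where "js = j # js'" "j < length fs" "set js \<subseteq> {..<length fs}"
        by (cases js) auto
      then show "\<iota> (\<phi> (partials js h) fs) \<otimes>\<^bsub>A\<^esub> monomial A ((!) Ns) js = \<zero>\<^bsub>A\<^esub>"
        using D[of js] N mon[of js'] by auto
    qed
    then show ?thesis unfolding taylor_term_eq using s by simp
  qed
  moreover have "taylor_term A \<iota> \<phi> h fs Ns 0 = \<iota> (\<phi> h fs)"
    unfolding taylor_term_eq using D[of "[]"] s by (simp add: A.contract_0)
  ultimately show ?thesis
    using D[of "[]"] by (subst taylor_finite[OF A, of 1]) (auto simp: lessThan_Suc)
qed

section \<open>Supercommutative rings and the canonical filtration\<close>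

locale supercommutative = ring R for R :: "('a, 'm) cinf_superstructure_scheme" (structure) +
  assumes superring: "superring R"
begin

abbreviation "R0 \<equiv> even_part R"
abbreviation "R1 \<equiv> odd_part R"
abbreviation "J k \<equiv> canonical_power R k"

lemma even_additive: "additive_subgroup R0 R" and odd_additive: "additive_subgroup R1 R"
  using superring unfolding superring_def by blast+

lemma even_closed: "x \<in> R0 \<Longrightarrow> x \<in> carrier R" and odd_closed: "x \<in> R1 \<Longrightarrow> x \<in> carrier R"
  using additive_subgroup.a_Hcarr even_additive odd_additive by metis+

lemma even_add: "x \<in> R0 \<Longrightarrow> y \<in> R0 \<Longrightarrow> x \<oplus> y \<in> R0"
  and even_neg: "x \<in> R0 \<Longrightarrow> \<ominus> x \<in> R0"
  and even_zero: "\<zero> \<in> R0"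
  and odd_add: "x \<in> R1 \<Longrightarrow> y \<in> R1 \<Longrightarrow> x \<oplus> y \<in> R1"
  and odd_neg: "x \<in> R1 \<Longrightarrow> \<ominus> x \<in> R1"
  and odd_zero: "\<zero> \<in> R1"
  using even_additive odd_additive
  by (auto simp: additive_subgroup.a_closed additive_subgroup.zero_closed
      intro: additive_subgroup.a_inv_closed[OF even_additive]
        additive_subgroup.a_inv_closed[OF odd_additive])

lemma even_one: "\<one> \<in> R0"
  and even_mult: "x \<in> R0 \<Longrightarrow> y \<in> R0 \<Longrightarrow> x \<otimes> y \<in> R0"
  and even_odd_mult: "x \<in> R0 \<Longrightarrow> y \<in> R1 \<Longrightarrow> x \<otimes> y \<in> R1"
  and odd_mult: "x \<in> R1 \<Longrightarrow> y \<in> R1 \<Longrightarrow> x \<otimes> y \<in> R0"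
  and even_commute: "x \<in> R0 \<Longrightarrow> y \<in> carrier R \<Longrightarrow> x \<otimes> y = y \<otimes> x"
  and even_inter_odd: "x \<in> R0 \<Longrightarrow> x \<in> R1 \<Longrightarrow> x = \<zero>"
  using superring unfolding superring_def by blast+

lemma odd_even_mult: "x \<in> R1 \<Longrightarrow> y \<in> R0 \<Longrightarrow> x \<otimes> y \<in> R1"
  using even_commute[of y x] even_odd_mult odd_closed by metis

lemma decompose:
  assumes "x \<in> carrier R"
  obtains a b where "a \<in> R0" "b \<in> R1" "x = a \<oplus> b"
proof -
  have "R0 <+> R1 = carrier R" using superring unfolding superring_def by blast
  then show ?thesis using assms that unfolding set_add_def' by auto
qed

text \<open>
  Indexing the two parts by a degree makes parities additive under multiplication.
\<close>

definition par :: "nat \<Rightarrow> 'a set" where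
  "par k = (if even k then R0 else R1)"

lemma par_closed: "x \<in> par k \<Longrightarrow> x \<in> carrier R"
  by (auto simp: par_def even_closed odd_closed split: if_splits)

lemma par_add: "x \<in> par k \<Longrightarrow> y \<in> par k \<Longrightarrow> x \<oplus> y \<in> par k"
  by (auto simp: par_def even_add odd_add split: if_splits)

lemma par_neg: "x \<in> par k \<Longrightarrow> \<ominus> x \<in> par k"
  by (auto simp: par_def even_neg odd_neg split: if_splits)

lemma par_zero: "\<zero> \<in> par k"
  by (auto simp: par_def even_zero odd_zero)

lemma par_mult: "x \<in> par k \<Longrightarrow> y \<in> par l \<Longrightarrow> x \<otimes> y \<in> par (k + l)"
  by (auto simp: par_def even_mult even_odd_mult odd_even_mult odd_mult split: if_splits)

lemma par_Suc_Suc [simp]: "par (Suc (Suc k)) = par k"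
  by (simp add: par_def)

lemma par_disjoint: "x \<in> par k \<Longrightarrow> x \<in> par (Suc k) \<Longrightarrow> x = \<zero>"
  by (auto simp: par_def even_inter_odd split: if_splits)

lemma par_decompose:
  assumes "x \<in> carrier R"
  obtains a b where "a \<in> par k" "b \<in> par (Suc k)" "x = a \<oplus> b"
proof -
  obtain a b where "a \<in> R0" "b \<in> R1" "x = a \<oplus> b" using decompose[OF assms] .
  then show ?thesis
    using that[of a b] that[of b a] a_comm[of a b]
    by (cases "even k") (auto simp: par_def even_closed odd_closed)
qed

lemma par_finsum: "(\<And>i. i \<in> A \<Longrightarrow> f i \<in> par k) \<Longrightarrow> finsum R f A \<in> par k"
proof (induction A rule: infinite_finite_induct)
  case (insert x A)
  then show ?case by (subst finsum_insert) (auto simp: par_add intro: par_closed)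
qed (auto simp: par_zero)

lemma odd_subset: "R1 \<subseteq> carrier R"
  using odd_closed by auto

lemma canonical_ideal: "ideal (canonical_ideal R) R"
  unfolding canonical_ideal_def using odd_subset by (rule genideal_ideal)

lemma J_ideal: "ideal (J k) R"
  by (induction k) (auto simp: oneideal intro: ideal_prod_is_ideal canonical_ideal)

lemma J_closed: "x \<in> J k \<Longrightarrow> x \<in> carrier R"
  using ideal.Icarr[OF J_ideal] .

lemma J_add: "x \<in> J k \<Longrightarrow> y \<in> J k \<Longrightarrow> x \<oplus> y \<in> J k"
  and J_zero: "\<zero> \<in> J k"
  and J_neg: "x \<in> J k \<Longrightarrow> \<ominus> x \<in> J k"
  using ideal.axioms(1)[OF J_ideal, of k]
  by (auto simp: additive_subgroup.a_closed additive_subgroup.zero_closed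
      intro: additive_subgroup.a_inv_closed)

lemma J_minus: "x \<in> J k \<Longrightarrow> y \<in> J k \<Longrightarrow> x \<ominus> y \<in> J k"
  unfolding a_minus_def by (intro J_add J_neg)

lemma J_lmult: "x \<in> J k \<Longrightarrow> a \<in> carrier R \<Longrightarrow> a \<otimes> x \<in> J k"
  by (rule ideal.I_l_closed[OF J_ideal])

lemma J_finsum: "(\<And>i. i \<in> A \<Longrightarrow> f i \<in> J k) \<Longrightarrow> finsum R f A \<in> J k"
proof (induction A rule: infinite_finite_induct)
  case (insert x A)
  then show ?case by (subst finsum_insert) (auto simp: J_add intro: J_closed)
qed (auto simp: J_zero)

lemma J_Suc_subset: "J (Suc k) \<subseteq> J k"
  using ideal_prod_inter[OF canonical_ideal J_ideal] by auto

lemma J_antimono: "k \<le> l \<Longrightarrow> x \<in> J l \<Longrightarrow> x \<in> J k"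
  using lift_Suc_antimono_le[of "canonical_power R", OF J_Suc_subset] by blast

lemma J_1: "J (Suc 0) = canonical_ideal R"
  using ideal_prod_one[OF canonical_ideal] by simp

lemma odd_J: "x \<in> R1 \<Longrightarrow> x \<in> J (Suc 0)"
  unfolding J_1 canonical_ideal_def using genideal_self[OF odd_subset] by auto

lemma J_prod: "ideal_prod R (J k) (J l) = J (k + l)"
proof (induction k)
  case 0
  have "ideal_prod R (carrier R) (J l) = J l"
  proof
    show "ideal_prod R (carrier R) (J l) \<subseteq> J l"
      using ideal_prod_inter[OF oneideal J_ideal] by auto
    show "J l \<subseteq> ideal_prod R (carrier R) (J l)"
      using ideal_prod.prod[of \<one> "carrier R" _ "J l" R] J_closed by fastforce
  qed
  then show ?case by simp
next
  case (Suc k)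
  then show ?case by (simp add: ideal_prod_assoc canonical_ideal J_ideal)
qed

lemma J_mult: "x \<in> J k \<Longrightarrow> y \<in> J l \<Longrightarrow> x \<otimes> y \<in> J (k + l)"
  unfolding J_prod[symmetric] by (rule ideal_prod.prod)

lemma J_monomial: "(\<And>j. j \<in> set js \<Longrightarrow> N j \<in> J (Suc 0)) \<Longrightarrow> monomial R N js \<in> J (length js)"
proof (induction js)
  case (Cons j js)
  then show ?case using J_mult[of "N j" "Suc 0" "monomial R N js" "length js"] by simp
qed simp

text \<open>
  The elements of filtration degree m whose class modulo \<open>J\<^sup>m\<^sup>+\<^sup>1\<close> has the parity of m.
\<close>

definition pure :: "nat \<Rightarrow> 'a set" where
  "pure m = {a \<oplus> b | a b. a \<in> par m \<and> a \<in> J m \<and> b \<in> par (Suc m) \<and> b \<in> J (Suc m)}"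

lemma pureI:
  "a \<in> par m \<Longrightarrow> a \<in> J m \<Longrightarrow> b \<in> par (Suc m) \<Longrightarrow> b \<in> J (Suc m) \<Longrightarrow> x = a \<oplus> b \<Longrightarrow> x \<in> pure m"
  unfolding pure_def by blast

lemma pureE:
  assumes "x \<in> pure m"
  obtains a b where "a \<in> par m" "a \<in> J m" "b \<in> par (Suc m)" "b \<in> J (Suc m)" "x = a \<oplus> b"
    "a \<in> carrier R" "b \<in> carrier R"
  using assms par_closed unfolding pure_def by blast

lemma pure_add:
  assumes "x \<in> pure m" "y \<in> pure m"
  shows "x \<oplus> y \<in> pure m"
proof -
  obtain a b where ab: "a \<in> par m" "a \<in> J m" "b \<in> par (Suc m)" "b \<in> J (Suc m)" "x = a \<oplus> b"
    "a \<in> carrier R" "b \<in> carrier R" using pureE[OF assms(1)] .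
  obtain c d where cd: "c \<in> par m" "c \<in> J m" "d \<in> par (Suc m)" "d \<in> J (Suc m)" "y = c \<oplus> d"
    "c \<in> carrier R" "d \<in> carrier R" using pureE[OF assms(2)] .
  have "x \<oplus> y = (a \<oplus> c) \<oplus> (b \<oplus> d)" using ab(5-7) cd(5-7) by (simp add: a_ac)
  with par_add[OF ab(1) cd(1)] J_add[OF ab(2) cd(2)] par_add[OF ab(3) cd(3)] J_add[OF ab(4) cd(4)]
  show ?thesis by (rule pureI)
qed

lemma pure_mult:
  assumes "x \<in> pure m" "y \<in> pure n"
  shows "x \<otimes> y \<in> pure (m + n)"
proof -
  obtain a b where ab: "a \<in> par m" "a \<in> J m" "b \<in> par (Suc m)" "b \<in> J (Suc m)" "x = a \<oplus> b"
    "a \<in> carrier R" "b \<in> carrier R" using pureE[OF assms(1)] .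
  obtain c d where cd: "c \<in> par n" "c \<in> J n" "d \<in> par (Suc n)" "d \<in> J (Suc n)" "y = c \<oplus> d"
    "c \<in> carrier R" "d \<in> carrier R" using pureE[OF assms(2)] .
  show ?thesis
  proof (rule pureI)
    show "x \<otimes> y = (a \<otimes> c \<oplus> b \<otimes> d) \<oplus> (a \<otimes> d \<oplus> b \<otimes> c)"
      using ab(5-7) cd(5-7) by (simp add: l_distr r_distr a_ac)
    show "a \<otimes> c \<oplus> b \<otimes> d \<in> par (m + n)"
      using par_mult[OF ab(1) cd(1)] par_mult[OF ab(3) cd(3)] by (intro par_add) simp_all
    show "a \<otimes> d \<oplus> b \<otimes> c \<in> par (Suc (m + n))"
      using par_mult[OF ab(1) cd(3)] par_mult[OF ab(3) cd(1)] by (intro par_add) simp_all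
    show "a \<otimes> c \<oplus> b \<otimes> d \<in> J (m + n)"
      using J_mult[OF ab(2) cd(2)] J_antimono[OF _ J_mult[OF ab(4) cd(4)], of "m + n"]
      by (intro J_add) simp_all
    show "a \<otimes> d \<oplus> b \<otimes> c \<in> J (Suc (m + n))"
      using J_mult[OF ab(2) cd(4)] J_mult[OF ab(4) cd(2)] by (intro J_add) simp_all
  qed
qed

lemma carrier_pure: "x \<in> carrier R \<Longrightarrow> x \<in> pure 0"
proof -
  assume "x \<in> carrier R"
  then obtain a b where "a \<in> R0" "b \<in> R1" "x = a \<oplus> b" by (rule decompose)
  then show ?thesis using odd_J even_closed by (intro pureI[of a 0 b]) (auto simp: par_def)
qed

text \<open>
  \<open>J\<^sup>k\<close> is generated by products of k odd elements. Multiplying such a product by an even element keeps its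
  parity, and multiplying it by an odd element lands in \<open>J\<^sup>k\<^sup>+\<^sup>1\<close>.
\<close>

lemma J_pure: "x \<in> J k \<Longrightarrow> x \<in> pure k"
proof (induction k arbitrary: x)
  case 0
  then show ?case using carrier_pure by simp
next
  case (Suc k)
  have closed: "r \<otimes> u \<in> pure 1" "u \<otimes> r \<in> pure 1" if "u \<in> pure 1" "r \<in> carrier R" for u r
    using pure_mult[OF carrier_pure that(1)] pure_mult[OF that(1) carrier_pure] that(2) by auto
  have carr: "u \<in> carrier R" if "u \<in> pure 1" for u
    using that by (elim pureE) simp
  have odd: "a \<in> pure 1" if "a \<in> R1" for a
    using that odd_J odd_closed even_zero J_zero
    by (intro pureI[of a 1 \<zero>]) (auto simp: par_def simp del: canonical_power.simps)
  have "ideal (pure 1) R"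
  proof (rule idealI)
    show "subgroup (pure 1) (add_monoid R)"
    proof (rule add.subgroupI)
      show "pure 1 \<noteq> {}" using odd[OF odd_zero] by blast
      show "\<ominus> u \<in> pure 1" if "u \<in> pure 1" for u
        using closed(1)[OF that, of "\<ominus> \<one>"] carr[OF that] by (simp add: l_minus)
    qed (use carr pure_add in auto)
  qed (use closed ring_axioms in auto)
  then have I: "canonical_ideal R \<subseteq> pure 1"
    unfolding canonical_ideal_def using odd by (intro genideal_minimal) auto
  have "x \<in> ideal_prod R (canonical_ideal R) (J k)" using Suc.prems by simp
  then show ?case
  proof induction
    case (prod i j)
    then show ?case using pure_mult[of i 1 j k] I Suc.IH by auto
  qed (rule pure_add)
qed

text \<open>
  Hence every class in \<open>J\<^sup>k / J\<^sup>k\<^sup>+\<^sup>1\<close> has a representative of the parity of k, and an element of the opposite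
  parity represents zero.
\<close>

lemma J_wrong_parity:
  assumes "x \<in> J k" "x \<in> par (Suc k)"
  shows "x \<in> J (Suc k)"
proof -
  obtain a b where ab: "a \<in> par k" "b \<in> par (Suc k)" "b \<in> J (Suc k)" "x = a \<oplus> b"
    using pureE[OF J_pure[OF assms(1)]] by metis
  have "a = x \<oplus> \<ominus> b" using ab par_closed by (simp add: a_assoc r_neg)
  then have "a \<in> par (Suc k)" using ab(2) assms(2) par_add par_neg by metis
  then have "a = \<zero>" using par_disjoint ab(1) by blast
  then show ?thesis using ab par_closed[OF ab(2)] by simp
qed

lemma even_center: "x \<in> R0 \<Longrightarrow> x \<in> center"
  by (auto simp: center_def even_closed intro: even_commute)

lemma even_finsum: "(\<And>i. i \<in> A \<Longrightarrow> f i \<in> R0) \<Longrightarrow> finsum R f A \<in> R0"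
  using par_finsum[of A f 0] by (simp add: par_def)

lemma even_monomial: "(\<And>j. j \<in> set js \<Longrightarrow> N j \<in> R0) \<Longrightarrow> monomial R N js \<in> R0"
  by (induction js) (auto simp: even_one even_mult)

lemma even_contract:
  assumes "\<And>js. set js \<subseteq> {..<k} \<Longrightarrow> D js \<in> R0" "\<And>j. j < k \<Longrightarrow> N j \<in> R0"
  shows "contract k D N n \<in> R0"
  unfolding contraction_def using assms by (auto intro!: even_finsum even_mult even_monomial)

end

section \<open>Real scalars in a smooth superring\<close>

lemma comp_smooth_two: "comp_smooth (\<lambda>x. F (x 0) (x (Suc 0))) [f, g] = (\<lambda>x. F (f x) (g x))"
  by (simp add: comp_smooth_def)

lemma smooth_add_mult:
  "smooth (Suc (Suc n)) (\<lambda>x. x 0 + x (Suc 0))" "smooth (Suc (Suc n)) (\<lambda>x. x 0 * x (Suc 0))"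
  by (auto intro!: smooth_polyfuns polyfuns.intros)

lemma smooth_const: "smooth n (\<lambda>_. c)"
  by (intro smooth_polyfuns polyfuns.intros)

lemma cinf_ring_closed: "cinf_ring C \<phi> \<Longrightarrow> smooth (length cs) f \<Longrightarrow> set cs \<subseteq> C \<Longrightarrow> \<phi> f cs \<in> C"
  unfolding cinf_ring_def by blast

lemma cinf_ring_coord: "cinf_ring C \<phi> \<Longrightarrow> set cs \<subseteq> C \<Longrightarrow> i < length cs \<Longrightarrow> \<phi> (\<lambda>x. x i) cs = cs ! i"
  unfolding cinf_ring_def by blast

lemma cinf_ring_comp:
  "cinf_ring C \<phi> \<Longrightarrow> smooth (length gs) f \<Longrightarrow> (\<And>g. g \<in> set gs \<Longrightarrow> smooth (length cs) g) \<Longrightarrow> set cs \<subseteq> C \<Longrightarrow>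
    \<phi> (comp_smooth f gs) cs = \<phi> f (map (\<lambda>g. \<phi> g cs) gs)"
  unfolding cinf_ring_def by blast

lemma cinf_ring_pointwise:
  assumes C: "cinf_ring C \<phi>" "set cs \<subseteq> C" "smooth (length cs) f" "smooth (length cs) g"
  shows "\<phi> (\<lambda>x. f x + g x) cs = \<phi> (\<lambda>x. x 0 + x 1) [\<phi> f cs, \<phi> g cs]"
    and "\<phi> (\<lambda>x. f x * g x) cs = \<phi> (\<lambda>x. x 0 * x 1) [\<phi> f cs, \<phi> g cs]"
  using cinf_ring_comp[OF C(1), of "[f, g]" "\<lambda>x. x 0 + x 1" cs]
    cinf_ring_comp[OF C(1), of "[f, g]" "\<lambda>x. x 0 * x 1" cs] C(2-4) smooth_add_mult[of 0]
  by (auto simp: comp_smooth_two)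

lemma cinf_ring_const:
  assumes "cinf_ring C \<phi>" "set cs \<subseteq> C"
  shows "\<phi> (\<lambda>_. c) cs = \<phi> (\<lambda>_. c) []"
  using cinf_ring_comp[OF assms(1), of "[]" "\<lambda>_. c" cs] assms(2) smooth_const by (simp add: comp_smooth_def)

locale cinf_super = supercommutative +
  assumes cinf_superring: "cinf_superring R"
begin

abbreviation "op \<equiv> smooth_op R"

definition scalar :: "real \<Rightarrow> 'a" where
  "scalar c = op (\<lambda>_. c) []"

lemma even_cinf_ring: "cinf_ring R0 op"
  using cinf_superring unfolding cinf_superring_def by blast

lemma op_closed: "smooth (length as) f \<Longrightarrow> set as \<subseteq> R0 \<Longrightarrow> op f as \<in> R0"
  using cinf_ring_closed[OF even_cinf_ring] .

lemma op_add_mult: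
  assumes "a \<in> R0" "b \<in> R0"
  shows "op (\<lambda>x. x 0 + x 1) [a, b] = a \<oplus> b" "op (\<lambda>x. x 0 * x 1) [a, b] = a \<otimes> b"
  using cinf_superring assms unfolding cinf_superring_def by auto

lemma scalar_even: "scalar c \<in> R0"
  unfolding scalar_def by (intro op_closed smooth_const) simp

lemma scalar_closed [simp]: "scalar c \<in> carrier R"
  using scalar_even even_closed by blast

lemma scalar_0 [simp]: "scalar 0 = \<zero>" and scalar_1 [simp]: "scalar 1 = \<one>"
  using cinf_superring unfolding cinf_superring_def scalar_def by auto

lemma scalar_add: "scalar (a + b) = scalar a \<oplus> scalar b"
  and scalar_mult: "scalar (a * b) = scalar a \<otimes> scalar b"
  using cinf_ring_pointwise[OF even_cinf_ring, of "[]" "\<lambda>_. a" "\<lambda>_. b"] smooth_const[of 0]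
    op_add_mult[OF scalar_even scalar_even, of a b]
  by (auto simp: scalar_def)

lemma scalar_minus: "scalar (- a) = \<ominus> scalar a"
  using scalar_add[of "- a" a] by (intro minus_equality[symmetric]) auto

lemma scalar_of_nat: "x \<in> carrier R \<Longrightarrow> scalar (real n) \<otimes> x = [n] \<cdot> x"
  by (induction n) (auto simp: scalar_add l_distr a_comm add.nat_pow_Suc)

lemma scalar_commute: "x \<in> carrier R \<Longrightarrow> x \<otimes> scalar c = scalar c \<otimes> x"
  using even_commute[OF scalar_even] by simp

lemma scalar_inverse: "c \<noteq> 0 \<Longrightarrow> x \<in> carrier R \<Longrightarrow> scalar (inverse c) \<otimes> (scalar c \<otimes> x) = x"
  by (simp add: m_assoc[symmetric] scalar_mult[symmetric])

lemma scalar_eq_zero: "c \<noteq> 0 \<Longrightarrow> x \<in> carrier R \<Longrightarrow> scalar c \<otimes> x = \<zero> \<Longrightarrow> x = \<zero>"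
  using scalar_inverse[of c x] by simp

lemma scalar_binomial_fact:
  "[((l + m) choose m)] \<cdot> scalar (1 / fact (l + m)) = scalar (1 / fact l) \<otimes> scalar (1 / fact m)"
proof -
  have "real ((l + m) choose m) * (1 / fact (l + m)) = 1 / fact l * (1 / fact m)"
    by (simp add: binomial_fact field_simps)
  then show ?thesis
    by (simp only: scalar_of_nat[symmetric] scalar_closed scalar_mult[symmetric])
qed

lemma symmetric_family_op:
  assumes "smooth (length as) f"
  shows "symmetric_family (length as) (\<lambda>js. op (partials js f) as)"
  unfolding symmetric_family_def
  using partials_insert_Cons[OF assms] by (auto simp del: partials_Cons)

lemma op_partials_even:
  assumes "smooth (length as) f" "set as \<subseteq> R0" "set js \<subseteq> {..<length as}"
  shows "op (partials js f) as \<in> R0"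
  using assms by (intro op_closed smooth_partials)

lemma taylor_nilpotent:
  assumes f: "smooth (length cs) f" and cs: "set cs \<subseteq> R0"
    and Ns: "\<And>j. j < length cs \<Longrightarrow> Ns ! j \<in> R0"
    and vanish: "\<And>js. set js \<subseteq> {..<length cs} \<Longrightarrow> length js \<ge> q \<Longrightarrow> monomial R ((!) Ns) js = \<zero>"
  shows "taylor R (\<lambda>x. x) op f cs Ns = (\<Oplus>n\<in>{..<q}. scalar (1 / fact n) \<otimes>
    contract (length cs) (\<lambda>js. op (partials js f) cs) ((!) Ns) n)"
proof -
  have D: "op (partials js f) cs \<in> carrier R" if "set js \<subseteq> {..<length cs}" for js
    using op_partials_even[OF f cs that] even_closed by blast
  have N: "Ns ! j \<in> carrier R" if "j < length cs" for j
    using Ns[OF that] even_closed by blast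
  have "contract (length cs) (\<lambda>js. op (partials js f) cs) ((!) Ns) n = \<zero>" if "n \<ge> q" for n
    unfolding contraction_def using that vanish D by (intro add.finprod_one_eqI) auto
  then have "taylor R (\<lambda>x. x) op f cs Ns = (\<Oplus>n\<in>{..<q}. taylor_term R (\<lambda>x. x) op f cs Ns n)"
    using D N by (intro taylor_finite ring_axioms) 
      (auto simp: taylor_term_eq scalar_def[symmetric] intro!: m_closed contract_closed)
  then show ?thesis
    by (simp add: taylor_term_eq[abs_def] scalar_def)
qed

end

section \<open>Taylor's formula in split superrings\<close>

lemma finsum_cong_ring:
  fixes A :: "('a, 'm) ring_scheme" and B :: "('a, 'n) ring_scheme"
  assumes "carrier A = carrier B" "zero A = zero B" "add A = add B"
  shows "finsum A g T = finsum B g T"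
  using assms by (simp add: finsum_def finprod_def)

lemma taylor_cong_ring:
  fixes A :: "('a, 'm) ring_scheme" and B :: "('a, 'n) ring_scheme"
  assumes "carrier A = carrier B" "mult A = mult B" "one A = one B" "zero A = zero B" "add A = add B"
  shows "taylor A \<iota> \<phi> f fs Ns = taylor B \<iota> \<phi> f fs Ns"
  using assms by (simp add: taylor_def taylor_term_def finsum_cong_ring[of A B])

text \<open>
  Each axiom is an identity between polynomial functions of three variables: evaluation of the operations
  at \<open>(a, b, c)\<close> turns pointwise sums and products into sums and products of the ring.
\<close>

lemma cring_ring_of_cinf:
  assumes C: "cinf_ring C \<phi>"
  shows "cring (ring_of_cinf C \<phi>)"
proof -
  define K where "K = ring_of_cinf C \<phi>"
  have K: "carrier K = C" "\<And>a b. a \<oplus>\<^bsub>K\<^esub> b = \<phi> (\<lambda>x. x 0 + x 1) [a, b]"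
    "\<And>a b. a \<otimes>\<^bsub>K\<^esub> b = \<phi> (\<lambda>x. x 0 * x 1) [a, b]" "\<zero>\<^bsub>K\<^esub> = \<phi> (\<lambda>_. 0) []" "\<one>\<^bsub>K\<^esub> = \<phi> (\<lambda>_. 1) []"
    by (simp_all add: K_def ring_of_cinf_def)
  note poly = polyfuns.intros[of _ 3]
  have closed: "\<phi> f [a, b, c] \<in> C" if "a \<in> C" "b \<in> C" "c \<in> C" "f \<in> polyfuns 3" for a b c f
    using cinf_ring_closed[OF C, of "[a, b, c]" f] smooth_polyfuns[of f 3] that
    by (simp add: eval_nat_numeral)
  have add: "\<phi> f [a, b, c] \<oplus>\<^bsub>K\<^esub> \<phi> g [a, b, c] = \<phi> (\<lambda>x. f x + g x) [a, b, c]"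
    and mult: "\<phi> f [a, b, c] \<otimes>\<^bsub>K\<^esub> \<phi> g [a, b, c] = \<phi> (\<lambda>x. f x * g x) [a, b, c]"
    if "a \<in> C" "b \<in> C" "c \<in> C" "f \<in> polyfuns 3" "g \<in> polyfuns 3" for a b c f g
    using cinf_ring_pointwise[OF C, of "[a, b, c]" f g] smooth_polyfuns[of _ 3] that
    by (simp_all add: K eval_nat_numeral)
  have coord: "\<phi> (\<lambda>x. x 0) [a, b, c] = a" "\<phi> (\<lambda>x. x 1) [a, b, c] = b" "\<phi> (\<lambda>x. x 2) [a, b, c] = c"
    if "a \<in> C" "b \<in> C" "c \<in> C" for a b c
    using cinf_ring_coord[OF C, of "[a, b, c]"] that by auto
  have const: "\<phi> (\<lambda>_. r) [a, b, c] = \<phi> (\<lambda>_. r) []" if "a \<in> C" "b \<in> C" "c \<in> C" for a b c r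
    using cinf_ring_const[OF C, of "[a, b, c]" r] that by simp
  have p: "(\<lambda>x. x 0) \<in> polyfuns 3" "(\<lambda>x. x 1) \<in> polyfuns 3" "(\<lambda>x. x 2) \<in> polyfuns 3"
    by (auto intro: poly)
  have add_closed: "a \<oplus>\<^bsub>K\<^esub> b \<in> C" and mult_closed: "a \<otimes>\<^bsub>K\<^esub> b \<in> C" if "a \<in> C" "b \<in> C" for a b
    using add[OF that that(1) p(1,2)] mult[OF that that(1) p(1,2)] coord[OF that that(1)]
      closed[OF that that(1) poly(3)[OF p(1,2)]] closed[OF that that(1) poly(4)[OF p(1,2)]] by auto
  have const_closed: "\<phi> (\<lambda>_. r) [] \<in> C" for r
    using cinf_ring_closed[OF C, of "[]"] smooth_const by simp
  have "cring K"
  proof (rule cringI)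
    show "abelian_group K"
    proof (rule abelian_groupI; unfold K(1))
      fix a b c assume abc: "a \<in> C" "b \<in> C" "c \<in> C"
      note ev = add[OF abc] coord[OF abc] const[OF abc]
      show "a \<oplus>\<^bsub>K\<^esub> b \<oplus>\<^bsub>K\<^esub> c = a \<oplus>\<^bsub>K\<^esub> (b \<oplus>\<^bsub>K\<^esub> c)"
        using ev(1)[of "\<lambda>x. x 0 + x 1" "\<lambda>x. x 2"] ev(1)[of "\<lambda>x. x 0" "\<lambda>x. x 1 + x 2"]
          ev(1)[OF p(1,2)] ev(1)[OF p(2,3)] p ev(2-4) by (simp add: poly add.assoc)
    next
      fix a b assume ab: "a \<in> C" "b \<in> C"
      show "a \<oplus>\<^bsub>K\<^esub> b = b \<oplus>\<^bsub>K\<^esub> a"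
        using add[OF ab ab(1) p(1,2)] add[OF ab ab(1) p(2,1)] coord[OF ab ab(1)] by (simp add: add.commute)
    next
      fix a assume a: "a \<in> C"
      show "\<zero>\<^bsub>K\<^esub> \<oplus>\<^bsub>K\<^esub> a = a"
        using add[OF a a a, of "\<lambda>_. 0" "\<lambda>x. x 0"] p(1) coord[OF a a a] const[OF a a a]
        by (simp add: K(4) poly)
      have "\<phi> (\<lambda>x. - 1 * x 0) [a, a, a] \<in> C"
        by (intro closed a poly) simp
      moreover have "\<phi> (\<lambda>x. - 1 * x 0) [a, a, a] \<oplus>\<^bsub>K\<^esub> a = \<zero>\<^bsub>K\<^esub>"
        using add[OF a a a, of "\<lambda>x. - 1 * x 0" "\<lambda>x. x 0"] poly(4)[OF poly(1)[of "- 1"] p(1)] p(1)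
          coord[OF a a a] const[OF a a a, of 0]
        by (simp add: K(4))
      ultimately show "\<exists>y\<in>C. y \<oplus>\<^bsub>K\<^esub> a = \<zero>\<^bsub>K\<^esub>" by blast
    qed (use add_closed const_closed in \<open>simp_all add: K(4)\<close>)
    show "comm_monoid K"
    proof (rule comm_monoidI; unfold K(1))
      fix a b c assume abc: "a \<in> C" "b \<in> C" "c \<in> C"
      note ev = mult[OF abc] coord[OF abc] const[OF abc]
      show "a \<otimes>\<^bsub>K\<^esub> b \<otimes>\<^bsub>K\<^esub> c = a \<otimes>\<^bsub>K\<^esub> (b \<otimes>\<^bsub>K\<^esub> c)"
        using ev(1)[of "\<lambda>x. x 0 * x 1" "\<lambda>x. x 2"] ev(1)[of "\<lambda>x. x 0" "\<lambda>x. x 1 * x 2"]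
          ev(1)[OF p(1,2)] ev(1)[OF p(2,3)] p ev(2-4) by (simp add: poly mult.assoc)
    next
      fix a b assume ab: "a \<in> C" "b \<in> C"
      show "a \<otimes>\<^bsub>K\<^esub> b = b \<otimes>\<^bsub>K\<^esub> a"
        using mult[OF ab ab(1) p(1,2)] mult[OF ab ab(1) p(2,1)] coord[OF ab ab(1)] by (simp add: mult.commute)
    next
      fix a assume a: "a \<in> C"
      show "\<one>\<^bsub>K\<^esub> \<otimes>\<^bsub>K\<^esub> a = a"
        using mult[OF a a a, of "\<lambda>_. 1" "\<lambda>x. x 0"] p(1) coord[OF a a a] const[OF a a a]
        by (simp add: K(5) poly)
    qed (use mult_closed const_closed in \<open>simp_all add: K(5)\<close>)
    fix a b c assume "a \<in> carrier K" "b \<in> carrier K" "c \<in> carrier K"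
    then have abc: "a \<in> C" "b \<in> C" "c \<in> C" by (simp_all add: K(1))
    note ev = coord[OF abc]
    show "(a \<oplus>\<^bsub>K\<^esub> b) \<otimes>\<^bsub>K\<^esub> c = a \<otimes>\<^bsub>K\<^esub> c \<oplus>\<^bsub>K\<^esub> b \<otimes>\<^bsub>K\<^esub> c"
      using mult[OF abc, of "\<lambda>x. x 0 + x 1" "\<lambda>x. x 2"] add[OF abc p(1,2)]
        add[OF abc, of "\<lambda>x. x 0 * x 2" "\<lambda>x. x 1 * x 2"] mult[OF abc p(1,3)] mult[OF abc p(2,3)]
        p ev by (simp add: poly distrib_right)
  qed
  then show ?thesis by (simp add: K_def)
qed

locale split_presentation = cinf_super R
  for R :: "('a, 'm) cinf_superstructure_scheme" (structure) +
  fixes C :: "'c set" and \<phi> :: "'c cinf_ops" and q :: nat and h :: "'a \<Rightarrow> nat set \<Rightarrow> 'c"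
  assumes C: "cinf_ring C \<phi>" and iso: "cinf_superring_iso R (grassmann C \<phi> q) h"
begin

definition "K = ring_of_cinf C \<phi>"
definition "S = grassmann C \<phi> q"

sublocale K: cring K
  unfolding K_def by (rule cring_ring_of_cinf[OF C])

lemma K_carrier: "carrier K = C"
  by (simp add: K_def ring_of_cinf_def)

lemma S_carrier: "carrier S = Pow {..<q} \<rightarrow>\<^sub>E C"
  and S_add: "F \<oplus>\<^bsub>S\<^esub> H = (\<lambda>A\<in>Pow {..<q}. F A \<oplus>\<^bsub>K\<^esub> H A)"
  and S_mult: "F \<otimes>\<^bsub>S\<^esub> H = (\<lambda>A\<in>Pow {..<q}. \<Oplus>\<^bsub>K\<^esub>B \<in> Pow A.
      (if even (inversions B (A - B)) then F B \<otimes>\<^bsub>K\<^esub> H (A - B) else \<ominus>\<^bsub>K\<^esub> (F B \<otimes>\<^bsub>K\<^esub> H (A - B))))"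
  and S_zero: "\<zero>\<^bsub>S\<^esub> = (\<lambda>A\<in>Pow {..<q}. \<zero>\<^bsub>K\<^esub>)"
  and S_one: "\<one>\<^bsub>S\<^esub> = (\<lambda>A\<in>Pow {..<q}. if A = {} then \<one>\<^bsub>K\<^esub> else \<zero>\<^bsub>K\<^esub>)"
  and S_even: "even_part S = {F \<in> carrier S. \<forall>A\<subseteq>{..<q}. odd (card A) \<longrightarrow> F A = \<zero>\<^bsub>K\<^esub>}"
  and S_odd: "odd_part S = {F \<in> carrier S. \<forall>A\<subseteq>{..<q}. even (card A) \<longrightarrow> F A = \<zero>\<^bsub>K\<^esub>}"
  by (simp_all add: S_def grassmann_def grassmann_ring_def Let_def K_def[symmetric])

lemma S_op: "smooth_op S f Fs = taylor S (grassmann_const C \<phi> q) \<phi> f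
    (map (\<lambda>F. F {}) Fs) (map (\<lambda>F. F({} := \<zero>\<^bsub>K\<^esub>)) Fs)"
proof -
  have "taylor (grassmann_ring C \<phi> q) \<iota> \<phi> f fs Ns = taylor S \<iota> \<phi> f fs Ns" for \<iota> fs Ns
    by (rule taylor_cong_ring) (simp_all add: S_def grassmann_def Let_def)
  then show ?thesis by (simp add: S_def grassmann_def Let_def K_def)
qed

lemma h_hom: "h \<in> ring_hom R S"
  and h_bij: "bij_betw h (carrier R) (carrier S)"
  and h_even: "x \<in> R0 \<Longrightarrow> h x \<in> even_part S"
  and h_odd: "x \<in> R1 \<Longrightarrow> h x \<in> odd_part S"
  and h_op: "smooth (length as) f \<Longrightarrow> set as \<subseteq> R0 \<Longrightarrow> h (op f as) = smooth_op S f (map h as)"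
  using iso unfolding cinf_superring_iso_def cinf_superring_hom_def S_def by blast+

lemma h_inj: "h x = h y \<Longrightarrow> x \<in> carrier R \<Longrightarrow> y \<in> carrier R \<Longrightarrow> x = y"
  using h_bij unfolding bij_betw_def inj_on_def by blast

lemma h_closed: "x \<in> carrier R \<Longrightarrow> h x \<in> carrier S"
  using ring_hom_closed[OF h_hom] .

lemma coeff_closed: "F \<in> carrier S \<Longrightarrow> A \<subseteq> {..<q} \<Longrightarrow> F A \<in> carrier K"
  by (auto simp: S_carrier K_carrier)

lemma S_eqI: "F \<in> carrier S \<Longrightarrow> H \<in> carrier S \<Longrightarrow> (\<And>A. A \<subseteq> {..<q} \<Longrightarrow> F A = H A) \<Longrightarrow> F = H"
  unfolding S_carrier by (rule PiE_ext) auto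

lemma h_add: "x \<in> carrier R \<Longrightarrow> y \<in> carrier R \<Longrightarrow> A \<subseteq> {..<q} \<Longrightarrow> h (x \<oplus> y) A = h x A \<oplus>\<^bsub>K\<^esub> h y A"
  using ring_hom_add[OF h_hom] by (simp add: S_add)

lemma S_zero_closed: "\<zero>\<^bsub>S\<^esub> \<in> carrier S"
  using K.zero_closed unfolding K_carrier by (auto simp: S_zero S_carrier)

lemma h_zero: "h \<zero> = \<zero>\<^bsub>S\<^esub>"
proof (rule S_eqI)
  fix A assume A: "A \<subseteq> {..<q}"
  have "h \<zero> A = h \<zero> A \<oplus>\<^bsub>K\<^esub> h \<zero> A" using h_add[OF zero_closed zero_closed A] by simp
  moreover have "h \<zero> A \<in> carrier K" by (intro coeff_closed h_closed A zero_closed)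
  ultimately show "h \<zero> A = \<zero>\<^bsub>S\<^esub> A"
    using A by (simp add: S_zero)
qed (auto intro: h_closed S_zero_closed)

text \<open>
  The ring axioms of the exterior algebra are inherited from R through h, which avoids computations with
  shuffle signs.
\<close>

lemma ring_S: "ring S"
proof -
  have "h \<in> ring_iso R S" using h_hom h_bij by (simp add: ring_iso_def)
  from ring_iso_imp_img_ring[OF this] show ?thesis by (simp add: h_zero)
qed

definition lift :: "(nat set \<Rightarrow> 'c) \<Rightarrow> 'a" where
  "lift = inv_into (carrier R) h"

lemma h_lift: "F \<in> carrier S \<Longrightarrow> h (lift F) = F"
  and lift_closed: "F \<in> carrier S \<Longrightarrow> lift F \<in> carrier R"
  using h_bij unfolding lift_def bij_betw_def by (auto simp: f_inv_into_f inv_into_into)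

lemma even_of_h:
  assumes x: "x \<in> carrier R" and hx: "h x \<in> even_part S"
  shows "x \<in> R0"
proof -
  obtain a b where ab: "a \<in> R0" "b \<in> R1" "x = a \<oplus> b" using decompose[OF x] .
  have "h b = h \<zero>"
    unfolding h_zero
  proof (rule S_eqI)
    fix A assume A: "A \<subseteq> {..<q}"
    show "h b A = \<zero>\<^bsub>S\<^esub> A"
    proof (cases "even (card A)")
      case True
      then show ?thesis using h_odd[OF ab(2)] A by (simp add: S_odd S_zero)
    next
      case False
      then have "h x A = \<zero>\<^bsub>K\<^esub>" "h a A = \<zero>\<^bsub>K\<^esub>" using hx h_even[OF ab(1)] A by (auto simp: S_even)
      moreover have "h x A = h a A \<oplus>\<^bsub>K\<^esub> h b A" unfolding ab(3) by (intro h_add A even_closed odd_closed ab)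
      moreover have "h b A \<in> carrier K" by (intro coeff_closed h_closed A odd_closed ab)
      ultimately show ?thesis using A by (simp add: S_zero)
    qed
  qed (use ab odd_closed h_closed S_zero_closed in auto)
  then have "b = \<zero>" using h_inj ab odd_closed by blast
  then show ?thesis using ab even_closed by simp
qed

text \<open>
  The filtration of the exterior algebra by the number of generators, pulled back to R. It contains the
  filtration by powers of the canonical ideal and can be computed coefficient by coefficient.
\<close>

definition Fil :: "nat \<Rightarrow> 'a set" where
  "Fil k = {x \<in> carrier R. \<forall>A\<subseteq>{..<q}. card A < k \<longrightarrow> h x A = \<zero>\<^bsub>K\<^esub>}"

lemma Fil_closed: "x \<in> Fil k \<Longrightarrow> x \<in> carrier R"
  by (simp add: Fil_def)

lemma Fil_0: "Fil 0 = carrier R"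
  by (simp add: Fil_def)

lemma Fil_zero: "\<zero> \<in> Fil k"
  by (auto simp: Fil_def h_zero S_zero)

lemma Fil_add: "x \<in> Fil k \<Longrightarrow> y \<in> Fil k \<Longrightarrow> x \<oplus> y \<in> Fil k"
  by (auto simp: Fil_def h_add)

lemma Fil_mult:
  assumes x: "x \<in> Fil k" and y: "y \<in> Fil l"
  shows "x \<otimes> y \<in> Fil (k + l)"
  unfolding Fil_def
proof (intro CollectI conjI allI impI)
  show "x \<otimes> y \<in> carrier R" using x y Fil_closed by simp
  fix A assume A: "A \<subseteq> {..<q}" "card A < k + l"
  have fin: "finite A" using A(1) finite_subset by blast
  have "h x B \<otimes>\<^bsub>K\<^esub> h y (A - B) = \<zero>\<^bsub>K\<^esub>" if B: "B \<subseteq> A" for B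
  proof -
    have c: "h x B \<in> carrier K" "h y (A - B) \<in> carrier K"
      using A(1) B x y Fil_closed by (auto intro!: coeff_closed h_closed)
    have "card A = card B + card (A - B)"
      using card_Diff_subset[OF finite_subset[OF B fin] B] card_mono[OF fin B] by simp
    then have "card B < k \<or> card (A - B) < l" using A(2) by linarith
    moreover have "B \<subseteq> {..<q}" "A - B \<subseteq> {..<q}" using A(1) B by auto
    ultimately have "h x B = \<zero>\<^bsub>K\<^esub> \<or> h y (A - B) = \<zero>\<^bsub>K\<^esub>"
      using x y unfolding Fil_def by blast
    then show ?thesis using c by auto
  qed
  then have "(\<Oplus>\<^bsub>K\<^esub>B \<in> Pow A. (if even (inversions B (A - B)) then h x B \<otimes>\<^bsub>K\<^esub> h y (A - B)
      else \<ominus>\<^bsub>K\<^esub> (h x B \<otimes>\<^bsub>K\<^esub> h y (A - B)))) = \<zero>\<^bsub>K\<^esub>"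
    by (intro K.add.finprod_one_eqI) auto
  then show "h (x \<otimes> y) A = \<zero>\<^bsub>K\<^esub>"
    using A(1) ring_hom_mult[OF h_hom] Fil_closed[OF x] Fil_closed[OF y] by (simp add: S_mult)
qed

lemma Fil_ideal: "ideal (Fil k) R"
proof (rule idealI)
  have mult: "a \<otimes> x \<in> Fil k" "x \<otimes> a \<in> Fil k" if "x \<in> Fil k" "a \<in> carrier R" for a x
    using Fil_mult[of a 0 x k] Fil_mult[of x k a 0] that by (auto simp: Fil_0)
  then show "x \<in> Fil k \<Longrightarrow> a \<in> carrier R \<Longrightarrow> a \<otimes> x \<in> Fil k"
    "x \<in> Fil k \<Longrightarrow> a \<in> carrier R \<Longrightarrow> x \<otimes> a \<in> Fil k" for a x by auto
  show "subgroup (Fil k) (add_monoid R)"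
  proof (rule add.subgroupI)
    show "\<ominus> x \<in> Fil k" if x: "x \<in> Fil k" for x
      using mult(1)[OF x, of "\<ominus> \<one>"] Fil_closed[OF x] by (simp add: l_minus)
    show "Fil k \<noteq> {}" using Fil_zero by blast
  qed (use Fil_closed Fil_add in auto)
qed (rule ring_axioms)

lemma J_subset_Fil: "J k \<subseteq> Fil k"
proof (induction k)
  case 0
  then show ?case by (simp add: Fil_0)
next
  case (Suc k)
  have "R1 \<subseteq> Fil 1"
  proof
    fix x assume "x \<in> R1"
    moreover have "finite A" if "A \<subseteq> {..<q}" for A :: "nat set" using that finite_subset by blast
    ultimately show "x \<in> Fil 1" using h_odd[of x] odd_closed by (auto simp: Fil_def S_odd)
  qed
  then have 1: "canonical_ideal R \<subseteq> Fil 1"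
    unfolding canonical_ideal_def by (rule genideal_minimal[OF Fil_ideal])
  show ?case
  proof
    fix x assume "x \<in> J (Suc k)"
    then have "x \<in> ideal_prod R (canonical_ideal R) (J k)" by simp
    then show "x \<in> Fil (Suc k)"
    proof induction
      case (prod i j)
      then show ?case using Fil_mult[of i 1 j k] 1 Suc by auto
    qed (rule Fil_add)
  qed
qed

lemma Fil_Suc_q: "x \<in> Fil (Suc q) \<Longrightarrow> x = \<zero>"
proof -
  assume x: "x \<in> Fil (Suc q)"
  have "h x = h \<zero>"
    unfolding h_zero
  proof (rule S_eqI)
    fix A assume A: "A \<subseteq> {..<q}"
    then have "card A < Suc q" using card_mono[OF finite_lessThan A] by simp
    then show "h x A = \<zero>\<^bsub>S\<^esub> A" using x A by (simp add: Fil_def S_zero)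
  qed (use x Fil_closed h_closed S_zero_closed in auto)
  then show "x = \<zero>" using h_inj Fil_closed[OF x] by blast
qed

lemma J_nilpotent: "J (Suc q) = {\<zero>}"
  using J_subset_Fil[of "Suc q"] Fil_Suc_q J_zero[of "Suc q"] by blast

lemma Fil_antimono: "k \<le> l \<Longrightarrow> x \<in> Fil l \<Longrightarrow> x \<in> Fil k"
  by (simp add: Fil_def)

lemma Fil_monomial: "(\<And>j. j \<in> set js \<Longrightarrow> N j \<in> Fil 1) \<Longrightarrow> monomial R N js \<in> Fil (length js)"
proof (induction js)
  case (Cons j js)
  then show ?case using Fil_mult[of "N j" 1 "monomial R N js" "length js"] by simp
qed (simp add: Fil_0)

abbreviation "gconst \<equiv> grassmann_const C \<phi> q"

text \<open>
  The ring C of the presentation embeds into R as the coefficients of degree zero. The map respects the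
  smooth operations, since the Taylor expansion at a vanishing nilpotent part is constant.
\<close>

definition const :: "'c \<Rightarrow> 'a" where
  "const c = lift (gconst c)"

lemma gconst_eq: "gconst c = (\<lambda>A\<in>Pow {..<q}. if A = {} then c else \<zero>\<^bsub>K\<^esub>)"
  unfolding grassmann_const_def K_def by (rule refl)

lemma gconst_closed: "c \<in> C \<Longrightarrow> gconst c \<in> carrier S"
  unfolding gconst_eq S_carrier using K.zero_closed by (auto simp: K_carrier)

lemma h_const: "c \<in> C \<Longrightarrow> h (const c) = gconst c"
  unfolding const_def by (intro h_lift gconst_closed)

lemma const_even: "c \<in> C \<Longrightarrow> const c \<in> R0"
proof (rule even_of_h)
  assume c: "c \<in> C"
  then show "const c \<in> carrier R" unfolding const_def by (intro lift_closed gconst_closed)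
  show "h (const c) \<in> even_part S"
    using c gconst_closed[OF c] by (auto simp: h_const S_even gconst_eq)
qed

lemma body_decompose:
  assumes a: "a \<in> R0"
  shows "h a {} \<in> C" "a \<ominus> const (h a {}) \<in> R0" "a \<ominus> const (h a {}) \<in> Fil 1"
    "h (a \<ominus> const (h a {})) = (h a)({} := \<zero>\<^bsub>K\<^esub>)"
proof -
  have ha: "h a \<in> carrier S" using a even_closed h_closed by blast
  show c: "h a {} \<in> C" using coeff_closed[OF ha, of "{}"] by (simp add: K_carrier)
  note e = const_even[OF c]
  show R0: "a \<ominus> const (h a {}) \<in> R0" unfolding a_minus_def using a e by (intro even_add even_neg)
  have N: "a \<ominus> const (h a {}) \<in> carrier R" using R0 even_closed by blast
  have eq: "a = const (h a {}) \<oplus> (a \<ominus> const (h a {}))"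
    using even_closed[OF a] even_closed[OF e] by (simp add: a_minus_def a_ac r_neg r_neg2)
  show "h (a \<ominus> const (h a {})) = (h a)({} := \<zero>\<^bsub>K\<^esub>)"
  proof (rule S_eqI)
    fix A assume A: "A \<subseteq> {..<q}"
    have "h a A = h (const (h a {})) A \<oplus>\<^bsub>K\<^esub> h (a \<ominus> const (h a {})) A"
      using h_add[OF even_closed[OF e] N A] eq by simp
    moreover have cl: "h (a \<ominus> const (h a {})) A \<in> carrier K" "h a A \<in> carrier K"
      using A N ha by (auto intro!: coeff_closed h_closed)
    ultimately show "h (a \<ominus> const (h a {})) A = ((h a)({} := \<zero>\<^bsub>K\<^esub>)) A"
      using A h_const[OF c] K.add.l_cancel_one'[of "h a A" "h (a \<ominus> const (h a {})) A"]
      by (auto simp: gconst_eq)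
  next
    show "(h a)({} := \<zero>\<^bsub>K\<^esub>) \<in> carrier S"
      using ha K.zero_closed by (auto simp: S_carrier K_carrier PiE_def extensional_def)
  qed (use N h_closed in auto)
  then show "a \<ominus> const (h a {}) \<in> Fil 1"
    using N by (auto simp: Fil_def dest: finite_subset)
qed

lemma const_op:
  assumes f: "smooth (length cs) f" and cs: "set cs \<subseteq> C"
  shows "const (\<phi> f cs) = op f (map const cs)"
proof -
  have even: "set (map const cs) \<subseteq> R0" using cs const_even by auto
  have D: "\<phi> (partials js f) cs \<in> C" if "set js \<subseteq> {..<length cs}" for js
    using cinf_ring_closed[OF C smooth_partials[OF f that] cs] .
  have s: "\<phi> (\<lambda>_. r) [] \<in> C" for r
    using cinf_ring_closed[OF C, of "[]"] smooth_const by simp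
  have "h (op f (map const cs)) = smooth_op S f (map gconst cs)"
    using h_op[OF _ even, of f] f cs h_const by (simp add: subset_iff cong: map_cong)
  also have "\<dots> = taylor S gconst \<phi> f (map (\<lambda>F. F {}) (map gconst cs))
      (map (\<lambda>F. F({} := \<zero>\<^bsub>K\<^esub>)) (map gconst cs))"
    by (simp add: S_op)
  also have "map (\<lambda>F. F {}) (map gconst cs) = cs"
    by (simp add: gconst_eq comp_def)
  also have "taylor S gconst \<phi> f cs (map (\<lambda>F. F({} := \<zero>\<^bsub>K\<^esub>)) (map gconst cs)) = gconst (\<phi> f cs)"
  proof (rule taylor_zero_nilpotents[OF ring_S])
    show "gconst (\<phi> (\<lambda>_. 1) []) = \<one>\<^bsub>S\<^esub>"
    proof -
      have "\<phi> (\<lambda>_. 1) [] = \<one>\<^bsub>K\<^esub>" by (simp add: K_def ring_of_cinf_def)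
      then show ?thesis by (simp add: gconst_eq S_one)
    qed
    show "map (\<lambda>F. F({} := \<zero>\<^bsub>K\<^esub>)) (map gconst cs) ! j = \<zero>\<^bsub>S\<^esub>" if "j < length cs" for j
      using that by (auto simp: gconst_eq S_zero)
  qed (use D s gconst_closed in auto)
  also have "\<dots> = h (const (\<phi> f cs))"
    using D[of "[]"] by (simp add: h_const)
  finally show ?thesis
    using h_inj[of "op f (map const cs)" "const (\<phi> f cs)"] f even
      even_closed[OF op_closed] even_closed[OF const_even[OF D[of "[]"]]] by simp
qed

lemma monomial_vanish:
  assumes "\<And>j. j \<in> set js \<Longrightarrow> N j \<in> Fil 1" "length js \<ge> Suc q"
  shows "monomial R N js = \<zero>"
  using Fil_Suc_q Fil_antimono[OF assms(2)] Fil_monomial[of js N] assms(1) by blast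

text \<open>
  Transported to R, the definition of the operations of an exterior algebra is Taylor's formula about
  elements of C.
\<close>

lemma taylor_at_constants:
  assumes f: "smooth (length cs) f" and cs: "set cs \<subseteq> C"
    and len: "length as = length cs" and as: "set as \<subseteq> R0"
    and X: "\<And>j. j < length cs \<Longrightarrow> as ! j = const (cs ! j) \<oplus> X j \<and> X j \<in> R0 \<and> X j \<in> Fil 1"
  shows "op f as = (\<Oplus>n\<in>{..<Suc q}. scalar (1 / fact n) \<otimes>
    contract (length cs) (\<lambda>js. op (partials js f) (map const cs)) X n)"
proof -
  define Ns where "Ns = map X [0..<length cs]"
  have Ns: "length Ns = length cs" "\<And>j. j < length cs \<Longrightarrow> Ns ! j = X j"
    by (simp_all add: Ns_def)
  have body: "h (as ! j) {} = cs ! j" "h (X j) = (h (as ! j))({} := \<zero>\<^bsub>K\<^esub>)" if j: "j < length cs" for j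
  proof -
    have c: "cs ! j \<in> C" using j cs by auto
    have Xj: "X j \<in> carrier R" using X[OF j] Fil_closed by blast
    have "h (as ! j) {} = h (const (cs ! j)) {} \<oplus>\<^bsub>K\<^esub> h (X j) {}"
      using X[OF j] Xj const_even[OF c] even_closed by (simp add: h_add)
    moreover have "h (X j) {} = \<zero>\<^bsub>K\<^esub>" using X[OF j] by (simp add: Fil_def)
    ultimately show 1: "h (as ! j) {} = cs ! j"
      using c by (simp add: h_const gconst_eq K_carrier)
    have a: "as ! j \<in> R0" using as j len by auto
    have "const (cs ! j) \<in> carrier R" using const_even[OF c] even_closed by blast
    then have "as ! j \<ominus> const (cs ! j) = X j"
      using X[OF j] Xj by (simp add: a_minus_def a_ac r_neg1 r_neg)
    then show "h (X j) = (h (as ! j))({} := \<zero>\<^bsub>K\<^esub>)"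
      using body_decompose(4)[OF a] unfolding 1 by simp
  qed
  have even: "set (map const cs) \<subseteq> R0" using cs const_even by auto
  have D: "\<phi> (partials js f) cs \<in> C" if "set js \<subseteq> {..<length cs}" for js
    using cinf_ring_closed[OF C smooth_partials[OF f that] cs] .
  have D': "op (partials js f) (map const cs) = const (\<phi> (partials js f) cs)"
    if "set js \<subseteq> {..<length cs}" for js
    using const_op[OF smooth_partials[OF f that] cs] by simp
  have s: "\<phi> (\<lambda>_. r) [] \<in> C" for r
    using cinf_ring_closed[OF C, of "[]"] smooth_const by simp
  have s': "scalar r = const (\<phi> (\<lambda>_. r) [])" for r
    using const_op[of "[]" "\<lambda>_. r"] smooth_const by (simp add: scalar_def)
  have T: "taylor R (\<lambda>x. x) op f (map const cs) Ns \<in> carrier R"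
  proof (unfold taylor_def, intro finsum_closed Pi_I)
    fix n show "taylor_term R (\<lambda>x. x) op f (map const cs) Ns n \<in> carrier R"
      unfolding taylor_term_eq scalar_def[symmetric] using X even_closed op_partials_even[of "map const cs" f] f even
      by (auto intro!: m_closed contract_closed simp: Ns)
  qed
  have "h (op f as) = taylor S gconst \<phi> f (map (\<lambda>F. F {}) (map h as)) (map (\<lambda>F. F({} := \<zero>\<^bsub>K\<^esub>)) (map h as))"
    using h_op[of as f] f as len by (simp add: S_op)
  also have "map (\<lambda>F. F {}) (map h as) = cs"
    using body(1) len by (auto intro!: nth_equalityI)
  also have "taylor S gconst \<phi> f cs (map (\<lambda>F. F({} := \<zero>\<^bsub>K\<^esub>)) (map h as)) =
      h (taylor R (\<lambda>x. x) op f (map const cs) Ns)"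
  proof (rule ring_hom_taylor[OF ring_axioms ring_S h_hom])
    show "inj_on h (carrier R)" using h_bij by (simp add: bij_betw_def)
  qed (use D D' s even body len Ns X Fil_closed op_partials_even[of "map const cs" f] f
      in \<open>auto simp: h_const even_closed scalar_def[symmetric] s' const_even\<close>)
  finally have "op f as = taylor R (\<lambda>x. x) op f (map const cs) Ns"
    using T f as len by (intro h_inj) (auto simp: even_closed op_closed)
  also have "\<dots> = (\<Oplus>n\<in>{..<Suc q}. scalar (1 / fact n) \<otimes>
      contract (length cs) (\<lambda>js. op (partials js f) (map const cs)) ((!) Ns) n)"
    using f even X by (subst taylor_nilpotent[where q = "Suc q"])
      (auto simp: Ns intro!: monomial_vanish)
  also have "\<dots> = (\<Oplus>n\<in>{..<Suc q}. scalar (1 / fact n) \<otimes>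
      contract (length cs) (\<lambda>js. op (partials js f) (map const cs)) X n)"
    using f even X op_partials_even[of "map const cs" f]
    by (intro finsum_cong' refl arg_cong2[where f = "(\<otimes>)"] contract_cong)
      (auto intro!: m_closed contract_closed simp: Ns even_closed)
  finally show ?thesis .
qed

text \<open>
  Write \<open>cs\<close> as constants plus increments M. By definition of the operations, the value at \<open>cs + Ns\<close> is the
  expansion about the constants at increment \<open>M + Ns\<close>. Grouped as an expansion in \<open>Ns\<close>, its coefficients are
  the expansions of the partial derivatives at increment M, which are their values at \<open>cs\<close>.
\<close>

theorem taylor_formula:
  assumes f: "smooth (length cs) f" and cs: "set cs \<subseteq> R0"
    and Ns: "length Ns = length cs" "set Ns \<subseteq> R0 \<inter> J (Suc 0)"
  shows "op f (map2 (\<oplus>) cs Ns) = taylor R (\<lambda>x. x) op f cs Ns"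
proof -
  define k where "k = length cs"
  define bs where "bs = map (\<lambda>c. h c {}) cs"
  define M where "M = (\<lambda>j. cs ! j \<ominus> const (bs ! j))"
  define D where "D = (\<lambda>js. op (partials js f) (map const bs))"
  define s where "s = (\<lambda>n::nat. scalar (1 / fact n))"
  have c: "cs ! j \<in> R0" if "j < k" for j using that cs by (auto simp: k_def)
  have bs: "length bs = k" "set bs \<subseteq> C"
    using cs body_decompose(1) by (auto simp: bs_def k_def)
  have M: "cs ! j = const (bs ! j) \<oplus> M j" "M j \<in> R0" "M j \<in> Fil 1" if j: "j < k" for j
  proof -
    note b = body_decompose[OF c[OF j]]
    show "M j \<in> R0" "M j \<in> Fil 1" using b j by (simp_all add: M_def bs_def k_def)
    show "cs ! j = const (bs ! j) \<oplus> M j"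
      using even_closed[OF const_even[OF b(1)]] even_closed[OF c[OF j]] j
      by (simp add: M_def bs_def k_def a_minus_def a_ac r_neg r_neg2)
  qed
  have N: "Ns ! j \<in> R0" "Ns ! j \<in> Fil 1" if "j < k" for j
    using that Ns J_subset_Fil[of "Suc 0"] by (auto simp: k_def subset_iff)
  have even_bs: "set (map const bs) \<subseteq> R0" using bs const_even by auto
  have fk: "smooth (length bs) f" "smooth (length (map const bs)) f" using f bs by (simp_all add: k_def)
  have D: "D js \<in> R0" if "set js \<subseteq> {..<k}" for js
    unfolding D_def using op_partials_even[OF fk(2) even_bs] that bs by simp
  have sym: "symmetric_family k D"
    unfolding D_def using symmetric_family_op[OF fk(2)] bs by simp
  have s: "s n \<in> R0" for n unfolding s_def by (rule scalar_even)
  have vanish: "monomial R M ks \<otimes> monomial R ((!) Ns) js = \<zero>"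
    if "set ks \<subseteq> {..<k}" "set js \<subseteq> {..<k}" "length ks + length js \<ge> Suc q" for ks js
    using Fil_Suc_q Fil_antimono[OF that(3)] Fil_mult[OF Fil_monomial Fil_monomial, of ks M js "(!) Ns"]
      M N that(1,2) by blast
  have "op f (map2 (\<oplus>) cs Ns) = (\<Oplus>n\<in>{..<Suc q}. s n \<otimes> contract k D (\<lambda>j. M j \<oplus> Ns ! j) n)"
    unfolding s_def D_def bs(1)[symmetric]
  proof (rule taylor_at_constants[OF fk(1) bs(2)])
    show "set (map2 (\<oplus>) cs Ns) \<subseteq> R0"
      using cs Ns by (auto simp: set_zip intro!: even_add)
    fix j assume "j < length bs"
    then have j: "j < k" using bs by simp
    have "bs ! j \<in> C" using j bs nth_mem by blast
    then have "const (bs ! j) \<in> R0" by (rule const_even)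
    then show "map2 (\<oplus>) cs Ns ! j = const (bs ! j) \<oplus> (M j \<oplus> Ns ! j) \<and> M j \<oplus> Ns ! j \<in> R0 \<and>
        M j \<oplus> Ns ! j \<in> Fil 1"
      using M[OF j] N[OF j] j Ns(1) Fil_add even_add by (simp add: k_def even_closed a_assoc[symmetric])
  qed (use Ns bs k_def in auto)
  also have "\<dots> = (\<Oplus>m\<in>{..<Suc q}. s m \<otimes> contract k
      (\<lambda>js. \<Oplus>l\<in>{..<Suc q}. s l \<otimes> contract k (\<lambda>ks. D (ks @ js)) M l) ((!) Ns) m)"
    using D M N s vanish scalar_binomial_fact
    by (intro contract_exp_add sym) (auto simp: s_def even_closed intro!: even_center)
  also have "\<dots> = (\<Oplus>m\<in>{..<Suc q}. s m \<otimes> contract k (\<lambda>js. op (partials js f) cs) ((!) Ns) m)"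
  proof -
    have "(\<Oplus>l\<in>{..<Suc q}. s l \<otimes> contract k (\<lambda>ks. D (ks @ js)) M l) = op (partials js f) cs"
      if js: "set js \<subseteq> {..<k}" for js
    proof -
      have "op (partials js f) cs = (\<Oplus>l\<in>{..<Suc q}. scalar (1 / fact l) \<otimes>
          contract (length bs) (\<lambda>ks. op (partials ks (partials js f)) (map const bs)) M l)"
        using smooth_partials[OF fk(1)] js bs cs M
        by (intro taylor_at_constants) (auto simp: k_def)
      then show ?thesis by (simp add: D_def s_def partials_append bs(1))
    qed
    moreover have "op (partials js f) cs \<in> carrier R" if "set js \<subseteq> {..<k}" for js
      using op_partials_even[OF f cs] that even_closed by (simp add: k_def)
    ultimately have "contract k (\<lambda>js. \<Oplus>l\<in>{..<Suc q}. s l \<otimes> contract k (\<lambda>ks. D (ks @ js)) M l) ((!) Ns) m =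
        contract k (\<lambda>js. op (partials js f) cs) ((!) Ns) m" for m
      using N even_closed by (intro contract_cong) auto
    then show ?thesis by simp
  qed
  also have "\<dots> = taylor R (\<lambda>x. x) op f cs Ns"
    unfolding s_def k_def
    by (rule taylor_nilpotent[symmetric, OF f cs]) (use N in \<open>auto simp: k_def intro!: monomial_vanish\<close>)
  finally show ?thesis .
qed

end

section \<open>Gradings adapted to the canonical filtration\<close>

locale nilpotent_taylor = cinf_super R
  for R :: "('a, 'm) cinf_superstructure_scheme" (structure) +
  fixes p :: nat
  assumes J_nil: "canonical_power R p = {\<zero>}"
    and taylor: "\<And>f cs Ns. smooth (length cs) f \<Longrightarrow> set cs \<subseteq> even_part R \<Longrightarrow> length Ns = length cs \<Longrightarrow>
      set Ns \<subseteq> even_part R \<inter> canonical_power R (Suc 0) \<Longrightarrow>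
      smooth_op R f (map2 (\<oplus>) cs Ns) = taylor R (\<lambda>x. x) (smooth_op R) f cs Ns"
begin

lemma eq_if_minus_zero:
  assumes "x \<in> carrier R" "y \<in> carrier R" "x \<ominus> y = \<zero>"
  shows "x = y"
proof -
  have "x = (x \<ominus> y) \<oplus> y" using assms(1,2) by (simp add: a_minus_def a_assoc l_neg)
  then show ?thesis using assms by simp
qed

lemma minus_add_cancel:
  assumes "x \<in> carrier R" "y \<in> carrier R"
  shows "y \<oplus> (x \<ominus> y) = x"
  using assms by (simp add: a_minus_def a_lcomm[of y] r_neg)

declare canonical_power.simps(2) [simp del]

lemma J_vanish: "p \<le> k \<Longrightarrow> x \<in> J k \<Longrightarrow> x = \<zero>"
  using J_antimono[of p k x] J_nil by auto

lemma op_add_nilpotent: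
  assumes f: "smooth (length cs) f" and cs: "set cs \<subseteq> R0"
    and N: "\<And>j. j < length cs \<Longrightarrow> N j \<in> R0 \<and> N j \<in> J (Suc 0)"
    and as: "length as = length cs" "\<And>j. j < length cs \<Longrightarrow> as ! j = cs ! j \<oplus> N j"
    and n: "p \<le> n"
  shows "op f as = (\<Oplus>m\<in>{..<n}. scalar (1 / fact m) \<otimes>
    contract (length cs) (\<lambda>js. op (partials js f) cs) N m)"
proof -
  define Ns where "Ns = map N [0..<length cs]"
  have Ns: "length Ns = length cs" "\<And>j. j < length cs \<Longrightarrow> Ns ! j = N j"
    by (simp_all add: Ns_def)
  have set_Ns: "set Ns \<subseteq> R0 \<inter> J (Suc 0)" using N by (auto simp: Ns_def)
  have "as = map2 (\<oplus>) cs Ns" using as Ns by (auto intro!: nth_equalityI)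
  then have "op f as = taylor R (\<lambda>x. x) op f cs Ns"
    using taylor[OF f cs Ns(1) set_Ns] by simp
  also have "\<dots> = (\<Oplus>m\<in>{..<n}. scalar (1 / fact m) \<otimes>
    contract (length cs) (\<lambda>js. op (partials js f) cs) ((!) Ns) m)"
  proof (rule taylor_nilpotent[OF f cs])
    fix js assume js: "set js \<subseteq> {..<length cs}" "n \<le> length js"
    have "monomial R ((!) Ns) js \<in> J (length js)"
      using N Ns js by (intro J_monomial) auto
    then show "monomial R ((!) Ns) js = \<zero>" using J_vanish n js by (meson le_trans)
  qed (use N Ns in auto)
  also have "\<dots> = (\<Oplus>m\<in>{..<n}. scalar (1 / fact m) \<otimes>
    contract (length cs) (\<lambda>js. op (partials js f) cs) N m)"
    using N op_partials_even[OF f cs]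
    by (intro finsum_cong' refl arg_cong2[where f = "(\<otimes>)"] contract_cong)
      (auto intro!: m_closed contract_closed simp: Ns even_closed)
  finally show ?thesis .
qed

text \<open>
  The operations descend to \<open>R / J\<close>, because all Taylor terms of positive degree lie in \<open>J\<close>.
\<close>

lemma op_cong_J:
  assumes f: "smooth (length as) f" and as: "set as \<subseteq> R0" and bs: "set bs \<subseteq> R0" "length bs = length as"
    and diff: "\<And>j. j < length as \<Longrightarrow> bs ! j \<ominus> as ! j \<in> J (Suc 0)"
  shows "op f bs \<ominus> op f as \<in> J (Suc 0)"
proof -
  define N where "N = (\<lambda>j. bs ! j \<ominus> as ! j)"
  define t where "t = (\<lambda>m. scalar (1 / fact m) \<otimes> contract (length as) (\<lambda>js. op (partials js f) as) N m)"
  have mem: "as ! j \<in> R0" "bs ! j \<in> R0" if "j < length as" for j using as bs that by auto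
  have N: "N j \<in> R0 \<and> N j \<in> J (Suc 0)" if j: "j < length as" for j
    using diff[OF j] mem[OF j] unfolding N_def a_minus_def by (auto intro: even_add even_neg)
  have "bs ! j = as ! j \<oplus> N j" if "j < length as" for j
    unfolding N_def using mem[OF that] by (intro minus_add_cancel[symmetric] even_closed)
  then have eq: "op f bs = (\<Oplus>m\<in>{..<Suc p}. t m)"
    unfolding t_def using N by (intro op_add_nilpotent f as bs) auto
  have D: "op (partials js f) as \<in> carrier R" if "set js \<subseteq> {..<length as}" for js
    using op_partials_even[OF f as that] even_closed by blast
  have t0: "t 0 = op f as" unfolding t_def using D[of "[]"] by (simp add: contract_0)
  have tm: "t (Suc m) \<in> J (Suc 0)" for m
    unfolding t_def contraction_def
  proof (rule J_lmult[OF J_finsum scalar_closed])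
    fix js assume js: "js \<in> index_lists (length as) (Suc m)"
    have "monomial R N js \<in> J (length js)" using js N by (intro J_monomial) auto
    then have "monomial R N js \<in> J (Suc 0)" using js by (intro J_antimono[of "Suc 0" "length js"]) auto
    then show "op (partials js f) as \<otimes> monomial R N js \<in> J (Suc 0)"
      using D js by (intro J_lmult) auto
  qed
  have c: "t m \<in> carrier R" for m
    using D[of "[]"] J_closed[OF tm] by (cases m) (auto simp: t0)
  have "op f bs = (\<Oplus>m\<in>{..<p}. t (Suc m)) \<oplus> t 0"
    unfolding eq using c by (intro finsum_lessThan_Suc_shift) auto
  moreover have S: "(\<Oplus>m\<in>{..<p}. t (Suc m)) \<in> J (Suc 0)" using tm by (intro J_finsum)
  ultimately show ?thesis
    using J_closed[OF S] c[of 0] unfolding t0 by (simp add: a_minus_def a_assoc r_neg)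
qed

text \<open>
  Closure under addition is the only linear condition: \<open>G 0\<close> contains the values of constant
  functions, so that by multiplicativity every \<open>G k\<close> is a real subspace.
\<close>

definition grading :: "(nat \<Rightarrow> 'a set) \<Rightarrow> bool" where
  "grading G \<longleftrightarrow>
     (\<forall>k. G k \<subseteq> J k \<inter> par k) \<and>
     (\<forall>k. \<forall>x\<in>G k. \<forall>y\<in>G k. x \<oplus> y \<in> G k) \<and>
     (\<forall>k. G k \<inter> J (Suc k) \<subseteq> {\<zero>}) \<and>
     (\<forall>k. \<forall>x\<in>J k. \<exists>y\<in>G k. x \<ominus> y \<in> J (Suc k)) \<and>
     (\<forall>k l. \<forall>x\<in>G k. \<forall>y\<in>G l. x \<otimes> y \<in> G (k + l)) \<and>
     (\<forall>f cs. smooth (length cs) f \<longrightarrow> set cs \<subseteq> G 0 \<longrightarrow> op f cs \<in> G 0)"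

end

locale graded = nilpotent_taylor R p
  for R :: "('a, 'm) cinf_superstructure_scheme" (structure) and p :: nat +
  fixes G :: "nat \<Rightarrow> 'a set"
  assumes grading: "grading G"
begin

lemma G_J: "x \<in> G k \<Longrightarrow> x \<in> J k"
  and G_par: "x \<in> G k \<Longrightarrow> x \<in> par k"
  and G_add: "x \<in> G k \<Longrightarrow> y \<in> G k \<Longrightarrow> x \<oplus> y \<in> G k"
  and G_inter: "x \<in> G k \<Longrightarrow> x \<in> J (Suc k) \<Longrightarrow> x = \<zero>"
  and G_mult: "x \<in> G k \<Longrightarrow> y \<in> G l \<Longrightarrow> x \<otimes> y \<in> G (k + l)"
  and G_op: "smooth (length cs) f \<Longrightarrow> set cs \<subseteq> G 0 \<Longrightarrow> op f cs \<in> G 0"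
  using grading unfolding grading_def by blast+

lemma G_leading:
  assumes "x \<in> J k"
  obtains y where "y \<in> G k" "x \<ominus> y \<in> J (Suc k)"
  using assms grading unfolding grading_def by blast

lemma G_closed: "x \<in> G k \<Longrightarrow> x \<in> carrier R"
  using G_J J_closed by blast

lemma G_scalar: "scalar c \<in> G 0"
  unfolding scalar_def by (intro G_op smooth_const) simp

lemma G_smult: "x \<in> G k \<Longrightarrow> scalar c \<otimes> x \<in> G k"
  using G_mult[OF G_scalar] by simp

lemma G_zero: "\<zero> \<in> G k"
proof -
  obtain y where y: "y \<in> G k" using G_leading[OF J_zero] .
  then show ?thesis using G_smult[OF y, of 0] G_closed[OF y] by simp
qed

lemma G_neg: "x \<in> G k \<Longrightarrow> \<ominus> x \<in> G k"
  using G_smult[of x k "- 1"] G_closed by (simp add: scalar_minus l_minus)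

lemma G_minus: "x \<in> G k \<Longrightarrow> y \<in> G k \<Longrightarrow> x \<ominus> y \<in> G k"
  unfolding a_minus_def by (intro G_add G_neg)

text \<open>
  Subtracting leading parts pushes an element of \<open>J\<^sup>m\<close> down the filtration until it vanishes. Thus \<open>J\<^sup>m\<close> is
  additively generated by homogeneous elements of degree at least m. The rule reduces additive and biadditive
  identities to homogeneous elements.
\<close>

lemma homogeneous_induct [consumes 1, case_names homogeneous add]:
  assumes x: "x \<in> J m"
    and hom: "\<And>k y. m \<le> k \<Longrightarrow> y \<in> G k \<Longrightarrow> Q y"
    and add: "\<And>y z. y \<in> J m \<Longrightarrow> z \<in> J m \<Longrightarrow> Q y \<Longrightarrow> Q z \<Longrightarrow> Q (y \<oplus> z)"
  shows "Q x"
proof -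
  have "Q y" if "p - k \<le> n" "m \<le> k" "y \<in> J k" for n k y
    using that
  proof (induction n arbitrary: k y)
    case 0
    then have "y = \<zero>" by (intro J_vanish[of k]) auto
    then show ?case using hom[of m] G_zero by simp
  next
    case (Suc n)
    obtain z where z: "z \<in> G k" "y \<ominus> z \<in> J (Suc k)" using G_leading[OF Suc.prems(3)] .
    have "Q (y \<ominus> z)" using Suc.IH[of "Suc k"] Suc.prems z by auto
    moreover have "Q z" using hom Suc.prems z by blast
    moreover have "y \<ominus> z \<in> J m" "z \<in> J m"
      using Suc.prems z J_antimono[of m "Suc k" "y \<ominus> z"] J_antimono[of m k z] G_J by auto
    moreover have "y = (y \<ominus> z) \<oplus> z"
      using J_closed[OF Suc.prems(3)] G_closed[OF z(1)] by (simp add: a_minus_def a_assoc l_neg)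
    ultimately show ?case using add by metis
  qed
  from this[of m "p - m" x] show ?thesis using x by simp
qed

lemma homogeneous_decomposition:
  assumes "x \<in> carrier R"
  shows "\<exists>y. (\<forall>k. y k \<in> G k) \<and> x = (\<Oplus>k\<in>{..<p}. y k)"
proof -
  have "x \<in> J 0" using assms by simp
  then show ?thesis
  proof (induction rule: homogeneous_induct)
    case (homogeneous k x)
    have "x = (\<Oplus>i\<in>{..<p}. if i = k then x else \<zero>)"
    proof (cases "k < p")
      case True
      then show ?thesis
        using add.finprod_singleton_swap[of k "{..<p}" "\<lambda>_. x"] G_closed[OF homogeneous(2)] by auto
    next
      case False
      then have "x = \<zero>" using J_vanish[of k] G_J homogeneous by auto
      then show ?thesis by (auto intro!: add.finprod_one_eqI[symmetric])
    qed
    then show ?case using homogeneous G_zero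
      by (intro exI[of _ "\<lambda>i. if i = k then x else \<zero>"]) auto
  next
    case (add u v)
    then obtain y z where "\<forall>k. y k \<in> G k" "u = (\<Oplus>k\<in>{..<p}. y k)" "\<forall>k. z k \<in> G k" "v = (\<Oplus>k\<in>{..<p}. z k)"
      by blast
    moreover from this have "y k \<in> carrier R" "z k \<in> carrier R" for k using G_closed by blast+
    ultimately show ?case
      by (intro exI[of _ "\<lambda>k. y k \<oplus> z k"]) (auto intro!: G_add finsum_addf[symmetric])
  qed
qed

text \<open>
  Once the summands of degree below k are known to vanish, \<open>y k\<close> is minus the sum of the higher ones and
  hence lies in \<open>J\<^sup>k\<^sup>+\<^sup>1\<close>.
\<close>

lemma homogeneous_independent:
  assumes y: "\<And>k. y k \<in> G k" and sum: "(\<Oplus>k\<in>{..<p}. y k) = \<zero>"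
  shows "y k = \<zero>"
proof (induction k rule: less_induct)
  case (less k)
  show ?case
  proof (cases "k < p")
    case True
    have yc: "y i \<in> carrier R" for i using y G_closed by blast
    have rest: "(\<Oplus>i\<in>{..<p} - {k}. y i) \<in> J (Suc k)"
    proof (rule J_finsum)
      fix i assume "i \<in> {..<p} - {k}"
      then show "y i \<in> J (Suc k)"
        using less[of i] J_zero J_antimono[of "Suc k" i "y i"] G_J[OF y] by (cases "i < k") auto
    qed
    have "{..<p} = insert k ({..<p} - {k})" using True by auto
    then have "(\<Oplus>k\<in>{..<p}. y k) = y k \<oplus> (\<Oplus>i\<in>{..<p} - {k}. y i)"
      using yc by (metis (no_types, lifting) Diff_iff Pi_I finite_Diff finite_lessThan finsum_insert insertI1)
    then have "y k = \<ominus> (\<Oplus>i\<in>{..<p} - {k}. y i)"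
      using sum yc J_closed[OF rest] by (simp add: minus_equality[symmetric])
    then show ?thesis using G_inter[OF y] J_neg[OF rest] by metis
  next
    case False
    then show ?thesis using J_vanish[of k] G_J[OF y] by auto
  qed
qed

definition component :: "nat \<Rightarrow> 'a \<Rightarrow> 'a" where
  "component k x = (SOME y. (\<forall>k. y k \<in> G k) \<and> x = (\<Oplus>k\<in>{..<p}. y k)) k"

lemma component_G: "x \<in> carrier R \<Longrightarrow> component k x \<in> G k"
  and sum_component: "x \<in> carrier R \<Longrightarrow> (\<Oplus>k\<in>{..<p}. component k x) = x"
  unfolding component_def using someI_ex[OF homogeneous_decomposition, of x] by auto

lemma component_closed [simp]: "x \<in> carrier R \<Longrightarrow> component k x \<in> carrier R"
  using component_G G_closed by blast

lemma component_unique: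
  assumes y: "\<And>k. y k \<in> G k" and x: "x = (\<Oplus>k\<in>{..<p}. y k)"
  shows "component k x = y k"
proof -
  have yc: "y k \<in> carrier R" for k using y G_closed by blast
  have xc: "x \<in> carrier R" unfolding x using yc by auto
  have neg: "(\<Oplus>k\<in>{..<p}. \<ominus> y k) = \<ominus> x"
  proof -
    have "(\<Oplus>k\<in>{..<p}. \<ominus> y k) = (\<Oplus>k\<in>{..<p}. \<ominus> \<one> \<otimes> y k)"
      using yc by (intro finsum_cong') (auto simp: l_minus)
    also have "\<dots> = \<ominus> \<one> \<otimes> x"
      unfolding x using yc by (intro finsum_rdistr[symmetric]) auto
    finally show ?thesis using xc by (simp add: l_minus)
  qed
  have "(\<Oplus>k\<in>{..<p}. component k x \<ominus> y k) = (\<Oplus>k\<in>{..<p}. component k x) \<oplus> (\<Oplus>k\<in>{..<p}. \<ominus> y k)"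
    unfolding a_minus_def using yc xc by (intro finsum_addf) auto
  also have "\<dots> = \<zero>" unfolding neg sum_component[OF xc] using xc by (simp add: r_neg)
  finally have "(\<Oplus>k\<in>{..<p}. component k x \<ominus> y k) = \<zero>" .
  with homogeneous_independent[of "\<lambda>k. component k x \<ominus> y k" k]
  have "component k x \<ominus> y k = \<zero>" using G_minus component_G[OF xc] y by blast
  then show ?thesis
    by (rule eq_if_minus_zero[OF component_closed[OF xc] yc])
qed

lemma component_add:
  assumes "x \<in> carrier R" "y \<in> carrier R"
  shows "component k (x \<oplus> y) = component k x \<oplus> component k y"
proof (rule component_unique)
  show "x \<oplus> y = (\<Oplus>k\<in>{..<p}. component k x \<oplus> component k y)"
    using assms by (subst finsum_addf) (auto simp: sum_component)
qed (use assms in \<open>auto intro!: G_add component_G\<close>)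

lemma component_homogeneous:
  assumes x: "x \<in> G k"
  shows "component j x = (if j = k then x else \<zero>)"
proof (rule component_unique)
  show "x = (\<Oplus>j\<in>{..<p}. if j = k then x else \<zero>)"
  proof (cases "k < p")
    case True
    then show ?thesis
      using add.finprod_singleton_swap[of k "{..<p}" "\<lambda>_. x"] G_closed[OF x] by auto
  next
    case False
    then have "x = \<zero>" using J_vanish[of k] G_J x by auto
    then show ?thesis by (auto intro!: add.finprod_one_eqI[symmetric])
  qed
qed (use x G_zero in auto)

lemma component_smult:
  assumes x: "x \<in> carrier R"
  shows "component k (scalar c \<otimes> x) = scalar c \<otimes> component k x"
proof (rule component_unique)
  have "scalar c \<otimes> x = scalar c \<otimes> (\<Oplus>k\<in>{..<p}. component k x)" using x by (simp add: sum_component)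
  also have "\<dots> = (\<Oplus>k\<in>{..<p}. scalar c \<otimes> component k x)"
    using x by (intro finsum_rdistr) auto
  finally show "scalar c \<otimes> x = (\<Oplus>k\<in>{..<p}. scalar c \<otimes> component k x)" .
qed (use x in \<open>auto intro!: G_smult component_G\<close>)

lemma component_minus:
  assumes "x \<in> carrier R" "y \<in> carrier R"
  shows "component k (x \<ominus> y) = component k x \<ominus> component k y"
proof -
  have neg: "\<ominus> z = scalar (- 1) \<otimes> z" if "z \<in> carrier R" for z using that by (simp add: scalar_minus l_minus)
  show ?thesis
    unfolding a_minus_def using assms by (simp add: neg component_add component_smult)
qed

lemma component_below:
  assumes "x \<in> J m" "k < m"
  shows "component k x = \<zero>"
  using assms(1)
proof (induction rule: homogeneous_induct)
  case (homogeneous j y)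
  then show ?case using assms(2) by (auto simp: component_homogeneous)
next
  case (add y z)
  then show ?case by (simp add: component_add J_closed)
qed

lemma minus_component:
  assumes "x \<in> J k"
  shows "x \<ominus> component k x \<in> J (Suc k)"
proof -
  obtain y where y: "y \<in> G k" "x \<ominus> y \<in> J (Suc k)" using G_leading[OF assms] .
  have c: "x \<in> carrier R" "y \<in> carrier R" using assms y J_closed G_closed by auto
  have "component k x \<ominus> y = \<zero>"
    using component_below[OF y(2), of k] component_minus[OF c, of k] component_homogeneous[OF y(1), of k] by simp
  then have "component k x = y" by (rule eq_if_minus_zero[OF component_closed[OF c(1)] c(2)])
  then show ?thesis using y by simp
qed

text \<open>
  The components of degree congruent to m modulo 2 add up to an element of the parity of m, the others to an
  element of the opposite parity. For an x of the parity of m the second sum has both parities and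
  is zero, so x is the sum of the first components alone.
\<close>

lemma component_parity:
  assumes x: "x \<in> par m" and k: "odd (k + m)"
  shows "component k x = \<zero>"
proof -
  have xc: "x \<in> carrier R" using x par_closed by blast
  define y where "y = (\<lambda>k. if even (k + m) then component k x else \<zero>)"
  define z where "z = (\<lambda>k. if even (k + m) then \<zero> else component k x)"
  have yc: "y k \<in> carrier R" and zc: "z k \<in> carrier R" for k using xc by (simp_all add: y_def z_def)
  have "y i \<in> par m \<and> z i \<in> par (Suc m)" for i
  proof (cases "even (i + m)")
    case True
    then have "par i = par m" by (auto simp: par_def)
    then show ?thesis using True G_par[OF component_G[OF xc], of i] by (simp add: y_def z_def par_zero)
  next
    case False
    then have "par i = par (Suc m)" by (auto simp: par_def)
    then show ?thesis using False G_par[OF component_G[OF xc], of i] by (simp add: y_def z_def par_zero)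
  qed
  then have par: "(\<Oplus>k\<in>{..<p}. y k) \<in> par m" "(\<Oplus>k\<in>{..<p}. z k) \<in> par (Suc m)"
    by (blast intro: par_finsum)+
  have "(\<Oplus>k\<in>{..<p}. y k) \<oplus> (\<Oplus>k\<in>{..<p}. z k) = (\<Oplus>k\<in>{..<p}. y k \<oplus> z k)"
    using yc zc by (intro finsum_addf[symmetric]) auto
  also have "\<dots> = (\<Oplus>k\<in>{..<p}. component k x)"
    using xc by (intro finsum_cong') (auto simp: y_def z_def)
  finally have eq: "x = (\<Oplus>k\<in>{..<p}. y k) \<oplus> (\<Oplus>k\<in>{..<p}. z k)" using xc by (simp add: sum_component)
  note c = par_closed[OF par(1)] par_closed[OF par(2)]
  have "(\<Oplus>k\<in>{..<p}. z k) = x \<oplus> \<ominus> (\<Oplus>k\<in>{..<p}. y k)"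
    using eq c xc by (metis a_comm a_assoc a_inv_closed r_neg1)
  then have "(\<Oplus>k\<in>{..<p}. z k) \<in> par m" using par_add[OF x par_neg[OF par(1)]] by simp
  then have "(\<Oplus>k\<in>{..<p}. z k) = \<zero>" using par_disjoint par(2) by blast
  then have "x = (\<Oplus>k\<in>{..<p}. y k)" using eq c by simp
  moreover have "y i \<in> G i" for i using component_G[OF xc] G_zero by (simp add: y_def)
  ultimately have "component k x = y k" by (intro component_unique)
  then show ?thesis using k by (simp add: y_def)
qed

lemma G_if_components:
  assumes x: "x \<in> carrier R" and j: "\<And>j. j \<noteq> k \<Longrightarrow> component j x = \<zero>"
  shows "x \<in> G k"
proof (cases "k < p")
  case True
  have "x = (\<Oplus>j\<in>{..<p}. component j x)" using x by (simp add: sum_component)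
  also have "\<dots> = (\<Oplus>j\<in>{..<p}. if j = k then component k x else \<zero>)"
    using x j by (intro finsum_cong') auto
  also have "\<dots> = component k x"
    using add.finprod_singleton_swap[of k "{..<p}" "\<lambda>_. component k x"] x True by auto
  finally show ?thesis using component_G[OF x] by metis
next
  case False
  have "x = (\<Oplus>j\<in>{..<p}. component j x)" using x by (simp add: sum_component)
  also have "\<dots> = \<zero>" using False j by (intro add.finprod_one_eqI) auto
  finally show ?thesis using G_zero by simp
qed

lemma component_mult:
  assumes x: "x \<in> carrier R" and y: "y \<in> carrier R"
  shows "component m (x \<otimes> y) = (\<Oplus>i\<in>{..m}. component i x \<otimes> component (m - i) y)"
proof -
  have "x \<in> J 0" using x by simp
  then show ?thesis
  proof (induction rule: homogeneous_induct)
    case (homogeneous a x)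
    note x = homogeneous(2) and xc = G_closed[OF homogeneous(2)]
    have "y \<in> J 0" using y by simp
    then show ?case
    proof (induction rule: homogeneous_induct)
      case (homogeneous b y)
      note y = homogeneous(2) and yc = G_closed[OF homogeneous(2)]
      have "(\<Oplus>i\<in>{..m}. component i x \<otimes> component (m - i) y) =
          (\<Oplus>i\<in>{..m}. if i = a then (if m = a + b then x \<otimes> y else \<zero>) else \<zero>)"
        using xc yc by (intro finsum_cong') (auto simp: component_homogeneous[OF x] component_homogeneous[OF y])
      also have "\<dots> = (if m = a + b then x \<otimes> y else \<zero>)"
        using add.finprod_singleton_swap[of a "{..m}" "\<lambda>_. x \<otimes> y"] xc yc by auto
      finally show ?case by (simp add: component_homogeneous[OF G_mult[OF x y]])
    next
      case (add y z)
      have "y \<in> carrier R" "z \<in> carrier R" using add J_closed by auto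
      then show ?case using add xc by (simp add: r_distr component_add Pi_def)
    qed
  next
    case (add u v)
    have "u \<in> carrier R" "v \<in> carrier R" using add J_closed by auto
    then show ?case using add y by (simp add: l_distr component_add Pi_def)
  qed
qed

end

section \<open>Euler vector fields and gradings\<close>

context nilpotent_taylor
begin

definition eigenspace :: "('a \<Rightarrow> 'a) \<Rightarrow> nat \<Rightarrow> 'a set" where
  "eigenspace E k = {x \<in> carrier R. E x = scalar (real k) \<otimes> x}"

lemma scalar_diff:
  assumes "x \<in> carrier R"
  shows "scalar a \<otimes> x \<ominus> scalar b \<otimes> x = scalar (a - b) \<otimes> x"
  using assms scalar_add[of a "- b"] by (simp add: a_minus_def scalar_minus l_distr l_minus)

end

locale euler_field = nilpotent_taylor R p
  for R :: "('a, 'm) cinf_superstructure_scheme" (structure) and p :: nat +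
  fixes E :: "'a \<Rightarrow> 'a"
  assumes euler: "euler_vector_field R E"
begin

lemma even_superderivation: "even_superderivation R E"
  using euler unfolding euler_vector_field_def cinf_even_superderivation_def by blast

lemma E_ext: "E \<in> carrier R \<rightarrow>\<^sub>E carrier R"
  and E_add: "x \<in> carrier R \<Longrightarrow> y \<in> carrier R \<Longrightarrow> E (x \<oplus> y) = E x \<oplus> E y"
  and E_smult: "x \<in> carrier R \<Longrightarrow> E (scalar c \<otimes> x) = scalar c \<otimes> E x"
  and E_even: "x \<in> R0 \<Longrightarrow> E x \<in> R0"
  and E_odd: "x \<in> R1 \<Longrightarrow> E x \<in> R1"
  and E_mult: "x \<in> carrier R \<Longrightarrow> y \<in> carrier R \<Longrightarrow> E (x \<otimes> y) = E x \<otimes> y \<oplus> x \<otimes> E y"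
proof -
  note D = even_superderivation[unfolded even_superderivation_def]
  show "E \<in> carrier R \<rightarrow>\<^sub>E carrier R" using D by (rule conjunct1)
  show "E (x \<oplus> y) = E x \<oplus> E y" "E (x \<otimes> y) = E x \<otimes> y \<oplus> x \<otimes> E y"
    if "x \<in> carrier R" "y \<in> carrier R" using D that by simp_all
  show "E (scalar c \<otimes> x) = scalar c \<otimes> E x" if "x \<in> carrier R"
    unfolding scalar_def using D that by meson
  show "E x \<in> R0" if "x \<in> R0" using D that by (simp add: image_subset_iff)
  show "E x \<in> R1" if "x \<in> R1" using D that by (simp add: image_subset_iff)
qed

lemma E_closed [simp]: "x \<in> carrier R \<Longrightarrow> E x \<in> carrier R"
  using E_ext by (rule PiE_mem)

lemma E_op: "smooth (length as) f \<Longrightarrow> set as \<subseteq> R0 \<Longrightarrow>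
    E (op f as) = (\<Oplus>i\<in>{..<length as}. op (partial i f) as \<otimes> E (as ! i))"
  using euler unfolding euler_vector_field_def cinf_even_superderivation_def by blast

lemma E_J: "x \<in> J k \<Longrightarrow> E x \<ominus> scalar (real k) \<otimes> x \<in> J (Suc k)"
  using euler unfolding euler_vector_field_def by (simp add: scalar_of_nat J_closed)

lemma E_par: "x \<in> par k \<Longrightarrow> E x \<in> par k"
  by (auto simp: par_def E_even E_odd split: if_splits)

lemma E_minus:
  assumes "x \<in> carrier R" "y \<in> carrier R"
  shows "E (x \<ominus> y) = E x \<ominus> E y"
proof -
  have neg: "\<ominus> z = scalar (- 1) \<otimes> z" if "z \<in> carrier R" for z
    using that by (simp add: scalar_minus l_minus)
  show ?thesis unfolding a_minus_def using assms by (simp add: neg E_add E_smult)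
qed

lemma eigenspace_D:
  assumes "x \<in> eigenspace E k"
  shows "x \<in> carrier R" "E x = scalar (real k) \<otimes> x"
  using assms by (simp_all add: eigenspace_def)

text \<open>
  E acts on \<open>J\<^sup>m / J\<^sup>m\<^sup>+\<^sup>1\<close> as m, so the class of an eigenvector with another eigenvalue is zero.
\<close>

lemma eigenspace_J_Suc:
  assumes x: "x \<in> eigenspace E k" and m: "x \<in> J m" "m \<noteq> k"
  shows "x \<in> J (Suc m)"
proof -
  note e = eigenspace_D[OF x]
  have "scalar (real k - real m) \<otimes> x \<in> J (Suc m)"
    using E_J[OF m(1)] e by (simp add: scalar_diff)
  then have "scalar (inverse (real k - real m)) \<otimes> (scalar (real k - real m) \<otimes> x) \<in> J (Suc m)"
    by (rule J_lmult) simp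
  then show ?thesis using m(2) e by (simp add: scalar_inverse)
qed

lemma eigenspace_J:
  assumes "x \<in> eigenspace E k"
  shows "x \<in> J k"
proof -
  have "x \<in> J m" if "m \<le> k" for m
    using that
  proof (induction m)
    case 0
    then show ?case using eigenspace_D[OF assms] by simp
  next
    case (Suc m)
    then show ?case using eigenspace_J_Suc[OF assms, of m] by simp
  qed
  then show ?thesis by simp
qed

lemma eigenspace_inter:
  assumes x: "x \<in> eigenspace E k" "x \<in> J (Suc k)"
  shows "x = \<zero>"
proof -
  have "x \<in> J (Suc k + n)" for n
    by (induction n) (use x eigenspace_J_Suc[OF x(1)] in auto)
  then show ?thesis using J_vanish[of "Suc k + p" x] by auto
qed

text \<open>
  Successive approximation of an eigenvector: let the error \<open>r = (E - k) y\<close> lie in \<open>J\<^sup>k\<^sup>+\<^sup>n\<^sup>+\<^sup>1\<close>. There \<open>E - k\<close> acts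
  as \<open>n + 1\<close> up to the next power, so subtracting \<open>r / (n + 1)\<close> from y improves the error by one step.
\<close>

lemma eigenspace_leading:
  assumes x: "x \<in> J k"
  shows "\<exists>y\<in>eigenspace E k. x \<ominus> y \<in> J (Suc k)"
proof -
  have "\<exists>y. y \<in> J k \<and> x \<ominus> y \<in> J (Suc k) \<and> E y \<ominus> scalar (real k) \<otimes> y \<in> J (Suc (k + n))" for n
  proof (induction n)
    case 0
    then show ?case
      using x E_J[OF x] J_closed[OF x] J_zero by (intro exI[of _ x]) (simp add: a_minus_def r_neg)
  next
    case (Suc n)
    then obtain y where y: "y \<in> J k" "x \<ominus> y \<in> J (Suc k)"
      "E y \<ominus> scalar (real k) \<otimes> y \<in> J (Suc (k + n))" by blast
    define r where "r = E y \<ominus> scalar (real k) \<otimes> y"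
    define c where "c = inverse (real (Suc n))"
    define t where "t = E r \<ominus> scalar (real (Suc (k + n))) \<otimes> r"
    have r: "r \<in> J (Suc (k + n))" using y by (simp add: r_def)
    have t: "t \<in> J (Suc (Suc (k + n)))" unfolding t_def by (rule E_J[OF r])
    have carr: "x \<in> carrier R" "y \<in> carrier R" "r \<in> carrier R" "t \<in> carrier R"
      using x y r t J_closed by auto
    have Er: "E r = t \<oplus> scalar (real (Suc (k + n))) \<otimes> r"
      using carr by (simp add: t_def a_minus_def a_assoc l_neg)
    have cr: "scalar c \<otimes> r \<in> J (Suc k)"
      using r J_antimono[of "Suc k" "Suc (k + n)" r] by (intro J_lmult) auto
    define z where "z = y \<ominus> scalar c \<otimes> r"
    have "z \<in> J k" unfolding z_def using y(1) J_antimono[OF _ cr, of k] by (intro J_minus) auto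
    moreover have "x \<ominus> z \<in> J (Suc k)"
    proof -
      have "x \<ominus> z = (x \<ominus> y) \<oplus> scalar c \<otimes> r"
        unfolding z_def using carr by (simp add: a_minus_def minus_add a_assoc)
      then show ?thesis using y(2) cr J_add by simp
    qed
    moreover have "E z \<ominus> scalar (real k) \<otimes> z = \<ominus> (scalar c \<otimes> t)"
    proof -
      have 1: "E z = E y \<ominus> scalar c \<otimes> E r"
        unfolding z_def using carr by (simp add: E_minus E_smult)
      have 2: "scalar (real k) \<otimes> z = scalar (real k) \<otimes> y \<ominus> scalar c \<otimes> (scalar (real k) \<otimes> r)"
        unfolding z_def a_minus_def using carr
        by (simp add: r_distr r_minus m_assoc[symmetric] scalar_mult[symmetric] mult.commute)
      have "E z \<ominus> scalar (real k) \<otimes> z = r \<ominus> scalar c \<otimes> (E r \<ominus> scalar (real k) \<otimes> r)"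
        unfolding 1 2 r_def[of] using carr
        by (simp add: a_minus_def minus_add r_distr r_minus a_ac)
      also have "E r \<ominus> scalar (real k) \<otimes> r = t \<oplus> scalar (real (Suc n)) \<otimes> r"
      proof -
        have "E r \<ominus> scalar (real k) \<otimes> r =
            t \<oplus> (scalar (real (Suc (k + n))) \<otimes> r \<ominus> scalar (real k) \<otimes> r)"
          unfolding Er using carr by (simp add: a_minus_def a_assoc)
        then show ?thesis using carr by (simp add: scalar_diff)
      qed
      also have "scalar c \<otimes> (t \<oplus> scalar (real (Suc n)) \<otimes> r) = scalar c \<otimes> t \<oplus> r"
        using carr by (simp add: r_distr c_def scalar_inverse del: of_nat_Suc)
      also have "r \<ominus> (scalar c \<otimes> t \<oplus> r) = \<ominus> (scalar c \<otimes> t)"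
        using carr by (simp add: a_minus_def minus_add a_lcomm[of r] r_neg)
      finally show ?thesis .
    qed
    moreover have "\<ominus> (scalar c \<otimes> t) \<in> J (Suc (k + Suc n))"
      using t by (intro J_neg J_lmult) auto
    ultimately show ?case by (intro exI[of _ z]) auto
  qed
  from this[of p] obtain y where y: "y \<in> J k" "x \<ominus> y \<in> J (Suc k)"
    "E y \<ominus> scalar (real k) \<otimes> y \<in> J (Suc (k + p))" by blast
  have "E y \<ominus> scalar (real k) \<otimes> y = \<zero>"
    by (rule J_vanish[OF _ y(3)]) simp
  then have "E y = scalar (real k) \<otimes> y"
    using J_closed[OF y(1)] by (intro eq_if_minus_zero[where x = "E y"]) auto
  then show ?thesis using y J_closed by (intro bexI[of _ y]) (auto simp: eigenspace_def)
qed

text \<open>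
  E preserves parity, so the part of an eigenvector of the wrong parity is an eigenvector; by
  \<open>J_wrong_parity\<close> it lies too deep in the filtration.
\<close>

lemma eigenspace_par:
  assumes x: "x \<in> eigenspace E k"
  shows "x \<in> par k"
proof -
  note e = eigenspace_D[OF x]
  obtain a b where ab: "a \<in> par k" "b \<in> par (Suc k)" "x = a \<oplus> b" using par_decompose[OF e(1)] .
  have carr: "a \<in> carrier R" "b \<in> carrier R" using ab par_closed by auto
  have smult: "scalar c \<otimes> z \<in> par m" if "z \<in> par m" for c z m
    using par_mult[of "scalar c" 0 z m] scalar_even that by (simp add: par_def[of 0])
  define u where "u = E a \<ominus> scalar (real k) \<otimes> a"
  define v where "v = E b \<ominus> scalar (real k) \<otimes> b"
  have uv: "u \<in> par k" "v \<in> par (Suc k)"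
    unfolding u_def v_def a_minus_def using ab by (auto intro!: par_add par_neg E_par smult)
  have "E x = E a \<oplus> E b" unfolding ab(3) using carr by (rule E_add)
  then have "u \<oplus> v = E x \<ominus> scalar (real k) \<otimes> x"
    unfolding u_def v_def ab(3) using carr by (simp add: a_minus_def r_distr minus_add a_ac)
  also have "\<dots> = \<zero>" using e by (simp add: a_minus_def r_neg)
  finally have "v = \<ominus> u"
    using par_closed[OF uv(1)] par_closed[OF uv(2)] by (metis a_comm minus_equality)
  then have "v = \<zero>" using par_disjoint[of v k] par_neg[OF uv(1)] uv(2) by simp
  then have "E b = scalar (real k) \<otimes> b"
    unfolding v_def using carr by (intro eq_if_minus_zero[where x = "E b"]) auto
  then have b: "b \<in> eigenspace E k" using carr by (simp add: eigenspace_def)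
  then have "b = \<zero>" using eigenspace_inter J_wrong_parity[OF eigenspace_J ab(2)] by blast
  then show ?thesis using ab carr by simp
qed

text \<open>
  The Leibniz rule adds eigenvalues, and the chain rule makes the kernel of E closed under the operations.
\<close>

lemma grading_eigenspace: "grading (eigenspace E)"
  unfolding grading_def
proof (intro conjI allI ballI impI)
  show "eigenspace E k \<subseteq> J k \<inter> par k" for k using eigenspace_J eigenspace_par by blast
  show "eigenspace E k \<inter> J (Suc k) \<subseteq> {\<zero>}" for k using eigenspace_inter by blast
  show "\<exists>y\<in>eigenspace E k. x \<ominus> y \<in> J (Suc k)" if "x \<in> J k" for k x using eigenspace_leading[OF that] .
  show "x \<oplus> y \<in> eigenspace E k" if "x \<in> eigenspace E k" "y \<in> eigenspace E k" for k x y
    using that by (simp add: eigenspace_def E_add r_distr)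
  show "x \<otimes> y \<in> eigenspace E (k + l)" if "x \<in> eigenspace E k" "y \<in> eigenspace E l" for k l x y
    using that by (simp add: eigenspace_def E_mult scalar_add l_distr m_assoc m_assoc[of x, symmetric]
        scalar_commute)
  show "op f cs \<in> eigenspace E 0" if f: "smooth (length cs) f" and cs: "set cs \<subseteq> eigenspace E 0" for f cs
  proof -
    have even: "set cs \<subseteq> R0" using cs eigenspace_par[of _ 0] by (auto simp: par_def)
    have "E (cs ! i) = \<zero>" if "i < length cs" for i
      using cs that eigenspace_D[of "cs ! i" 0] nth_mem by fastforce
    moreover have "op (partial i f) cs \<in> carrier R" if "i < length cs" for i
      using op_closed[OF smooth_partial[OF f that] even] even_closed by blast
    ultimately have "E (op f cs) = \<zero>"
      unfolding E_op[OF f even] by (intro add.finprod_one_eqI) auto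
    then show ?thesis using op_closed[OF f even] by (simp add: eigenspace_def even_closed)
  qed
qed

end

context graded
begin

definition degree_field :: "'a \<Rightarrow> 'a" where
  "degree_field = (\<lambda>x\<in>carrier R. \<Oplus>k\<in>{..<p}. scalar (real k) \<otimes> component k x)"

lemma degree_field_closed [simp]: "x \<in> carrier R \<Longrightarrow> degree_field x \<in> carrier R"
  by (auto simp: degree_field_def)

lemma degree_field_add:
  assumes "x \<in> carrier R" "y \<in> carrier R"
  shows "degree_field (x \<oplus> y) = degree_field x \<oplus> degree_field y"
  using assms by (simp add: degree_field_def component_add r_distr Pi_def)

lemma component_degree_field:
  assumes "x \<in> carrier R"
  shows "component k (degree_field x) = scalar (real k) \<otimes> component k x"
  using assms by (intro component_unique) (auto simp: degree_field_def intro!: G_smult component_G)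

lemma degree_field_homogeneous:
  assumes x: "x \<in> G k"
  shows "degree_field x = scalar (real k) \<otimes> x"
proof -
  have eq: "component j (degree_field x) = component j (scalar (real k) \<otimes> x)" for j
    using G_closed[OF x] by (simp add: component_degree_field component_smult component_homogeneous[OF x])
  have "degree_field x = (\<Oplus>j\<in>{..<p}. component j (degree_field x))"
    using G_closed[OF x] by (simp only: sum_component degree_field_closed)
  also have "\<dots> = scalar (real k) \<otimes> x"
    unfolding eq using G_closed[OF x] by (intro sum_component m_closed scalar_closed)
  finally show ?thesis .
qed

lemma degree_field_op_G: "smooth (length cs) f \<Longrightarrow> set cs \<subseteq> G 0 \<Longrightarrow> degree_field (op f cs) = \<zero>"
  using degree_field_homogeneous[OF G_op] G_closed[OF G_op] by simp

lemma degree_field_par: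
  assumes "x \<in> par m"
  shows "degree_field x \<in> par m"
proof -
  have x: "x \<in> carrier R" using assms par_closed by blast
  have "scalar (real k) \<otimes> component k x \<in> par m" for k
  proof (cases "even (k + m)")
    case True
    then have "par k = par m" by (auto simp: par_def)
    then show ?thesis using G_par[OF G_smult[OF component_G[OF x]]] by metis
  next
    case False
    then show ?thesis using component_parity[OF assms] par_zero by simp
  qed
  then show ?thesis unfolding degree_field_def using x by (simp add: par_finsum)
qed

lemma degree_field_mult:
  assumes x: "x \<in> carrier R" and y: "y \<in> carrier R"
  shows "degree_field (x \<otimes> y) = degree_field x \<otimes> y \<oplus> x \<otimes> degree_field y"
proof -
  have "x \<in> J 0" using x by simp
  then show ?thesis
  proof (induction rule: homogeneous_induct)
    case (homogeneous a x)
    note x = homogeneous(2) and xc = G_closed[OF homogeneous(2)]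
    have "y \<in> J 0" using y by simp
    then show ?case
    proof (induction rule: homogeneous_induct)
      case (homogeneous b y)
      note y = homogeneous(2) and yc = G_closed[OF homogeneous(2)]
      have "x \<otimes> (scalar (real b) \<otimes> y) = scalar (real b) \<otimes> (x \<otimes> y)"
        using xc yc by (simp add: m_assoc[symmetric] scalar_commute)
      then show ?case
        using xc yc by (simp add: degree_field_homogeneous[OF x] degree_field_homogeneous[OF y]
            degree_field_homogeneous[OF G_mult[OF x y]] scalar_add l_distr m_assoc)
    next
      case (add y z)
      have "y \<in> carrier R" "z \<in> carrier R" using add J_closed by auto
      then show ?case using add xc by (simp add: r_distr degree_field_add a_ac)
    qed
  next
    case (add u v)
    have "u \<in> carrier R" "v \<in> carrier R" using add J_closed by auto
    then show ?case using add y by (simp add: l_distr degree_field_add a_ac)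
  qed
qed

lemma degree_field_smult:
  assumes "x \<in> carrier R"
  shows "degree_field (scalar c \<otimes> x) = scalar c \<otimes> degree_field x"
  using assms degree_field_homogeneous[OF G_scalar] by (simp add: degree_field_mult)

lemma degree_field_J:
  assumes "x \<in> J m"
  shows "degree_field x \<ominus> scalar (real m) \<otimes> x \<in> J (Suc m)"
  using assms
proof (induction rule: homogeneous_induct)
  case (homogeneous k y)
  note yc = G_closed[OF homogeneous(2)]
  have eq: "degree_field y \<ominus> scalar (real m) \<otimes> y = scalar (real k - real m) \<otimes> y"
    using yc by (simp add: degree_field_homogeneous[OF homogeneous(2)] scalar_diff)
  show ?case
  proof (cases "k = m")
    case True
    then show ?thesis unfolding eq using yc J_zero by simp
  next
    case False
    then have "y \<in> J (Suc m)" using J_antimono[of "Suc m" k y] G_J homogeneous by simp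
    then show ?thesis unfolding eq by (intro J_lmult) auto
  qed
next
  case (add y z)
  have c: "y \<in> carrier R" "z \<in> carrier R" using add J_closed by auto
  have "degree_field (y \<oplus> z) \<ominus> scalar (real m) \<otimes> (y \<oplus> z) =
      (degree_field y \<ominus> scalar (real m) \<otimes> y) \<oplus> (degree_field z \<ominus> scalar (real m) \<otimes> z)"
    using c by (simp add: degree_field_add a_minus_def r_distr minus_add a_ac)
  then show ?case using add J_add by simp
qed

text \<open>
  Even elements are degree-zero parts plus increments in \<open>J\<close>, to which Taylor's formula applies.
\<close>

lemma degree_zero_part:
  assumes "set as \<subseteq> R0"
  defines "cs \<equiv> map (component 0) as" and "N \<equiv> \<lambda>j. as ! j \<ominus> component 0 (as ! j)"
  shows "length cs = length as" "set cs \<subseteq> G 0" "set cs \<subseteq> R0"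
    "\<And>j. j < length cs \<Longrightarrow> N j \<in> R0 \<and> N j \<in> J (Suc 0)"
    "\<And>j. j < length cs \<Longrightarrow> as ! j = cs ! j \<oplus> N j"
proof -
  have as: "as ! j \<in> R0" "as ! j \<in> carrier R" if "j < length as" for j
    using assms(1) that even_closed nth_mem by blast+
  show "length cs = length as" by (simp add: cs_def)
  show cs: "set cs \<subseteq> G 0" using assms(1) even_closed by (auto simp: cs_def intro!: component_G)
  show cs': "set cs \<subseteq> R0" using cs G_par[of _ 0] by (auto simp: par_def)
  fix j assume "j < length cs"
  then have j: "j < length as" by (simp add: cs_def)
  have c: "component 0 (as ! j) \<in> R0" using cs' j by (auto simp: cs_def)
  show "N j \<in> R0 \<and> N j \<in> J (Suc 0)"
    using minus_component[of "as ! j" 0] as[OF j] c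
    by (auto simp: N_def a_minus_def intro!: even_add even_neg)
  show "as ! j = cs ! j \<oplus> N j"
    using as[OF j] j by (simp add: N_def cs_def minus_add_cancel)
qed

text \<open>
  Expand f about the degree-zero parts. There all derivatives of f take values in \<open>G 0\<close>, so that the
  derivation acts on the monomials only. By \<open>contract_derivation\<close> it turns the term of degree \<open>n + 1\<close> of f into
  the sum over i of the terms of degree n of the partial derivatives, times the derivatives of the
  arguments; the factor \<open>n + 1\<close> is absorbed by the factorials.
\<close>

lemma degree_field_op:
  assumes f: "smooth (length as) f" and as: "set as \<subseteq> R0"
  shows "degree_field (op f as) = (\<Oplus>i\<in>{..<length as}. op (partial i f) as \<otimes> degree_field (as ! i))"
proof -
  define cs where "cs = map (component 0) as"
  define N where "N = (\<lambda>j. as ! j \<ominus> component 0 (as ! j))"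
  define k where "k = length as"
  define D where "D = (\<lambda>js. op (partials js f) cs)"
  define s where "s = (\<lambda>n::nat. scalar (1 / fact n))"
  have dz: "length cs = length as" "set cs \<subseteq> G 0" "set cs \<subseteq> R0"
    "\<And>j. j < length cs \<Longrightarrow> N j \<in> R0 \<and> N j \<in> J (Suc 0)"
    "\<And>j. j < length cs \<Longrightarrow> as ! j = cs ! j \<oplus> N j"
    unfolding cs_def N_def by (fact degree_zero_part[OF as])+
  have len: "length cs = k" using dz(1) by (simp add: k_def)
  have f': "smooth (length cs) f" using f len by (simp add: k_def)
  have N: "N j \<in> R0" "N j \<in> carrier R" "N j \<in> J (Suc 0)" if "j < k" for j
    using dz(4)[of j] that len even_closed by auto
  have as_j: "as ! j \<in> R0" "as ! j \<in> carrier R" if "j < k" for j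
    using as that even_closed nth_mem unfolding k_def by blast+
  have D: "D js \<in> R0" "D js \<in> carrier R" "degree_field (D js) = \<zero>" if "set js \<subseteq> {..<k}" for js
    using op_partials_even[OF f' dz(3), of js] degree_field_op_G[OF smooth_partials[OF f'] dz(2), of js]
      that len even_closed by (auto simp: D_def)
  have sym: "symmetric_family k D"
    unfolding D_def using symmetric_family_op[OF f'] len by simp
  have deg_N: "degree_field (N j) = degree_field (as ! j)" if "j < k" for j
  proof -
    have cj: "cs ! j \<in> G 0" using dz(2) len that by auto
    have "as ! j = cs ! j \<oplus> N j" using dz(5)[of j] len that by (simp add: N_def)
    then have "degree_field (as ! j) = degree_field (cs ! j \<oplus> N j)" by (rule arg_cong)
    also have "\<dots> = degree_field (cs ! j) \<oplus> degree_field (N j)"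
      using that N G_closed[OF cj] by (intro degree_field_add)
    finally show ?thesis
      using degree_field_homogeneous[OF cj] G_closed[OF cj] N that by simp
  qed
  have s: "s n \<in> carrier R" for n by (simp add: s_def)
  have te: "contract k (\<lambda>js. D (js @ ks)) N n \<in> R0"
    "contract k (\<lambda>js. D (js @ ks)) N n \<in> carrier R" if "set ks \<subseteq> {..<k}" for n ks
    using D N that even_closed by (auto intro!: even_contract contract_closed)
  define X where "X = (\<lambda>n. \<Oplus>i\<in>{..<k}. contract k (\<lambda>js. D (js @ [i])) N n \<otimes> degree_field (as ! i))"
  have X: "X n \<in> carrier R" for n
    unfolding X_def using te as_j by (auto intro!: finsum_closed)
  have deg_te_0: "degree_field (contract k D N 0) = \<zero>"
    using D[of "[]"] by (simp add: contract_0)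
  have deg_te_Suc: "degree_field (contract k D N (Suc n)) = [(Suc n)] \<cdot> X n" for n
  proof -
    have "degree_field (contract k D N (Suc n)) = [(Suc n)] \<cdot> (\<Oplus>i\<in>{..<k}.
        contract k (\<lambda>js. D (js @ [i])) N n \<otimes> degree_field (N i))"
      using D(2,3) N(1) sym
      by (intro contract_derivation) (auto simp: degree_field_mult degree_field_add intro: even_center)
    also have "(\<Oplus>i\<in>{..<k}. contract k (\<lambda>js. D (js @ [i])) N n \<otimes> degree_field (N i)) = X n"
      unfolding X_def using te as_j by (intro finsum_cong') (auto simp: deg_N)
    finally show ?thesis .
  qed
  \<comment> \<open>One degree more than for the partial derivatives below, as differentiation lowers degrees.\<close>
  have "op f as = (\<Oplus>n\<in>{..<Suc p}. s n \<otimes> contract k D N n)"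
    unfolding s_def D_def len[symmetric] using dz by (intro op_add_nilpotent f') auto
  then have "degree_field (op f as) = (\<Oplus>n\<in>{..<Suc p}. s n \<otimes> degree_field (contract k D N n))"
    using te[of "[]"] s 
      additive_finsum[of degree_field "{..<Suc p}" "\<lambda>n. s n \<otimes> contract k D N n"]
    by (simp add: s_def degree_field_smult degree_field_add)
  also have "\<dots> = (\<Oplus>n\<in>{..<p}. s (Suc n) \<otimes> degree_field (contract k D N (Suc n))) \<oplus>
      s 0 \<otimes> degree_field (contract k D N 0)"
    using te[of "[]"] s by (intro finsum_lessThan_Suc_shift) auto
  also have "\<dots> = (\<Oplus>n\<in>{..<p}. s (Suc n) \<otimes> [(Suc n)] \<cdot> X n)"
    using s X by (simp add: deg_te_0 deg_te_Suc del: add.nat_pow_Suc)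
  also have "\<dots> = (\<Oplus>n\<in>{..<p}. \<Oplus>i\<in>{..<k}. s n \<otimes> (contract k (\<lambda>js. D (js @ [i])) N n \<otimes> degree_field (as ! i)))"
  proof (rule finsum_cong')
    fix n
    have "s (Suc n) \<otimes> [(Suc n)] \<cdot> X n = scalar (1 / fact (Suc n) * real (Suc n)) \<otimes> X n"
      unfolding s_def scalar_of_nat[OF X, symmetric] scalar_mult using X by (simp only: m_assoc scalar_closed)
    also have "1 / fact (Suc n) * real (Suc n) = 1 / fact n"
      by (simp add: field_simps del: of_nat_Suc)
    also have "scalar (1 / fact n) \<otimes> X n =
        (\<Oplus>i\<in>{..<k}. s n \<otimes> (contract k (\<lambda>js. D (js @ [i])) N n \<otimes> degree_field (as ! i)))"
      unfolding X_def s_def using te as_j by (intro finsum_rdistr) auto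
    finally show "s (Suc n) \<otimes> [(Suc n)] \<cdot> X n =
        (\<Oplus>i\<in>{..<k}. s n \<otimes> (contract k (\<lambda>js. D (js @ [i])) N n \<otimes> degree_field (as ! i)))" .
  qed (use s te as_j in \<open>auto intro!: finsum_closed\<close>)
  also have "\<dots> = (\<Oplus>i\<in>{..<k}. \<Oplus>n\<in>{..<p}. s n \<otimes> (contract k (\<lambda>js. D (js @ [i])) N n \<otimes> degree_field (as ! i)))"
    using s te as_j by (intro finsum_swap) auto
  also have "\<dots> = (\<Oplus>i\<in>{..<k}. op (partial i f) as \<otimes> degree_field (as ! i))"
  proof (rule finsum_cong')
    fix i assume "i \<in> {..<k}"
    then have i: "i < k" by simp
    have "op (partial i f) as = (\<Oplus>n\<in>{..<p}. s n \<otimes>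
        contract (length cs) (\<lambda>js. op (partials js (partial i f)) cs) N n)"
      unfolding s_def using dz smooth_partial[OF f'] i len by (intro op_add_nilpotent) auto
    also have "(\<lambda>js. op (partials js (partial i f)) cs) = (\<lambda>js. D (js @ [i]))"
      by (simp add: D_def partials_append)
    finally have op_eq: "op (partial i f) as = (\<Oplus>n\<in>{..<p}. s n \<otimes> contract k (\<lambda>js. D (js @ [i])) N n)"
      by (simp only: len)
    show "(\<Oplus>n\<in>{..<p}. s n \<otimes> (contract k (\<lambda>js. D (js @ [i])) N n \<otimes> degree_field (as ! i))) =
        op (partial i f) as \<otimes> degree_field (as ! i)"
      unfolding op_eq using i s te as_j
      by (subst finsum_ldistr) (auto simp: m_assoc intro!: finsum_cong')
  qed (use op_closed[OF smooth_partial[OF f] as] as_j in \<open>auto simp: k_def even_closed\<close>)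
  finally show ?thesis by (simp add: k_def)
qed

theorem euler_degree_field: "euler_vector_field R degree_field"
  unfolding euler_vector_field_def cinf_even_superderivation_def even_superderivation_def
proof (intro conjI allI ballI impI)
  show "degree_field \<in> carrier R \<rightarrow>\<^sub>E carrier R"
    by (auto simp: PiE_def degree_field_def)
  show "degree_field ` R0 \<subseteq> R0" "degree_field ` R1 \<subseteq> R1"
    using degree_field_par[of _ 0] degree_field_par[of _ 1] by (auto simp: par_def)
  show "degree_field (op (\<lambda>_. c) [] \<otimes> r) = op (\<lambda>_. c) [] \<otimes> degree_field r" if "r \<in> carrier R" for c r
    using degree_field_smult[OF that, of c] by (simp add: scalar_def)
  show "degree_field x \<ominus> [k] \<cdot> x \<in> J (Suc k)" if "x \<in> J k" for k x
    using degree_field_J[OF that] J_closed[OF that] by (simp add: scalar_of_nat)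
qed (auto simp: degree_field_add degree_field_mult degree_field_op)

lemma eigenspace_degree_field: "eigenspace degree_field = G"
proof
  fix k
  show "eigenspace degree_field k = G k"
  proof
    show "G k \<subseteq> eigenspace degree_field k"
      by (auto simp: eigenspace_def degree_field_homogeneous G_closed)
    show "eigenspace degree_field k \<subseteq> G k"
    proof
      fix x assume "x \<in> eigenspace degree_field k"
      then have x: "x \<in> carrier R" "degree_field x = scalar (real k) \<otimes> x" by (auto simp: eigenspace_def)
      show "x \<in> G k"
      proof (rule G_if_components[OF x(1)])
        fix j assume j: "j \<noteq> k"
        have "scalar (real j) \<otimes> component j x = scalar (real k) \<otimes> component j x"
          using component_degree_field[OF x(1), of j] component_smult[OF x(1), of j "real k"] x(2) by simp
        then have "scalar (real j - real k) \<otimes> component j x = \<zero>"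
          using x(1) scalar_diff[of "component j x" "real j" "real k"] by (simp add: a_minus_def r_neg)
        then show "component j x = \<zero>"
          using j x(1) scalar_eq_zero[of "real j - real k" "component j x"] by simp
      qed
    qed
  qed
qed

end

context nilpotent_taylor
begin

theorem bij_betw_eigenspace: "bij_betw eigenspace {E. euler_vector_field R E} {G. grading G}"
  unfolding bij_betw_def
proof
  show "inj_on eigenspace {E. euler_vector_field R E}"
  proof (rule inj_onI, unfold mem_Collect_eq)
    fix E F assume E: "euler_vector_field R E" and F: "euler_vector_field R F"
      and eq: "eigenspace E = eigenspace F"
    interpret E: euler_field R p E using E by unfold_locales
    interpret F: euler_field R p F using F by unfold_locales
    interpret graded R p "eigenspace E" using E.grading_eigenspace by unfold_locales
    show "E = F"
    proof (rule PiE_ext[OF E.E_ext F.E_ext])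
      fix x assume "x \<in> carrier R"
      then have "x \<in> J 0" by simp
      then show "E x = F x"
      proof (induction rule: homogeneous_induct)
        case (homogeneous k y)
        moreover from this have "y \<in> eigenspace F k" using eq by simp
        ultimately show ?case using E.eigenspace_D F.eigenspace_D by metis
      next
        case (add y z)
        then show ?case using J_closed E.E_add F.E_add by metis
      qed
    qed
  qed
  show "eigenspace ` {E. euler_vector_field R E} = {G. grading G}"
  proof
    show "eigenspace ` {E. euler_vector_field R E} \<subseteq> {G. grading G}"
    proof
      fix G assume "G \<in> eigenspace ` {E. euler_vector_field R E}"
      then obtain E where "euler_vector_field R E" and G: "G = eigenspace E" by blast
      then interpret euler_field R p E by unfold_locales
      show "G \<in> {G. grading G}" using grading_eigenspace G by simp
    qed
    show "{G. grading G} \<subseteq> eigenspace ` {E. euler_vector_field R E}"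
    proof
      fix G assume "G \<in> {G. grading G}"
      then interpret graded R p G by unfold_locales simp
      show "G \<in> eigenspace ` {E. euler_vector_field R E}"
        using euler_degree_field eigenspace_degree_field by (intro image_eqI[of _ _ degree_field]) auto
    qed
  qed
qed

end

section \<open>Splittings and gradings\<close>

context nilpotent_taylor
begin

lemma gr_proj_zero_iff:
  assumes "x \<in> carrier R"
  shows "gr_proj R k x = J (Suc k) \<longleftrightarrow> x \<in> J (Suc k)"
  unfolding gr_proj_def
  using assms a_rcos_zero[OF J_ideal] ideal.rcos_const_imp_mem[OF J_ideal] by metis

lemma gr_proj_eq_iff:
  assumes "x \<in> carrier R" "y \<in> carrier R"
  shows "gr_proj R k x = gr_proj R k y \<longleftrightarrow> x \<ominus> y \<in> J (Suc k)"
  unfolding gr_proj_def using quotient_eq_iff_same_a_r_cos[OF J_ideal assms] by blast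

lemma gr_proj_add:
  assumes "x \<in> carrier R" "y \<in> carrier R"
  shows "gr_proj R k x <+> gr_proj R k y = gr_proj R k (x \<oplus> y)"
  unfolding gr_proj_def using ideal.a_rcos_sum[OF J_ideal assms] .

lemma gr_proj_zero: "gr_proj R k \<zero> = J (Suc k)"
  using gr_proj_zero_iff[of \<zero> k] J_zero by simp

lemma gr_proj_J: "x \<in> J (Suc k) \<Longrightarrow> gr_proj R k x = J (Suc k)"
  using gr_proj_zero_iff J_closed by blast

lemma gr_proj_subset: "x \<in> carrier R \<Longrightarrow> a \<in> gr_proj R k x \<Longrightarrow> \<exists>u\<in>J (Suc k). a = u \<oplus> x"
  unfolding gr_proj_def a_r_coset_def' by auto

text \<open>
  The cosets are taken modulo different powers. Changing x by an element of \<open>J\<^sup>i\<^sup>+\<^sup>1\<close> or y by an element of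
  \<open>J\<^sup>j\<^sup>+\<^sup>1\<close> changes the product by an element of \<open>J\<^sup>i\<^sup>+\<^sup>j\<^sup>+\<^sup>1\<close>.
\<close>

lemma rcoset_mult_gr_proj:
  assumes x: "x \<in> J i" and y: "y \<in> J j" and m: "m = i + j"
  shows "rcoset_mult R (J (Suc m)) (gr_proj R i x) (gr_proj R j y) = gr_proj R m (x \<otimes> y)"
proof -
  have c: "x \<in> carrier R" "y \<in> carrier R" using x y J_closed by auto
  have self: "x \<in> gr_proj R i x" "y \<in> gr_proj R j y"
    unfolding gr_proj_def a_r_coset_def' using c J_zero
    by (auto intro!: bexI[of _ \<zero>])
  have "J (Suc m) +> (a \<otimes> b) = gr_proj R m (x \<otimes> y)"
    if a: "a \<in> gr_proj R i x" and b: "b \<in> gr_proj R j y" for a b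
  proof -
    obtain u v where u: "u \<in> J (Suc i)" "a = u \<oplus> x" and v: "v \<in> J (Suc j)" "b = v \<oplus> y"
      using gr_proj_subset a b c by metis
    have uv: "u \<in> carrier R" "v \<in> carrier R" using u v J_closed by auto
    have "a \<otimes> b \<ominus> x \<otimes> y = u \<otimes> v \<oplus> (u \<otimes> y \<oplus> x \<otimes> v)"
      unfolding u v using c uv
      by (simp add: a_minus_def l_distr r_distr a_assoc r_neg r_neg1 r_neg2 a_comm[of "x \<otimes> v"])
    moreover have "u \<otimes> v \<in> J (Suc m)"
      using J_mult[OF u(1) v(1)] J_antimono[of "Suc m" "Suc i + Suc j"] by (simp add: m)
    moreover have "u \<otimes> y \<in> J (Suc m)" "x \<otimes> v \<in> J (Suc m)"
      using J_mult[OF u(1) y] J_mult[OF x v(1)] by (simp_all add: m)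
    ultimately have "a \<otimes> b \<ominus> x \<otimes> y \<in> J (Suc m)" using J_add by simp
    moreover have "a \<in> carrier R" "b \<in> carrier R" using u v uv c by auto
    ultimately show ?thesis
      using gr_proj_eq_iff[of "a \<otimes> b" "x \<otimes> y" m] c by (simp add: gr_proj_def)
  qed
  then show ?thesis unfolding rcoset_mult_def using self by blast
qed

lemma Gr_carrier: "carrier (Gr R) = {F. (\<forall>k. F k \<in> gr_piece R k) \<and> finite {k. F k \<noteq> J (Suc k)}}"
  and Gr_mult: "F \<otimes>\<^bsub>Gr R\<^esub> H = (\<lambda>m. \<Oplus>\<^bsub>R Quot (J (Suc m))\<^esub>i \<in> {..m}. rcoset_mult R (J (Suc m)) (F i) (H (m - i)))"
  and Gr_add: "F \<oplus>\<^bsub>Gr R\<^esub> H = (\<lambda>k. F k <+> H k)"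
  and Gr_zero: "\<zero>\<^bsub>Gr R\<^esub> = (\<lambda>k. J (Suc k))"
  and Gr_one: "\<one>\<^bsub>Gr R\<^esub> = (\<lambda>k. if k = 0 then gr_proj R 0 \<one> else J (Suc k))"
  and Gr_even: "even_part (Gr R) = {F \<in> carrier (Gr R). \<forall>k. odd k \<longrightarrow> F k = J (Suc k)}"
  and Gr_odd: "odd_part (Gr R) = {F \<in> carrier (Gr R). \<forall>k. even k \<longrightarrow> F k = J (Suc k)}"
  by (simp_all add: Gr_def gr_ring_def Let_def)

lemma Gr_op: "smooth_op (Gr R) f Fs = taylor (Gr R) (gr_const R) (body_op R) f
    (map (\<lambda>F. F 0) Fs) (map (\<lambda>F. F(0 := J (Suc 0))) Fs)"
proof -
  have "taylor (gr_ring R) \<iota> \<phi> f fs Ns = taylor (Gr R) \<iota> \<phi> f fs Ns" for \<iota> \<phi> fs Ns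
    by (rule taylor_cong_ring) (simp_all add: Gr_def Let_def)
  then show ?thesis by (simp add: Gr_def Let_def)
qed

lemma gr_piece_obtain:
  assumes "A \<in> gr_piece R k"
  obtains x where "x \<in> J k" "A = gr_proj R k x"
  using assms unfolding gr_piece_def by blast

lemma zero_gr_piece: "J (Suc k) \<in> gr_piece R k"
  unfolding gr_piece_def using gr_proj_zero[of k] J_zero[of k] by (metis image_eqI)

lemma body_op_gr_proj:
  assumes f: "smooth (length as) f" and as: "set as \<subseteq> R0"
  shows "body_op R f (map (gr_proj R 0) as) = gr_proj R 0 (op f as)"
proof -
  have "gr_proj R 0 (op f bs) = gr_proj R 0 (op f as)"
    if "list_all2 (\<lambda>a A. a \<in> A \<inter> R0) bs (map (gr_proj R 0) as)" for bs
  proof -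
    have len: "length bs = length as" using list_all2_lengthD[OF that] by simp
    have bs: "bs ! j \<in> gr_proj R 0 (as ! j)" "bs ! j \<in> R0" if "j < length as" for j
      using list_all2_nthD2[OF \<open>list_all2 _ bs _\<close>, of j] that by auto
    have set_bs: "set bs \<subseteq> R0" using bs(2) len by (auto simp: in_set_conv_nth)
    have "bs ! j \<ominus> as ! j \<in> J (Suc 0)" if j: "j < length as" for j
    proof -
      have a: "as ! j \<in> carrier R" using as j even_closed nth_mem by blast
      obtain u where u: "u \<in> J (Suc 0)" "bs ! j = u \<oplus> as ! j"
        using gr_proj_subset[OF a bs(1)[OF j]] by blast
      then show ?thesis using a J_closed[OF u(1)] by (simp add: a_minus_def a_assoc r_neg)
    qed
    then have "op f bs \<ominus> op f as \<in> J (Suc 0)"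
      by (intro op_cong_J f as set_bs len)
    then show ?thesis
      using gr_proj_eq_iff[of "op f bs" "op f as" 0] f len op_closed[of bs f] op_closed[of as f] as set_bs even_closed
      by simp
  qed
  moreover have "list_all2 (\<lambda>a A. a \<in> A \<inter> R0) as (map (gr_proj R 0) as)"
  proof (rule list_all2_all_nthI)
    fix j assume "j < length as"
    then have a: "as ! j \<in> R0" "as ! j \<in> carrier R" using as even_closed nth_mem by blast+
    then have "as ! j = \<zero> \<oplus> as ! j" by simp
    then have "as ! j \<in> gr_proj R 0 (as ! j)"
      unfolding gr_proj_def a_r_coset_def' using J_zero by blast
    then show "as ! j \<in> map (gr_proj R 0) as ! j \<inter> R0" using a \<open>j < length as\<close> by simp
  qed simp
  ultimately have "{gr_proj R 0 (op f bs) | bs. list_all2 (\<lambda>a A. a \<in> A \<inter> R0) bs (map (gr_proj R 0) as)} =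
      {gr_proj R 0 (op f as)}" by blast
  then show ?thesis unfolding body_op_def by simp
qed

lemma body_op_scalar: "body_op R (\<lambda>_. c) [] = gr_proj R 0 (scalar c)"
  using body_op_gr_proj[of "[]" "\<lambda>_. c"] smooth_const by (simp add: scalar_def)

definition degree_part :: "('a \<Rightarrow> nat \<Rightarrow> 'a set) \<Rightarrow> nat \<Rightarrow> 'a set" where
  "degree_part l k = {x \<in> carrier R. \<forall>j. j \<noteq> k \<longrightarrow> l x j = J (Suc j)}"

text \<open>
  The associated graded ring inherits the ring axioms through any additive and multiplicative bijection.
\<close>

lemma ring_Gr:
  assumes "l \<in> ring_hom R (Gr R)" "bij_betw l (carrier R) (carrier (Gr R))" "l \<zero> = \<zero>\<^bsub>Gr R\<^esub>"
  shows "ring (Gr R)"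
proof -
  have "l \<in> ring_iso R (Gr R)" using assms by (simp add: ring_iso_def)
  from ring_iso_imp_img_ring[OF this] show ?thesis by (simp add: assms(3))
qed

lemma gr_const_closed:
  assumes "x \<in> carrier R"
  shows "gr_const R (gr_proj R 0 x) \<in> carrier (Gr R)"
proof -
  have "gr_const R (gr_proj R 0 x) k \<in> gr_piece R k" for k
    using assms zero_gr_piece by (auto simp: gr_const_def gr_piece_def)
  moreover have "finite {k. gr_const R (gr_proj R 0 x) k \<noteq> J (Suc k)}"
    by (rule finite_subset[of _ "{0}"]) (auto simp: gr_const_def)
  ultimately show ?thesis by (simp add: Gr_carrier)
qed

end

locale split_map = nilpotent_taylor R p
  for R :: "('a, 'm) cinf_superstructure_scheme" (structure) and p :: nat +
  fixes l :: "'a \<Rightarrow> nat \<Rightarrow> 'a set"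
  assumes splitting: "splitting R l"
begin

lemma l_ext: "l \<in> extensional (carrier R)"
  and l_hom: "l \<in> ring_hom R (Gr R)"
  and l_bij: "bij_betw l (carrier R) (carrier (Gr R))"
  and l_even: "x \<in> R0 \<Longrightarrow> l x \<in> even_part (Gr R)"
  and l_odd: "x \<in> R1 \<Longrightarrow> l x \<in> odd_part (Gr R)"
  and l_op: "smooth (length as) f \<Longrightarrow> set as \<subseteq> R0 \<Longrightarrow> l (op f as) = smooth_op (Gr R) f (map l as)"
  and l_proj: "x \<in> J k \<Longrightarrow> l x k = gr_proj R k x"
  using splitting unfolding splitting_def cinf_superring_iso_def cinf_superring_hom_def by blast+

lemma l_inj: "l x = l y \<Longrightarrow> x \<in> carrier R \<Longrightarrow> y \<in> carrier R \<Longrightarrow> x = y"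
  using l_bij unfolding bij_betw_def inj_on_def by blast

lemma l_closed: "x \<in> carrier R \<Longrightarrow> l x \<in> carrier (Gr R)"
  using ring_hom_closed[OF l_hom] .

lemma l_add: "x \<in> carrier R \<Longrightarrow> y \<in> carrier R \<Longrightarrow> l (x \<oplus> y) k = l x k <+> l y k"
  using ring_hom_add[OF l_hom] by (simp add: Gr_add)

lemma l_zero: "l \<zero> = \<zero>\<^bsub>Gr R\<^esub>"
  using l_proj[OF J_zero] by (auto simp: Gr_zero gr_proj_zero)

lemma l_coset:
  assumes "x \<in> carrier R"
  obtains z where "z \<in> J k" "l x k = gr_proj R k z"
  using l_closed[OF assms] gr_piece_obtain unfolding Gr_carrier by blast

lemma l_add_zero:
  assumes "x \<in> carrier R" "y \<in> carrier R" "l x k = J (Suc k)"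
  shows "l (x \<oplus> y) k = l y k"
proof -
  obtain z where z: "z \<in> J k" "l y k = gr_proj R k z" using l_coset[OF assms(2)] .
  have "l (x \<oplus> y) k = gr_proj R k \<zero> <+> gr_proj R k z"
    using assms z by (simp add: l_add gr_proj_zero)
  also have "\<dots> = l y k" using z J_closed[OF z(1)] by (simp add: gr_proj_add)
  finally show ?thesis .
qed

lemma degree_part_D:
  assumes "x \<in> degree_part l k"
  shows "x \<in> carrier R" "\<And>j. j \<noteq> k \<Longrightarrow> l x j = J (Suc j)"
  using assms by (simp_all add: degree_part_def)

text \<open>
  If x lies in \<open>J\<^sup>m\<close> for some m below its degree, then its class in \<open>J\<^sup>m / J\<^sup>m\<^sup>+\<^sup>1\<close> is the component of degree m
  of its image, which vanishes.
\<close>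

lemma degree_part_J:
  assumes x: "x \<in> degree_part l k"
  shows "x \<in> J k"
proof -
  have "x \<in> J m" if "m \<le> k" for m
    using that
  proof (induction m)
    case 0
    then show ?case using degree_part_D[OF x] by simp
  next
    case (Suc m)
    then have "gr_proj R m x = J (Suc m)" using l_proj[of x m] degree_part_D(2)[OF x, of m] by simp
    then show ?case using gr_proj_zero_iff degree_part_D[OF x] by blast
  qed
  then show ?thesis by simp
qed

lemma degree_part_inter:
  assumes x: "x \<in> degree_part l k" "x \<in> J (Suc k)"
  shows "x = \<zero>"
proof -
  have "l x k = J (Suc k)"
    using l_proj[OF degree_part_J[OF x(1)]] gr_proj_J[OF x(2)] by simp
  then have "l x j = J (Suc j)" for j using degree_part_D(2)[OF x(1)] by (cases "j = k") auto
  then have "l x = l \<zero>" by (auto simp: l_zero Gr_zero)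
  then show ?thesis using l_inj degree_part_D[OF x(1)] by blast
qed

lemma degree_part_leading:
  assumes x: "x \<in> J k"
  shows "\<exists>y\<in>degree_part l k. x \<ominus> y \<in> J (Suc k)"
proof -
  define F where "F = (\<lambda>j. if j = k then gr_proj R k x else J (Suc j))"
  have "finite {j. F j \<noteq> J (Suc j)}" by (rule finite_subset[of _ "{k}"]) (auto simp: F_def)
  moreover have "F j \<in> gr_piece R j" for j
    using x zero_gr_piece by (auto simp: F_def gr_piece_def)
  ultimately have "F \<in> carrier (Gr R)" by (simp add: Gr_carrier)
  then obtain y where y: "y \<in> carrier R" "l y = F"
    using l_bij unfolding bij_betw_def by (metis imageE)
  then have dy: "y \<in> degree_part l k" by (simp add: degree_part_def F_def)
  have "gr_proj R k y = gr_proj R k x"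
    using l_proj[OF degree_part_J[OF dy]] y by (simp add: F_def)
  then have "x \<ominus> y \<in> J (Suc k)" using gr_proj_eq_iff y J_closed[OF x] by metis
  then show ?thesis using dy by blast
qed

lemma degree_part_par:
  assumes x: "x \<in> degree_part l k"
  shows "x \<in> par k"
proof -
  obtain a b where ab: "a \<in> par k" "b \<in> par (Suc k)" "x = a \<oplus> b"
    using par_decompose[OF degree_part_D(1)[OF x]] .
  have carr: "a \<in> carrier R" "b \<in> carrier R" using ab par_closed by auto
  have parity: "l z j = J (Suc j)" if "z \<in> par m" "odd (j + m)" for z j m
    using that l_even l_odd by (auto simp: par_def Gr_even Gr_odd split: if_splits)
  have "l b j = J (Suc j)" for j
  proof (cases "even (j + k)")
    case True
    then show ?thesis using parity[OF ab(2)] by simp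
  next
    case False
    then have "l b j = l x j"
      using l_add_zero[OF carr parity[OF ab(1)]] ab(3) by simp
    moreover have "j \<noteq> k" using False by auto
    ultimately show ?thesis using degree_part_D(2)[OF x] by simp
  qed
  then have "l b = l \<zero>" by (auto simp: l_zero Gr_zero)
  then have "b = \<zero>" using l_inj carr by blast
  then show ?thesis using ab carr by simp
qed

lemma degree_part_mult:
  assumes x: "x \<in> degree_part l a" and y: "y \<in> degree_part l b"
  shows "x \<otimes> y \<in> degree_part l (a + b)"
proof -
  note xc = degree_part_D(1)[OF x] and yc = degree_part_D(1)[OF y]
  have "l (x \<otimes> y) m = J (Suc m)" if m: "m \<noteq> a + b" for m
  proof -
    have zero: "\<zero>\<^bsub>R Quot J (Suc m)\<^esub> = J (Suc m)" by (simp add: FactRing_def)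
    interpret Q: ring "R Quot J (Suc m)" by (rule ideal.quotient_is_ring[OF J_ideal])
    have "rcoset_mult R (J (Suc m)) (l x i) (l y (m - i)) = J (Suc m)" if i: "i \<le> m" for i
    proof -
      have "l x i = J (Suc i) \<or> l y (m - i) = J (Suc (m - i))"
      proof (cases "i = a")
        case True
        then have "m - i \<noteq> b" using m i by auto
        then show ?thesis using degree_part_D(2)[OF y] by blast
      next
        case False
        then show ?thesis using degree_part_D(2)[OF x] by blast
      qed
      moreover obtain u where u: "u \<in> J i" "l x i = gr_proj R i u" using l_coset[OF xc] .
      moreover obtain v where v: "v \<in> J (m - i)" "l y (m - i) = gr_proj R (m - i) v" using l_coset[OF yc] .
      ultimately have uv: "u \<in> J (Suc i) \<or> v \<in> J (Suc (m - i))"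
        using gr_proj_zero_iff J_closed by metis
      have "u \<otimes> v \<in> J (Suc m)"
        using uv J_mult[of u "Suc i" v "m - i"] J_mult[of u i v "Suc (m - i)"] u v i by auto
      then show ?thesis
        using rcoset_mult_gr_proj[OF u(1) v(1), of m] i by (simp add: u v gr_proj_J)
    qed
    then have "(\<Oplus>\<^bsub>R Quot J (Suc m)\<^esub>i\<in>{..m}. rcoset_mult R (J (Suc m)) (l x i) (l y (m - i))) = \<zero>\<^bsub>R Quot J (Suc m)\<^esub>"
      by (intro Q.add.finprod_one_eqI) (simp add: zero)
    then show ?thesis
      using ring_hom_mult[OF l_hom xc yc] by (simp add: Gr_mult zero)
  qed
  then show ?thesis using xc yc by (simp add: degree_part_def)
qed

text \<open>
  The image of an element of degree zero has no nilpotent part, so the Taylor expansion in the associated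
  graded ring reduces to its constant term.
\<close>

lemma degree_part_op:
  assumes f: "smooth (length cs) f" and cs: "set cs \<subseteq> degree_part l 0"
  shows "op f cs \<in> degree_part l 0"
proof -
  have even: "set cs \<subseteq> R0" using cs degree_part_par[of _ 0] by (auto simp: par_def)
  have body: "map (\<lambda>F. F 0) (map l cs) = map (gr_proj R 0) cs"
    using even even_closed l_proj[of _ 0] by auto
  have body_op: "body_op R (partials js f) (map (gr_proj R 0) cs) = gr_proj R 0 (op (partials js f) cs)"
    if "set js \<subseteq> {..<length cs}" for js
    using body_op_gr_proj[OF smooth_partials[OF f that] even] .
  have op_carr: "op (partials js f) cs \<in> carrier R" if "set js \<subseteq> {..<length cs}" for js
    using op_partials_even[OF f even that] even_closed by blast
  have "l (op f cs) = taylor (Gr R) (gr_const R) (body_op R) f (map (gr_proj R 0) cs)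
      (map (\<lambda>F. F(0 := J (Suc 0))) (map l cs))"
    unfolding l_op[OF f even] Gr_op body ..
  also have "\<dots> = gr_const R (body_op R f (map (gr_proj R 0) cs))"
  proof (rule taylor_zero_nilpotents[OF ring_Gr[OF l_hom l_bij l_zero]])
    show "gr_const R (body_op R (\<lambda>_. 1) []) = \<one>\<^bsub>Gr R\<^esub>"
      by (auto simp: body_op_scalar gr_const_def Gr_one)
    show "map (\<lambda>F. F(0 := J (Suc 0))) (map l cs) ! j = \<zero>\<^bsub>Gr R\<^esub>" if "j < length (map (gr_proj R 0) cs)" for j
    proof
      fix i
      have "cs ! j \<in> degree_part l 0" using that cs by auto
      then show "(map (\<lambda>F. F(0 := J (Suc 0))) (map l cs) ! j) i = \<zero>\<^bsub>Gr R\<^esub> i"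
        using that degree_part_D(2)[of "cs ! j" 0 i] by (simp add: Gr_zero)
    qed
  qed (simp_all add: body_op op_carr gr_const_closed body_op_scalar)
  finally show ?thesis
    using op_carr[of "[]"] by (simp add: degree_part_def gr_const_def)
qed

lemma grading_degree_part: "grading (degree_part l)"
  unfolding grading_def
proof (intro conjI allI ballI impI)
  show "degree_part l k \<subseteq> J k \<inter> par k" for k using degree_part_J degree_part_par by blast
  show "degree_part l k \<inter> J (Suc k) \<subseteq> {\<zero>}" for k using degree_part_inter by blast
  show "x \<oplus> y \<in> degree_part l k" if "x \<in> degree_part l k" "y \<in> degree_part l k" for k x y
    using that l_add_zero by (simp add: degree_part_def)
qed (simp_all add: degree_part_leading degree_part_mult degree_part_op)

end

context graded
begin

definition leading_forms :: "'a \<Rightarrow> nat \<Rightarrow> 'a set" where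
  "leading_forms = (\<lambda>x\<in>carrier R. \<lambda>k. gr_proj R k (component k x))"

lemma leading_forms_eq: "x \<in> carrier R \<Longrightarrow> leading_forms x = (\<lambda>k. gr_proj R k (component k x))"
  by (simp add: leading_forms_def)

lemma component_J: "x \<in> carrier R \<Longrightarrow> component k x \<in> J k"
  using component_G G_J by blast

lemma gr_proj_component_zero_iff:
  assumes "x \<in> carrier R"
  shows "gr_proj R k (component k x) = J (Suc k) \<longleftrightarrow> component k x = \<zero>"
  using assms gr_proj_zero_iff[of "component k x" k] G_inter[OF component_G[OF assms]] J_zero by auto

lemma component_vanish: "x \<in> carrier R \<Longrightarrow> p \<le> k \<Longrightarrow> component k x = \<zero>"
  using component_J J_vanish by blast

lemma leading_forms_closed:
  assumes x: "x \<in> carrier R"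
  shows "leading_forms x \<in> carrier (Gr R)"
proof -
  have "finite {k. gr_proj R k (component k x) \<noteq> J (Suc k)}"
  proof (rule finite_subset[of _ "{..<p}"])
    show "{k. gr_proj R k (component k x) \<noteq> J (Suc k)} \<subseteq> {..<p}"
      using component_vanish[OF x] gr_proj_component_zero_iff[OF x] by (auto simp: not_le[symmetric])
  qed simp
  then show ?thesis
    using component_J[OF x] by (auto simp: Gr_carrier leading_forms_eq[OF x] gr_piece_def)
qed

lemma leading_forms_homogeneous:
  assumes "x \<in> G k"
  shows "leading_forms x = (\<lambda>j. if j = k then gr_proj R k x else J (Suc j))"
  using assms by (intro ext) (simp add: leading_forms_eq G_closed component_homogeneous gr_proj_zero)

lemma leading_forms_hom: "leading_forms \<in> ring_hom R (Gr R)"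
proof (rule ring_hom_memI)
  fix x y assume x: "x \<in> carrier R" and y: "y \<in> carrier R"
  show "leading_forms (x \<oplus> y) = leading_forms x \<oplus>\<^bsub>Gr R\<^esub> leading_forms y"
    using x y by (simp add: leading_forms_eq Gr_add gr_proj_add component_add)
  show "leading_forms (x \<otimes> y) = leading_forms x \<otimes>\<^bsub>Gr R\<^esub> leading_forms y"
  proof
    fix m
    have hom: "(+>) (J (Suc m)) \<in> ring_hom R (R Quot J (Suc m))"
      by (rule ideal.rcos_ring_hom[OF J_ideal])
    interpret Q: ring "R Quot J (Suc m)" by (rule ideal.quotient_is_ring[OF J_ideal])
    have "leading_forms (x \<otimes> y) m = J (Suc m) +> (\<Oplus>i\<in>{..m}. component i x \<otimes> component (m - i) y)"
      using x y by (simp add: leading_forms_eq component_mult gr_proj_def)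
    also have "\<dots> = (\<Oplus>\<^bsub>R Quot J (Suc m)\<^esub>i\<in>{..m}. J (Suc m) +> (component i x \<otimes> component (m - i) y))"
      using x y by (intro ring_hom_finsum[OF ring_axioms Q.ring_axioms hom]) auto
    also have "\<dots> = (\<Oplus>\<^bsub>R Quot J (Suc m)\<^esub>i\<in>{..m}.
        rcoset_mult R (J (Suc m)) (leading_forms x i) (leading_forms y (m - i)))"
    proof (rule Q.finsum_cong'[symmetric])
      fix i assume "i \<in> {..m}"
      then show "rcoset_mult R (J (Suc m)) (leading_forms x i) (leading_forms y (m - i)) =
          J (Suc m) +> (component i x \<otimes> component (m - i) y)"
        using rcoset_mult_gr_proj[OF component_J[OF x] component_J[OF y], of m i "m - i"] x y
        by (simp add: leading_forms_eq gr_proj_def[of R m])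
    qed (use x y ring_hom_closed[OF hom] in auto)
    finally show "leading_forms (x \<otimes> y) m = (leading_forms x \<otimes>\<^bsub>Gr R\<^esub> leading_forms y) m"
      by (simp add: Gr_mult)
  qed
next
  show "leading_forms \<one> = \<one>\<^bsub>Gr R\<^esub>"
    using leading_forms_homogeneous[OF G_scalar, of 1] by (intro ext) (simp add: Gr_one)
qed (rule leading_forms_closed)

lemma leading_forms_zero: "leading_forms \<zero> = \<zero>\<^bsub>Gr R\<^esub>"
  using leading_forms_homogeneous[OF G_zero[of 0]] by (intro ext) (simp add: Gr_zero gr_proj_zero)

lemma leading_forms_bij: "bij_betw leading_forms (carrier R) (carrier (Gr R))"
  unfolding bij_betw_def
proof
  show "inj_on leading_forms (carrier R)"
  proof (rule inj_onI)
    fix x y assume x: "x \<in> carrier R" and y: "y \<in> carrier R" and eq: "leading_forms x = leading_forms y"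
    have "component k (x \<ominus> y) = \<zero>" for k
    proof -
      have "gr_proj R k (component k x) = gr_proj R k (component k y)"
        using fun_cong[OF eq, of k] x y by (simp add: leading_forms_eq)
      then have "component k (x \<ominus> y) \<in> J (Suc k)"
        using x y by (simp add: gr_proj_eq_iff component_minus)
      then show ?thesis using G_inter component_G x y by blast
    qed
    then have "x \<ominus> y = \<zero>"
      using sum_component[of "x \<ominus> y"] x y by simp
    then show "x = y" by (rule eq_if_minus_zero[OF x y])
  qed
  show "leading_forms ` carrier R = carrier (Gr R)"
  proof
    show "carrier (Gr R) \<subseteq> leading_forms ` carrier R"
    proof
      fix F assume F: "F \<in> carrier (Gr R)"
      have "\<exists>y\<in>G k. F k = gr_proj R k y" for k
      proof -
        obtain z where z: "z \<in> J k" "F k = gr_proj R k z"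
          using F gr_piece_obtain unfolding Gr_carrier by blast
        obtain y where y: "y \<in> G k" "z \<ominus> y \<in> J (Suc k)" using G_leading[OF z(1)] .
        then show ?thesis using z gr_proj_eq_iff[of z y k] J_closed G_closed by auto
      qed
      then obtain y where y: "\<And>k. y k \<in> G k" "\<And>k. F k = gr_proj R k (y k)" by metis
      define x where "x = (\<Oplus>k\<in>{..<p}. y k)"
      have x: "x \<in> carrier R" unfolding x_def using y(1) G_closed by (blast intro: finsum_closed)
      have "component k x = y k" for k by (rule component_unique[OF y(1) x_def])
      then have "F = leading_forms x" using x y by (auto simp: leading_forms_eq)
      then show "F \<in> leading_forms ` carrier R" using x by blast
    qed
  qed (use leading_forms_closed in auto)
qed

text \<open>
  The degree-zero parts and the increments of the arguments map to the constant and the nilpotent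
  parts of their images. So the Taylor expansion in R is carried to the one that defines the
  operations of the associated graded ring.
\<close>

lemma leading_forms_op:
  assumes f: "smooth (length as) f" and as: "set as \<subseteq> R0"
  shows "leading_forms (op f as) = smooth_op (Gr R) f (map leading_forms as)"
proof -
  define cs where "cs = map (component 0) as"
  define Ns where "Ns = map (\<lambda>a. a \<ominus> component 0 a) as"
  note dz = degree_zero_part[OF as]
  have len: "length cs = length as" "length Ns = length as" by (simp_all add: cs_def Ns_def)
  have f': "smooth (length cs) f" using f len by simp
  have cs: "set cs \<subseteq> G 0" "set cs \<subseteq> R0" using dz(2,3) by (simp_all add: cs_def)
  have Ns_j: "Ns ! j \<in> R0 \<and> Ns ! j \<in> J (Suc 0)" "as ! j = cs ! j \<oplus> Ns ! j" if "j < length as" for j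
    using dz(4)[of j] dz(5)[of j] that by (simp_all add: cs_def Ns_def)
  have Ns: "set Ns \<subseteq> R0 \<inter> J (Suc 0)" using Ns_j(1) len by (auto simp: in_set_conv_nth)
  have as_eq: "as = map2 (\<oplus>) cs Ns" using Ns_j(2) len by (auto intro!: nth_equalityI)
  have as_carr: "a \<in> carrier R" if "a \<in> set as" for a using that as even_closed by blast
  have op_G: "op (partials js f) cs \<in> G 0" if "set js \<subseteq> {..<length cs}" for js
    using G_op[OF smooth_partials[OF f' that] cs(1)] .
  have const: "leading_forms x = gr_const R (gr_proj R 0 x)" if "x \<in> G 0" for x
    using leading_forms_homogeneous[OF that] by (intro ext) (simp add: gr_const_def)
  have body: "map (\<lambda>F. F 0) (map leading_forms as) = map (gr_proj R 0) cs"
    using as_carr by (auto simp: cs_def leading_forms_eq)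
  have "op f as = taylor R (\<lambda>x. x) op f cs Ns"
    using taylor[OF f' cs(2) _ Ns] len as_eq[symmetric] by simp
  then have "leading_forms (op f as) = leading_forms (taylor R (\<lambda>x. x) op f cs Ns)"
    by (rule arg_cong)
  also have "\<dots> = taylor (Gr R) (gr_const R) (body_op R) f (map (gr_proj R 0) cs)
      (map (\<lambda>F. F(0 := J (Suc 0))) (map leading_forms as))"
  proof (rule ring_hom_taylor[symmetric, OF ring_axioms
        ring_Gr[OF leading_forms_hom leading_forms_bij leading_forms_zero] leading_forms_hom])
    show "inj_on leading_forms (carrier R)" using leading_forms_bij by (simp add: bij_betw_def)
    show "op (partials js f) cs \<in> carrier R" if "set js \<subseteq> {..<length cs}" for js
      using op_G[OF that] G_closed by blast
    show "op (\<lambda>_. 1 / fact n) [] \<in> carrier R" for n :: nat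
      using scalar_closed by (simp add: scalar_def)
    show "Ns ! j \<in> carrier R" if "j < length cs" for j
      using Ns_j that len even_closed by auto
    show "gr_const R (body_op R (partials js f) (map (gr_proj R 0) cs)) = leading_forms (op (partials js f) cs)"
      if "set js \<subseteq> {..<length cs}" for js
      using body_op_gr_proj[OF smooth_partials[OF f' that] cs(2)] const[OF op_G[OF that]] by simp
    show "gr_const R (body_op R (\<lambda>_. 1 / fact n) []) = leading_forms (op (\<lambda>_. 1 / fact n) [])" for n :: nat
      using const[OF G_scalar] by (simp add: body_op_scalar scalar_def[symmetric])
    show "map (\<lambda>F. F(0 := J (Suc 0))) (map leading_forms as) ! j = leading_forms (Ns ! j)"
      if "j < length cs" for j
    proof -
      have j: "j < length as" using that len by simp
      then have a: "as ! j \<in> carrier R" using as_carr by simp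
      have "component k (as ! j \<ominus> component 0 (as ! j)) = (if k = 0 then \<zero> else component k (as ! j))" for k
      proof -
        have "component k (as ! j \<ominus> component 0 (as ! j)) =
            component k (as ! j) \<ominus> component k (component 0 (as ! j))"
          by (rule component_minus[OF a component_closed[OF a]])
        also have "component k (component 0 (as ! j)) = (if k = 0 then component 0 (as ! j) else \<zero>)"
          by (rule component_homogeneous[OF component_G[OF a]])
        finally show ?thesis using a by (simp add: a_minus_def r_neg)
      qed
      then show ?thesis
        using a j by (intro ext) (simp add: Ns_def leading_forms_eq gr_proj_zero)
    qed
  qed simp
  also have "\<dots> = smooth_op (Gr R) f (map leading_forms as)"
    unfolding Gr_op body ..
  finally show ?thesis .
qed

theorem splitting_leading_forms: "splitting R leading_forms"
  unfolding splitting_def cinf_superring_iso_def cinf_superring_hom_def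
proof (intro conjI allI ballI impI)
  show "leading_forms \<in> extensional (carrier R)" by (simp add: leading_forms_def)
  show "leading_forms \<in> ring_hom R (Gr R)" by (rule leading_forms_hom)
  show "bij_betw leading_forms (carrier R) (carrier (Gr R))" by (rule leading_forms_bij)
  have parity: "leading_forms x k = J (Suc k)" if "x \<in> par m" "odd (k + m)" for x k m
    using component_parity[OF that] par_closed[OF that(1)] by (simp add: leading_forms_eq gr_proj_zero)
  show "leading_forms ` R0 \<subseteq> even_part (Gr R)"
    using parity[of _ 0] leading_forms_closed even_closed by (auto simp: par_def Gr_even)
  show "leading_forms ` R1 \<subseteq> odd_part (Gr R)"
    using parity[of _ 1] leading_forms_closed odd_closed by (auto simp: par_def Gr_odd)
  show "leading_forms x k = gr_proj R k x" if x: "x \<in> J k" for k x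
  proof -
    have "gr_proj R k x = gr_proj R k (component k x)"
      using gr_proj_eq_iff minus_component[OF x] J_closed[OF x] by simp
    then show ?thesis using J_closed[OF x] by (simp add: leading_forms_eq)
  qed
qed (rule leading_forms_op)

lemma degree_part_leading_forms: "degree_part leading_forms = G"
proof
  fix k
  show "degree_part leading_forms k = G k"
  proof
    show "G k \<subseteq> degree_part leading_forms k"
      by (auto simp: degree_part_def leading_forms_homogeneous G_closed)
    show "degree_part leading_forms k \<subseteq> G k"
    proof
      fix x assume "x \<in> degree_part leading_forms k"
      then have x: "x \<in> carrier R" "\<And>j. j \<noteq> k \<Longrightarrow> gr_proj R j (component j x) = J (Suc j)"
        by (auto simp: degree_part_def leading_forms_eq)
      then show "x \<in> G k" using gr_proj_component_zero_iff[OF x(1)] by (intro G_if_components) auto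
    qed
  qed
qed

end

context nilpotent_taylor
begin

theorem bij_betw_degree_part: "bij_betw degree_part {l. splitting R l} {G. grading G}"
  unfolding bij_betw_def
proof
  show "inj_on degree_part {l. splitting R l}"
  proof (rule inj_onI, unfold mem_Collect_eq)
    fix l l' assume l: "splitting R l" and l': "splitting R l'" and eq: "degree_part l = degree_part l'"
    interpret l: split_map R p l using l by unfold_locales
    interpret l': split_map R p l' using l' by unfold_locales
    interpret graded R p "degree_part l" using l.grading_degree_part by unfold_locales
    show "l = l'"
    proof (rule extensionalityI[OF l.l_ext l'.l_ext])
      fix x assume "x \<in> carrier R"
      then have "x \<in> J 0" by simp
      then show "l x = l' x"
      proof (induction rule: homogeneous_induct)
        case (homogeneous k y)
        then have y: "y \<in> degree_part l k" "y \<in> degree_part l' k" using eq by simp_all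
        show ?case
        proof
          fix j show "l y j = l' y j"
            using l.degree_part_D(2)[OF y(1), of j] l'.degree_part_D(2)[OF y(2), of j]
              l.l_proj[OF G_J[OF y(1)]] l'.l_proj[OF G_J[OF y(1)]] by (cases "j = k") auto
        qed
      next
        case (add y z)
        then show ?case using J_closed l.l_add l'.l_add by (intro ext) metis
      qed
    qed
  qed
  show "degree_part ` {l. splitting R l} = {G. grading G}"
  proof
    show "degree_part ` {l. splitting R l} \<subseteq> {G. grading G}"
    proof
      fix G assume "G \<in> degree_part ` {l. splitting R l}"
      then obtain l where "splitting R l" and G: "G = degree_part l" by blast
      then interpret split_map R p l by unfold_locales
      show "G \<in> {G. grading G}" using grading_degree_part G by simp
    qed
    show "{G. grading G} \<subseteq> degree_part ` {l. splitting R l}"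
    proof
      fix G assume "G \<in> {G. grading G}"
      then interpret graded R p G by unfold_locales simp
      show "G \<in> degree_part ` {l. splitting R l}"
        using splitting_leading_forms degree_part_leading_forms by (intro image_eqI[of _ _ leading_forms]) auto
    qed
  qed
qed

end

section \<open>The correspondence\<close>

theorem proposition3p44:
  fixes R :: "'a cinf_superstructure"
  assumes "cinf_superring R"
    and "is_split TYPE('c) R"
  shows "\<exists>\<Psi>. bij_betw \<Psi> {E. euler_vector_field R E} {l. splitting R l}"
proof -
  obtain C :: "'c set" and \<phi> q h where "cinf_ring C \<phi>" "cinf_superring_iso R (grassmann C \<phi> q) h"
    using assms(2) unfolding is_split_def by blast
  moreover have "superring R" using assms(1) unfolding cinf_superring_def by blast
  moreover from this have "ring R" unfolding superring_def by blast
  ultimately interpret S: split_presentation R C \<phi> q h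
    using assms(1) by (simp add: split_presentation_def split_presentation_axioms_def cinf_super_def
        cinf_super_axioms_def supercommutative_def supercommutative_axioms_def)
  interpret nilpotent_taylor R "Suc q"
    using S.J_nilpotent S.taylor_formula by unfold_locales auto
  show ?thesis
    using bij_betw_trans[OF bij_betw_eigenspace bij_betw_inv_into[OF bij_betw_degree_part]] by blast
qed

end
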